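(* Suppose $\gamma\in-\mathbb N$. Then there exists a polynomial $Q\in\mathbb R[X]$ of degree $-\gamma$ and a constant $c$ such that the Laplace transform $\phi_1$ of the lateral invariant measure $\boldsymbol\nu_1$ satisfies $$\phi_1(y)=\frac{c}{Q(y)}\qquad(\mathfrak{Re}(y)\le0).$$ Here, $Q$ is given by $$Q(y)=\prod_{k=0}^{-\gamma-1}\bigl(y-\mathrm y(s_1-k)\bigr).$$
   Context: $\mathbb N=\{1,2,3,\dots\}$. Parameters: $r_1,r_2\in\mathbb R$ and $\mu_1,\mu_2>0$ with $\mu_1+\mu_2=1$, such that ($1-r_1r_2>0$, or $r_1>0$ and $r_2>0$), $\mu_1-r_2\mu_2>0$, $\mu_2-r_1\mu_1>0$, $r_1\neq -1$ and $r_2\neq -1$. Process: $\mathbf G=(G_1,G_2)$ is the degenerate obliquely reflected Brownian motion in $\mathbb R_+^2$, i.e. the continuous semimartingale with values in $\mathbb R_+^2$ satisfying $$G_1(t)=G_1(0)-\mu_1t+\widetilde W_1(t)+L_1(t)+r_2L_2(t),\qquad G_2(t)=G_2(0)-\mu_2t+\widetilde W_2(t)+r_1L_1(t)+L_2(t),$$ where $(\widetilde W_1,\widetilde W_2)$ is a centered Brownian motion with (singular) covariance matrix $\begin{pmatrix}1&-1\\-1&1\end{pmatrix}$ and $L_i$ (the local time of $G_i$ at $0$) is continuous, nondecreasing, $L_i(0)=0$, and increases only when $G_i=0$. Under the assumptions above this process is positive recurrent with a unique invariant probability measure $\boldsymbol\pi$. For Borel $A\subset(0,\infty)$, $\boldsymbol\nu_1(A)=\mathbb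 E_{\boldsymbol\pi}\int_0^2\mathbf 1_A(G_2(t))\,\mathrm dL_1(t)$, and $\phi_1(y)=\int_{(0,\infty)}e^{yv}\,\boldsymbol\nu_1(\mathrm dv)$ for $\mathfrak{Re}(y)\le0$. Further notation: $\mathrm y(s)=2s(s-\mu_1)$, $s_1=\dfrac{r_1\mu_1-\mu_2}{1+r_1}$, $s_2=\dfrac{\mu_1-r_2\mu_2}{1+r_2}$, $\gamma=s_2-s_1=\dfrac{1-r_1r_2}{(1+r_1)(1+r_2)}$. *)

theory Defs
  imports "HOL-Probability.Probability" "HOL-Computational_Algebra.Polynomial"
begin

text \<open>
  The law \<open>N(0, v)\<close> is rendered as the law of \<open>sqrt v * Z\<close> with \<open>Z\<close> standard normal, so that
  \<open>v = 0\<close> gives the point mass at \<open>0\<close>; this is needed for singular covariance matrices.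
\<close>

definition centered_gaussian_vector ::
    "'a measure \<Rightarrow> real^'n^'n \<Rightarrow> ('a \<Rightarrow> real^'n) \<Rightarrow> bool" where
  "centered_gaussian_vector M \<Sigma> X \<longleftrightarrow>
     X \<in> borel_measurable M \<and>
     (\<forall>a. distr M borel (\<lambda>\<omega>. a \<bullet> X \<omega>) =
          distr std_normal_distribution borel (\<lambda>z. sqrt (a \<bullet> (\<Sigma> *v a)) * z))"

text \<open>
  Time is the half-line \<open>t \<ge> 0\<close>. All processes and filtrations are indexed by \<^typ>\<open>real\<close>, and their
  values at negative times play no role.
\<close>

locale filtered_prob_space = prob_space M + filtration "space M" F
  for M :: "'a measure" and F :: "real \<Rightarrow> 'a measure" +
  assumes F_subalgebra: "\<And>t. subalgebra M (F t)"

locale brownian_motion = filtered_prob_space M F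
  for M :: "'a measure" and F :: "real \<Rightarrow> 'a measure"
    and \<Sigma> :: "real^'n^'n" and W :: "real \<Rightarrow> 'a \<Rightarrow> real^'n" +
  assumes W_adapted: "\<And>t. 0 \<le> t \<Longrightarrow> W t \<in> borel_measurable (F t)"
    and W_zero: "AE \<omega> in M. W 0 \<omega> = 0"
    and W_continuous: "AE \<omega> in M. continuous_on {0..} (\<lambda>t. W t \<omega>)"
    and W_increment_indep: "\<And>s t. 0 \<le> s \<Longrightarrow> s \<le> t \<Longrightarrow>
      indep_set (sets (F s)) (sets (vimage_algebra (space M) (\<lambda>\<omega>. W t \<omega> - W s \<omega>) borel))"
    and W_increment_gaussian: "\<And>s t. 0 \<le> s \<Longrightarrow> s \<le> t \<Longrightarrow>
      centered_gaussian_vector M ((t - s) *\<^sub>R \<Sigma>) (\<lambda>\<omega>. W t \<omega> - W s \<omega>)"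

text \<open>
  The Lebesgue--Stieltjes measure \<open>dl\<close> of a continuous nondecreasing path \<open>l\<close> on \<open>[0, \<infinity>)\<close>. The path
  is continued by \<open>l 0\<close> to the left of \<open>0\<close>, so negative times carry no mass.
\<close>

definition path_measure :: "(real \<Rightarrow> real) \<Rightarrow> real measure" where
  "path_measure l = interval_measure (\<lambda>t. l (max 0 t))"

locale degenerate_reflected_bm =
  brownian_motion M F "vector [vector [1, -1], vector [-1, 1]] :: real^2^2" W
  for M :: "'a measure" and F :: "real \<Rightarrow> 'a measure" and W :: "real \<Rightarrow> 'a \<Rightarrow> real^2" +
  fixes r1 r2 \<mu>1 \<mu>2 :: real
    and G L :: "real \<Rightarrow> 'a \<Rightarrow> real^2"
  assumes G_adapted: "\<And>t. 0 \<le> t \<Longrightarrow> G t \<in> borel_measurable (F t)"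
    and L_adapted: "\<And>t. 0 \<le> t \<Longrightarrow> L t \<in> borel_measurable (F t)"
    and G_continuous: "AE \<omega> in M. continuous_on {0..} (\<lambda>t. G t \<omega>)"
    and G_quadrant: "AE \<omega> in M. \<forall>t\<ge>0. \<forall>i. 0 \<le> G t \<omega> $ i"
    and G_equation1: "AE \<omega> in M. \<forall>t\<ge>0.
      G t \<omega> $ 1 = G 0 \<omega> $ 1 - \<mu>1 * t + W t \<omega> $ 1 + L t \<omega> $ 1 + r2 * L t \<omega> $ 2"
    and G_equation2: "AE \<omega> in M. \<forall>t\<ge>0.
      G t \<omega> $ 2 = G 0 \<omega> $ 2 - \<mu>2 * t + W t \<omega> $ 2 + r1 * L t \<omega> $ 1 + L t \<omega> $ 2"
    and L_zero: "AE \<omega> in M. L 0 \<omega> = 0"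
    and L_continuous: "AE \<omega> in M. continuous_on {0..} (\<lambda>t. L t \<omega>)"
    and L_mono: "AE \<omega> in M. \<forall>i. mono_on {0..} (\<lambda>t. L t \<omega> $ i)"
    and L_support: "AE \<omega> in M. \<forall>i.
      emeasure (path_measure (\<lambda>t. L t \<omega> $ i)) {t. 0 \<le> t \<and> G t \<omega> $ i \<noteq> 0} = 0"

text \<open>
  The case \<open>t = 0\<close> says that \<open>G\<close> is started from \<open>\<pi>\<close>, the others that \<open>\<pi>\<close> is invariant;
  expectations with respect to \<open>M\<close> are then the expectations \<open>E\<^sub>\<pi>\<close>.
\<close>

definition started_from_invariant ::
    "'a measure \<Rightarrow> (real \<Rightarrow> 'a \<Rightarrow> real^2) \<Rightarrow> (real^2) measure \<Rightarrow> bool" where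
  "started_from_invariant M G \<pi> \<longleftrightarrow>
     (\<forall>t\<ge>0. distr M borel (G t) = \<pi>)"

definition lateral_measure1 ::
    "'a measure \<Rightarrow> (real \<Rightarrow> 'a \<Rightarrow> real^2) \<Rightarrow> (real \<Rightarrow> 'a \<Rightarrow> real^2) \<Rightarrow> real measure" where
  "lateral_measure1 M G L =
     measure_of {0<..} (sets (restrict_space borel {0<..}))
       (\<lambda>A. \<integral>\<^sup>+ \<omega>. (\<integral>\<^sup>+ t\<in>{0..2}. indicator A (G t \<omega> $ 2) \<partial>path_measure (\<lambda>t. L t \<omega> $ 1)) \<partial>M)"

definition laplace_transform :: "real measure \<Rightarrow> complex \<Rightarrow> complex" where
  "laplace_transform \<nu> y = (LINT v|\<nu>. exp (y * of_real v))"

definition y_curve :: "real \<Rightarrow> real \<Rightarrow> real" where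
  "y_curve \<mu>1 s = 2 * s * (s - \<mu>1)"

definition s_one :: "real \<Rightarrow> real \<Rightarrow> real \<Rightarrow> real" where
  "s_one r1 \<mu>1 \<mu>2 = (r1 * \<mu>1 - \<mu>2) / (1 + r1)"

definition s_two :: "real \<Rightarrow> real \<Rightarrow> real \<Rightarrow> real" where
  "s_two r2 \<mu>1 \<mu>2 = (\<mu>1 - r2 * \<mu>2) / (1 + r2)"

definition gamma_par :: "real \<Rightarrow> real \<Rightarrow> real \<Rightarrow> real \<Rightarrow> real" where
  "gamma_par r1 r2 \<mu>1 \<mu>2 = s_two r2 \<mu>1 \<mu>2 - s_one r1 \<mu>1 \<mu>2"

lemma gamma_par_eq:
  assumes "\<mu>1 + \<mu>2 = 1" "r1 \<noteq> -1" "r2 \<noteq> -1"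
  shows "gamma_par r1 r2 \<mu>1 \<mu>2 = (1 - r1 * r2) / ((1 + r1) * (1 + r2))"
proof -
  have m: "\<mu>2 = 1 - \<mu>1" using assms(1) by simp
  have nz: "1 + r1 \<noteq> 0" "1 + r2 \<noteq> 0" using assms(2,3) by auto
  show ?thesis
    unfolding gamma_par_def s_one_def s_two_def m
    using nz by (simp add: diff_frac_eq) (simp add: algebra_simps)
qed

end

theory Submission
  imports Defs "HOL-Complex_Analysis.Complex_Analysis" "HOL-Real_Asymp.Real_Asymp"
begin

text \<open>
  Write \<open>\<Phi>\<^sub>1(y) = E \<integral>\<^sub>0\<^sup>2 exp(y G\<^sub>2) dL\<^sub>1\<close> and \<open>\<Phi>\<^sub>2(x) = E \<integral>\<^sub>0\<^sup>2 exp(x G\<^sub>1) dL\<^sub>2\<close>, corner included,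
  and \<open>\<phi>(x, y) = E exp(x G\<^sub>1 + y G\<^sub>2)\<close> for the stationary process. Stationarity gives the functional
  equation
  \<open>((x - y)\<^sup>2 - 2(\<mu>\<^sub>1 x + \<mu>\<^sub>2 y)) \<phi>(x, y) + (x + r\<^sub>1 y) \<Phi>\<^sub>1(y) + (r\<^sub>2 x + y) \<Phi>\<^sub>2(x) = 0\<close>
  on \<open>Re x \<le> 0, Re y \<le> 0\<close> (\<open>adjoint_relation\<close>). The kernel vanishes on the rational curve
  \<open>x(s) = 2s(s + \<mu>\<^sub>2)\<close>, \<open>y(s) = 2s(s - \<mu>\<^sub>1)\<close>, where the equation becomes
  \<open>(1 + r\<^sub>1)(s - s\<^sub>1) \<Phi>\<^sub>1(y(s)) + (1 + r\<^sub>2)(s - s\<^sub>2) \<Phi>\<^sub>2(x(s)) = 0\<close> (\<open>curve_relation\<close>).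

  The map \<open>y\<close> is invariant under \<open>s \<mapsto> \<mu>\<^sub>1 - s\<close> and \<open>x\<close> under \<open>s \<mapsto> -\<mu>\<^sub>2 - s\<close>; since
  \<open>\<mu>\<^sub>1 + \<mu>\<^sub>2 = 1\<close> these point reflections compose to the unit shift. When \<open>s\<^sub>2 = s\<^sub>1 - n\<close>, multiplying
  the two boundary transforms by suitable polynomials of degree \<open>2n\<close> in \<open>s\<close>, each respecting its own
  reflection, turns the relation into an equality on the imaginary axis. The \<open>\<Phi>\<^sub>1\<close> side lives
  on the strip \<open>0 \<le> Re s \<le> \<mu>\<^sub>1\<close>, the \<open>\<Phi>\<^sub>2\<close> side on \<open>-\<mu>\<^sub>2 \<le> Re s \<le> 0\<close>, and the two strips together have width
  exactly one. They glue to an entire function of period one and polynomial growth, that is, a constant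
  (\<open>reflected_strip_functions_constant\<close>). Hence \<open>\<Phi>\<^sub>1(y) Q(y)\<close> is constant. As \<open>Q\<close> has positive degree,
  \<open>\<Phi>\<^sub>1(y)\<close> tends to \<open>0\<close> as \<open>y\<close> tends to \<open>-\<infinity>\<close>, so the corner carries no mass of \<open>dL\<^sub>1\<close>
  and \<open>\<Phi>\<^sub>1\<close> is the Laplace transform of the lateral measure.

  The functional equation needs no stochastic integration. For imaginary \<open>x, y\<close> the increment of the
  exponential over a time step has a closed form, because the Brownian increment is Gaussian and independent
  of the past (\<open>one_step_identity\<close>); summing over a grid and refining it gives the equation
  there (\<open>adjoint_relation_imaginary\<close>). The domination is supplied by \<open>E L\<^sub>i(2) < \<infinity>\<close>, which follows from
  stationarity (\<open>integrable_stationary_increment\<close>) and the invertibility of the reflection matrix. From the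
  imaginary axes the equation spreads to the half-planes because a function that is continuous on the closed left
  half-plane, holomorphic inside and zero on the boundary line vanishes.
\<close>

no_notation fps_nth (infixl "$" 75)

section \<open>Laplace transforms on the left half-plane\<close>

text \<open>
  The weight \<open>g\<close> is there for transforms in two variables: one exponential is frozen into \<open>g\<close>
  while the other variable moves.
\<close>

lemma laplace_weighted_integrable:
  fixes X :: "'b \<Rightarrow> real" and g :: "'b \<Rightarrow> complex"
  assumes "finite_measure N" and [measurable]: "X \<in> borel_measurable N" "g \<in> borel_measurable N"
    and "\<And>x. x \<in> space N \<Longrightarrow> 0 \<le> X x" "\<And>x. x \<in> space N \<Longrightarrow> norm (g x) \<le> 1" "Re z \<le> 0"
  shows "integrable N (\<lambda>x. exp (z * of_real (X x)) * g x)"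
proof -
  interpret finite_measure N by fact
  show ?thesis
  proof (rule integrable_const_bound[where B = 1])
    show "AE x in N. norm (exp (z * of_real (X x)) * g x) \<le> 1"
    proof (rule AE_I2)
      fix x assume "x \<in> space N"
      then have "Re z * X x \<le> 0" "norm (g x) \<le> 1"
        using assms by (auto simp: mult_nonpos_nonneg)
      then show "norm (exp (z * of_real (X x)) * g x) \<le> 1"
        by (simp add: norm_mult mult_le_one)
    qed
  qed measurable
qed

lemma laplace_weighted_norm_le:
  fixes X :: "'b \<Rightarrow> real" and g :: "'b \<Rightarrow> complex"
  assumes "finite_measure N" and [measurable]: "X \<in> borel_measurable N" "g \<in> borel_measurable N"
    and "\<And>x. x \<in> space N \<Longrightarrow> 0 \<le> X x" "\<And>x. x \<in> space N \<Longrightarrow> norm (g x) \<le> 1" "Re z \<le> 0"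
  shows "norm (\<integral>x. exp (z * of_real (X x)) * g x \<partial>N) \<le> measure N (space N)"
proof -
  interpret finite_measure N by fact
  have "norm (\<integral>x. exp (z * of_real (X x)) * g x \<partial>N) \<le> (\<integral>x. norm (exp (z * of_real (X x)) * g x) \<partial>N)"
    by (rule integral_norm_bound)
  also have "\<dots> \<le> (\<integral>x. 1 \<partial>N)"
  proof (rule integral_mono)
    fix x assume "x \<in> space N"
    then have "Re z * X x \<le> 0" "norm (g x) \<le> 1"
      using assms by (auto simp: mult_nonpos_nonneg)
    then show "norm (exp (z * of_real (X x)) * g x) \<le> 1"
      by (simp add: norm_mult mult_le_one)
  qed (use laplace_weighted_integrable[OF assms] in auto)
  finally show ?thesis by simp
qed

lemma laplace_weighted_continuous_on:
  fixes X :: "'b \<Rightarrow> real" and g :: "'b \<Rightarrow> complex"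
  assumes "finite_measure N" and [measurable]: "X \<in> borel_measurable N" "g \<in> borel_measurable N"
    and "\<And>x. x \<in> space N \<Longrightarrow> 0 \<le> X x" "\<And>x. x \<in> space N \<Longrightarrow> norm (g x) \<le> 1"
  shows "continuous_on {z. Re z \<le> 0} (\<lambda>z. \<integral>x. exp (z * of_real (X x)) * g x \<partial>N)"
proof -
  interpret finite_measure N by fact
  show ?thesis
  proof (rule continuous_on_sequentiallyI)
    fix u :: "nat \<Rightarrow> complex" and z :: complex
    assume u: "\<forall>n. u n \<in> {z. Re z \<le> 0}" and z: "z \<in> {z. Re z \<le> 0}" and lim: "u \<longlonglongrightarrow> z"
    show "(\<lambda>n. \<integral>x. exp (u n * of_real (X x)) * g x \<partial>N) \<longlonglongrightarrow> (\<integral>x. exp (z * of_real (X x)) * g x \<partial>N)"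
    proof (rule integral_dominated_convergence[where w = "\<lambda>_. 1"])
      show "AE x in N. (\<lambda>n. exp (u n * of_real (X x)) * g x) \<longlonglongrightarrow> exp (z * of_real (X x)) * g x"
        by (intro AE_I2 tendsto_intros lim)
      show "AE x in N. norm (exp (u n * of_real (X x)) * g x) \<le> 1" for n
      proof (rule AE_I2)
        fix x assume "x \<in> space N"
        then have "Re (u n) * X x \<le> 0" "norm (g x) \<le> 1"
          using assms u by (auto simp: mult_nonpos_nonneg)
        then show "norm (exp (u n * of_real (X x)) * g x) \<le> 1"
          by (simp add: norm_mult mult_le_one)
      qed
    qed auto
  qed
qed

text \<open>
  The derivative is taken under the integral. On \<open>Re w \<le> -e\<close> the function \<open>w \<mapsto> exp(w v)\<close> has
  derivative of modulus at most \<open>v exp(-e v) \<le> 1/e\<close>, uniformly in \<open>v \<ge> 0\<close>, so the difference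
  quotients have a constant bound.
\<close>

lemma laplace_weighted_holomorphic_on:
  fixes X :: "'b \<Rightarrow> real" and g :: "'b \<Rightarrow> complex"
  assumes "finite_measure N" and [measurable]: "X \<in> borel_measurable N" "g \<in> borel_measurable N"
    and X: "\<And>x. x \<in> space N \<Longrightarrow> 0 \<le> X x" and g: "\<And>x. x \<in> space N \<Longrightarrow> norm (g x) \<le> 1"
  shows "(\<lambda>z. \<integral>x. exp (z * of_real (X x)) * g x \<partial>N) holomorphic_on {z. Re z < 0}"
proof -
  interpret finite_measure N by fact
  let ?F = "\<lambda>z. \<integral>x. exp (z * of_real (X x)) * g x \<partial>N"
  have "(?F has_field_derivative (\<integral>x. of_real (X x) * exp (z * of_real (X x)) * g x \<partial>N)) (at z)"
    if z: "Re z < 0" for z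
  proof -
    define e where "e = - Re z / 2"
    have e: "e > 0" and ez: "Re z \<le> - e" using z by (auto simp: e_def)
    have quot: "norm ((exp (w * of_real v) - exp (z * of_real v)) / (w - z)) \<le> 1 / e"
      if "Re w \<le> - e" "0 \<le> v" for w :: complex and v :: real
    proof -
      have "norm (exp (w * of_real v) - exp (z * of_real v)) \<le> 1 / e * norm (w - z)"
      proof (rule field_differentiable_bound[where S = "{w. Re w \<le> - e}" and
            f' = "\<lambda>w. of_real v * exp (w * of_real v)"])
        fix a :: complex assume a: "a \<in> {w. Re w \<le> - e}"
        show "((\<lambda>w. exp (w * of_real v)) has_field_derivative of_real v * exp (a * of_real v))
            (at a within {w. Re w \<le> - e})"
          by (auto intro!: derivative_eq_intros)
        have "norm (of_real v * exp (a * of_real v)) = v * exp (Re a * v)"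
          using that by (simp add: norm_mult)
        also have "\<dots> \<le> v * exp (- (e * v))"
          using a that mult_right_mono[of "Re a" "-e" v] by (intro mult_left_mono) auto
        also have "\<dots> \<le> 1 / e"
        proof -
          have "e * v \<le> exp (e * v)" using exp_ge_add_one_self[of "e * v"] by linarith
          then show ?thesis using e by (simp add: exp_minus field_simps)
        qed
        finally show "norm (of_real v * exp (a * of_real v)) \<le> 1 / e" .
      qed (use that ez in \<open>auto intro: convex_halfspace_Re_le\<close>)
      then show ?thesis
        by (cases "w = z") (use e in \<open>auto simp: norm_divide divide_simps\<close>)
    qed
    show ?thesis
      unfolding has_field_derivative_iff
    proof (subst tendsto_at_iff_sequentially, intro allI impI)
      fix u :: "nat \<Rightarrow> complex"
      assume u: "\<forall>i. u i \<in> UNIV - {z}" and lim: "u \<longlonglongrightarrow> z"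
      have "eventually (\<lambda>i. Re (u i) < - e) sequentially"
        using tendsto_Re[OF lim] order_tendstoD(2)[of "\<lambda>i. Re (u i)" "Re z" sequentially "-e"] z
        by (simp add: e_def)
      then obtain i0 where i0: "\<And>i. i \<ge> i0 \<Longrightarrow> Re (u i) \<le> - e"
        by (auto simp: eventually_sequentially intro: less_imp_le)
      let ?q = "\<lambda>i x. (exp (u (i + i0) * of_real (X x)) - exp (z * of_real (X x))) / (u (i + i0) - z) * g x"
      have "(\<lambda>i. \<integral>x. ?q i x \<partial>N) \<longlonglongrightarrow> (\<integral>x. of_real (X x) * exp (z * of_real (X x)) * g x \<partial>N)"
      proof (rule integral_dominated_convergence[where w = "\<lambda>_. 1 / e"])
        show "AE x in N. (\<lambda>i. ?q i x) \<longlonglongrightarrow> of_real (X x) * exp (z * of_real (X x)) * g x"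
        proof (intro AE_I2 tendsto_mult tendsto_const)
          fix x
          have "((\<lambda>w. exp (w * of_real (X x))) has_field_derivative of_real (X x) * exp (z * of_real (X x))) (at z)"
            by (auto intro!: derivative_eq_intros)
          then have "(\<lambda>i. (exp (u i * of_real (X x)) - exp (z * of_real (X x))) / (u i - z))
              \<longlonglongrightarrow> of_real (X x) * exp (z * of_real (X x))"
            unfolding has_field_derivative_iff tendsto_at_iff_sequentially comp_def
            using u lim by blast
          then show "(\<lambda>i. (exp (u (i + i0) * of_real (X x)) - exp (z * of_real (X x))) / (u (i + i0) - z))
              \<longlonglongrightarrow> of_real (X x) * exp (z * of_real (X x))"
            by (rule LIMSEQ_ignore_initial_segment)
        qed
        show "AE x in N. norm (?q i x) \<le> 1 / e" for i
        proof (rule AE_I2)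
          fix x assume x: "x \<in> space N"
          have "norm (?q i x) \<le> (1 / e) * 1"
            unfolding norm_mult using quot[OF i0 X[OF x], of "i + i0"] g[OF x] e
            by (intro mult_mono) auto
          then show "norm (?q i x) \<le> 1 / e" by simp
        qed
      qed auto
      also have "(\<lambda>i. \<integral>x. ?q i x \<partial>N) = (\<lambda>i. (?F (u (i + i0)) - ?F z) / (u (i + i0) - z))"
      proof
        fix i
        have "integrable N (\<lambda>x. exp (u (i + i0) * of_real (X x)) * g x)"
          using i0[of "i + i0"] e by (intro laplace_weighted_integrable assms) auto
        moreover have "integrable N (\<lambda>x. exp (z * of_real (X x)) * g x)"
          using z by (intro laplace_weighted_integrable assms) auto
        ultimately have "(?F (u (i + i0)) - ?F z) / (u (i + i0) - z) =
          (\<integral>x. (exp (u (i + i0) * of_real (X x)) * g x - exp (z * of_real (X x)) * g x) / (u (i + i0) - z) \<partial>N)"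
          by simp
        also have "\<dots> = (\<integral>x. ?q i x \<partial>N)"
          by (intro Bochner_Integration.integral_cong) (auto simp: algebra_simps diff_divide_distrib)
        finally show "(\<integral>x. ?q i x \<partial>N) = (?F (u (i + i0)) - ?F z) / (u (i + i0) - z)" ..
      qed
      finally show "((\<lambda>y. (?F y - ?F z) / (y - z)) \<circ> u) \<longlonglongrightarrow>
          (\<integral>x. of_real (X x) * exp (z * of_real (X x)) * g x \<partial>N)"
        unfolding comp_def by (rule LIMSEQ_offset)
    qed
  qed
  then show ?thesis
    by (auto simp: holomorphic_on_open open_halfspace_Re_lt)
qed

text \<open>
  Extended by zero to the right half-plane, \<open>f\<close> remains continuous, hence is entire by Morera's theorem,
  and it vanishes on an open set.
\<close>

lemma zero_on_left_half_plane_if_zero_on_axis: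
  assumes cont: "continuous_on {z. Re z \<le> 0} f" and hol: "f holomorphic_on {z. Re z < 0}"
    and zero: "\<And>z. Re z = 0 \<Longrightarrow> f z = 0" and z: "Re z \<le> 0"
  shows "f z = (0 :: complex)"
proof -
  define F where "F = (\<lambda>z. if Re z \<le> 0 then f z else 0)"
  have contF: "continuous_on UNIV F"
  proof -
    have "continuous_on ({z. Re z \<le> 0} \<union> {z. 0 \<le> Re z}) F"
      unfolding F_def
      by (intro continuous_on_If cont continuous_on_const closed_halfspace_Re_le closed_halfspace_Re_ge)
        (auto intro: zero)
    moreover have "{z. Re z \<le> 0} \<union> {z. 0 \<le> Re z} = UNIV" by auto
    ultimately show ?thesis by simp
  qed
  have "F holomorphic_on UNIV"
  proof (rule holomorphic_on_paste_across_line[where d = 1 and k = 0])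
    show "F holomorphic_on UNIV \<inter> {z. 1 \<bullet> z < 0}"
      by (rule holomorphic_transform[of f]) (auto simp: F_def inner_complex_def intro: holomorphic_on_subset[OF hol])
    show "F holomorphic_on UNIV \<inter> {z. 0 < 1 \<bullet> z}"
      by (rule holomorphic_transform[of "\<lambda>_. 0"]) (auto simp: F_def inner_complex_def)
  qed (use contF in auto)
  moreover have "{z. 0 < Re z} \<noteq> {}" by (metis (mono_tags) empty_iff mem_Collect_eq one_complex.sel(1) zero_less_one)
  ultimately have "F z = 0"
    using analytic_continuation_open[of "{z. 0 < Re z}" UNIV F "\<lambda>_. 0" z]
    by (auto simp: open_halfspace_Re_gt F_def connected_UNIV)
  then show ?thesis using z by (simp add: F_def)
qed

section \<open>Gluing two reflected strips\<close>

text \<open>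
  The composition of the point reflections about \<open>\<alpha>/2\<close> and \<open>-\<beta>/2\<close> is the shift by \<open>\<alpha> + \<beta> = 1\<close>.
  Together with the matching on the imaginary axis this makes \<open>hA\<close> on the line \<open>Re s = \<alpha>\<close> agree with \<open>hB\<close>
  on \<open>Re s = -\<beta>\<close>, so the two functions define an entire function of period one. By Liouville it is a
  polynomial, and a periodic polynomial is constant.
\<close>

lemma reflected_strip_functions_constant:
  fixes hA hB :: "complex \<Rightarrow> complex" and \<alpha> \<beta> :: real
  assumes "\<alpha> > 0" "\<beta> > 0" "\<alpha> + \<beta> = 1"
    and contA: "continuous_on {s. 0 \<le> Re s \<and> Re s \<le> \<alpha>} hA"
    and holA: "hA holomorphic_on {s. 0 < Re s \<and> Re s < \<alpha>}"
    and contB: "continuous_on {s. -\<beta> \<le> Re s \<and> Re s \<le> 0} hB"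
    and holB: "hB holomorphic_on {s. -\<beta> < Re s \<and> Re s < 0}"
    and reflA: "\<And>s. hA (of_real \<alpha> - s) = hA s"
    and reflB: "\<And>s. hB (- of_real \<beta> - s) = hB s"
    and match: "\<And>s. Re s = 0 \<Longrightarrow> hA s = hB s"
    and growthA: "\<And>s. 0 \<le> Re s \<Longrightarrow> Re s \<le> \<alpha> \<Longrightarrow> norm (hA s) \<le> C * (1 + norm s) ^ m"
    and growthB: "\<And>s. -\<beta> \<le> Re s \<Longrightarrow> Re s \<le> 0 \<Longrightarrow> norm (hB s) \<le> C * (1 + norm s) ^ m"
  obtains c where "\<And>s. 0 \<le> Re s \<Longrightarrow> Re s \<le> \<alpha> \<Longrightarrow> hA s = c"
proof -
  \<comment> \<open>The two overlapping pieces: \<open>F1\<close> crosses the imaginary axis, \<open>F2\<close> crosses the line \<open>Re s = \<alpha>\<close>.\<close>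
  define F1 where "F1 = (\<lambda>s. if Re s \<le> 0 then hB s else hA s)"
  define F2 where "F2 = (\<lambda>s. if Re s \<le> \<alpha> then hA s else hB (s - 1))"
  define F where "F = (\<lambda>s. F2 (s - of_int \<lfloor>Re s\<rfloor>))"
  have openstrip: "open {s. a < Re s \<and> Re s < b}" for a b :: real
  proof -
    have "{s. a < Re s \<and> Re s < b} = {s. a < Re s} \<inter> {s. Re s < b}" by auto
    then show ?thesis by (simp add: open_Int open_halfspace_Re_gt open_halfspace_Re_lt)
  qed
  have closedstrip: "closed {s. a \<le> Re s \<and> Re s \<le> b}" for a b :: real
  proof -
    have "{s. a \<le> Re s \<and> Re s \<le> b} = {s. a \<le> Re s} \<inter> {s. Re s \<le> b}" by auto
    then show ?thesis by (simp add: closed_Int closed_halfspace_Re_ge closed_halfspace_Re_le)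
  qed
  have matchA: "hA s = hB (s - 1)" if "Re s = \<alpha>" for s
  proof -
    have "hA s = hA (of_real \<alpha> - s)" by (rule reflA[symmetric])
    also have "\<dots> = hB (of_real \<alpha> - s)" using that by (intro match) auto
    also have "\<dots> = hB (- of_real \<beta> - (of_real \<alpha> - s))" by (rule reflB[symmetric])
    also have "- of_real \<beta> - (of_real \<alpha> - s) = s - of_real (\<alpha> + \<beta>)" by simp
    finally show ?thesis by (simp add: assms(3))
  qed
  have F1: "F1 holomorphic_on {s. -\<beta> < Re s \<and> Re s < \<alpha>}"
  proof (rule holomorphic_on_paste_across_line[where d = 1 and k = 0, OF openstrip])
    show "F1 holomorphic_on {s. -\<beta> < Re s \<and> Re s < \<alpha>} \<inter> {z. 1 \<bullet> z < 0}"
      by (rule holomorphic_transform[of hB])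
        (auto simp: F1_def inner_complex_def intro!: holomorphic_on_subset[OF holB])
    show "F1 holomorphic_on {s. -\<beta> < Re s \<and> Re s < \<alpha>} \<inter> {z. 0 < 1 \<bullet> z}"
      by (rule holomorphic_transform[of hA])
        (auto simp: F1_def inner_complex_def intro!: holomorphic_on_subset[OF holA])
    have "continuous_on ({s. -\<beta> \<le> Re s \<and> Re s \<le> 0} \<union> {s. 0 \<le> Re s \<and> Re s \<le> \<alpha>}) F1"
      unfolding F1_def
      by (intro continuous_on_If contA contB closedstrip) (auto simp: match)
    then show "continuous_on {s. -\<beta> < Re s \<and> Re s < \<alpha>} F1"
      by (rule continuous_on_subset) auto
  qed auto
  have F2: "F2 holomorphic_on {s. 0 < Re s \<and> Re s < 1}"
  proof (rule holomorphic_on_paste_across_line[where d = 1 and k = \<alpha>, OF openstrip])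
    show "F2 holomorphic_on {s. 0 < Re s \<and> Re s < 1} \<inter> {z. 1 \<bullet> z < \<alpha>}"
      by (rule holomorphic_transform[of hA])
        (auto simp: F2_def inner_complex_def intro!: holomorphic_on_subset[OF holA])
    have "(hB \<circ> (\<lambda>s. s - 1)) holomorphic_on {s. 0 < Re s \<and> Re s < 1} \<inter> {z. \<alpha> < 1 \<bullet> z}"
      by (rule holomorphic_on_compose_gen[OF _ holB])
        (use assms(3) in \<open>auto intro!: holomorphic_intros simp: inner_complex_def\<close>)
    then show "F2 holomorphic_on {s. 0 < Re s \<and> Re s < 1} \<inter> {z. \<alpha> < 1 \<bullet> z}"
      by (rule holomorphic_transform) (auto simp: F2_def inner_complex_def)
    have "continuous_on {s. \<alpha> \<le> Re s \<and> Re s \<le> 1} (\<lambda>s. hB (s - 1))"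
      by (rule continuous_on_compose2[OF contB]) (use assms(3) in \<open>auto intro!: continuous_intros\<close>)
    then have "continuous_on ({s. 0 \<le> Re s \<and> Re s \<le> \<alpha>} \<union> {s. \<alpha> \<le> Re s \<and> Re s \<le> 1}) F2"
      unfolding F2_def
      by (intro continuous_on_If contA closedstrip) (auto simp: matchA)
    then show "continuous_on {s. 0 < Re s \<and> Re s < 1} F2"
      by (rule continuous_on_subset) auto
  qed auto
  have hol1: "F holomorphic_on {s. of_int k - \<beta> < Re s \<and> Re s < of_int k + \<alpha>}" for k :: int
  proof -
    have "(F1 \<circ> (\<lambda>s. s - of_int k)) holomorphic_on {s. of_int k - \<beta> < Re s \<and> Re s < of_int k + \<alpha>}"
      by (rule holomorphic_on_compose_gen[OF _ F1]) (auto intro!: holomorphic_intros)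
    moreover have "(F1 \<circ> (\<lambda>s. s - of_int k)) s = F s"
      if s: "of_int k - \<beta> < Re s" "Re s < of_int k + \<alpha>" for s
    proof (cases "of_int k \<le> Re s")
      case True
      then have "\<lfloor>Re s\<rfloor> = k" using s assms by (intro floor_unique) auto
      then show ?thesis using True s match[of "s - of_int k"] by (auto simp: F_def F1_def F2_def)
    next
      case False
      then have *: "\<lfloor>Re s\<rfloor> = k - 1" using s assms by (intro floor_unique) auto
      have "\<not> Re (s - of_int (k - 1)) \<le> \<alpha>" using s assms by auto
      then show ?thesis using False by (simp add: F_def F1_def F2_def *)
    qed
    ultimately show ?thesis by (rule holomorphic_transform) auto
  qed
  have hol2: "F holomorphic_on {s. of_int k < Re s \<and> Re s < of_int k + 1}" for k :: int
  proof -
    have "(F2 \<circ> (\<lambda>s. s - of_int k)) holomorphic_on {s. of_int k < Re s \<and> Re s < of_int k + 1}"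
      by (rule holomorphic_on_compose_gen[OF _ F2]) (auto intro!: holomorphic_intros)
    moreover have "(F2 \<circ> (\<lambda>s. s - of_int k)) s = F s"
      if s: "of_int k < Re s" "Re s < of_int k + 1" for s
    proof -
      have "\<lfloor>Re s\<rfloor> = k" using s by (intro floor_unique) auto
      then show ?thesis by (simp add: F_def)
    qed
    ultimately show ?thesis by (rule holomorphic_transform) auto
  qed
  have "F holomorphic_on (\<Union>k::int. {s. of_int k - \<beta> < Re s \<and> Re s < of_int k + \<alpha>} \<union>
      {s. of_int k < Re s \<and> Re s < of_int k + 1})"
    by (intro holomorphic_on_UN_open holomorphic_on_Un hol1 hol2 openstrip open_Un)
  moreover have "(\<Union>k::int. {s. of_int k - \<beta> < Re s \<and> Re s < of_int k + \<alpha>} \<union>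
      {s. of_int k < Re s \<and> Re s < of_int k + 1}) = UNIV"
  proof -
    have "s \<in> {s. of_int k - \<beta> < Re s \<and> Re s < of_int k + \<alpha>} \<union> {s. of_int k < Re s \<and> Re s < of_int k + 1}"
      if k: "k = \<lfloor>Re s\<rfloor>" for s and k :: int
    proof -
      have "of_int k \<le> Re s" "Re s < of_int k + 1" unfolding k by linarith+
      then show ?thesis using assms(1,2) by (cases "of_int k = Re s") simp_all
    qed
    then show ?thesis by blast
  qed
  ultimately have entire: "F holomorphic_on UNIV" by simp
  have C0: "C \<ge> 0"
  proof -
    have "0 \<le> C * (1 + norm (0::complex)) ^ m"
      using growthA[of 0] assms by (intro order_trans[OF norm_ge_zero[of "hA 0"]]) auto
    then show ?thesis by simp
  qed
  have growth: "norm (F s) \<le> (C * 3 ^ m) * norm s ^ m" if "1 \<le> norm s" for s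
  proof -
    define t where "t = s - of_int \<lfloor>Re s\<rfloor>"
    have Ret: "0 \<le> Re t" "Re t \<le> 1"
      by (simp_all add: t_def) linarith
    have Imt: "\<bar>Im t\<bar> \<le> norm s" by (simp add: t_def abs_Im_le_cmod)
    have le: "C * (1 + norm r) ^ m \<le> (C * 3 ^ m) * norm s ^ m" if r: "\<bar>Re r\<bar> \<le> 1" "Im r = Im t" for r
    proof -
      have "1 + norm r \<le> 3 * norm s"
        using cmod_le[of r] r Imt \<open>1 \<le> norm s\<close> by linarith
      then have "(1 + norm r) ^ m \<le> (3 * norm s) ^ m" by (intro power_mono) auto
      then show ?thesis using C0 by (simp add: power_mult_distrib mult.assoc mult_left_mono)
    qed
    have Ft: "F s = (if Re t \<le> \<alpha> then hA t else hB (t - 1))"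
      by (simp only: F_def F2_def t_def)
    show ?thesis
    proof (cases "Re t \<le> \<alpha>")
      case True
      then have "norm (F s) \<le> C * (1 + norm t) ^ m"
        using growthA[of t] Ret by (simp add: Ft)
      also have "\<dots> \<le> (C * 3 ^ m) * norm s ^ m" using Ret by (intro le) auto
      finally show ?thesis .
    next
      case False
      then have "norm (F s) \<le> C * (1 + norm (t - 1)) ^ m"
        using growthB[of "t - 1"] Ret assms(3) by (simp add: Ft)
      also have "\<dots> \<le> (C * 3 ^ m) * norm s ^ m" using Ret by (intro le) auto
      finally show ?thesis .
    qed
  qed
  define a where "a = (\<lambda>k. (deriv ^^ k) F 0 / fact k)"
  have poly: "F s = (\<Sum>k\<le>m. a k * s ^ k)" for s
    unfolding a_def using Liouville_polynomial[OF entire growth] by simp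
  define b where "b = (\<lambda>k. if k = 0 then 0 else a k)"
  have split: "F s = a 0 + (\<Sum>k\<le>m. b k * s ^ k)" for s
  proof -
    have "(\<Sum>k\<le>m. a k * s ^ k) = (\<Sum>k\<le>m. (if k = 0 then a 0 else 0) + b k * s ^ k)"
      by (intro sum.cong) (auto simp: b_def)
    then show ?thesis by (simp add: poly sum.distrib)
  qed
  \<comment> \<open>All natural numbers are zeros of \<open>F - F 0\<close> because \<open>F\<close> has period one.\<close>
  have roots: "range (of_nat :: nat \<Rightarrow> complex) \<subseteq> {z. (\<Sum>k\<le>m. b k * z ^ k) = 0}"
  proof safe
    fix j :: nat
    have "F (of_nat j) = F 0" by (simp add: F_def)
    moreover have "(\<Sum>k\<le>m. b k * 0 ^ k) = 0" by (intro sum.neutral) (auto simp: b_def power_0_left)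
    then have "F 0 = a 0" by (simp add: split)
    ultimately show "(\<Sum>k\<le>m. b k * of_nat j ^ k) = 0" by (simp add: split[of "of_nat j"])
  qed
  have "infinite (range (of_nat :: nat \<Rightarrow> complex))"
    by (rule range_inj_infinite) (simp add: inj_on_def)
  then have "infinite {z. (\<Sum>k\<le>m. b k * z ^ k) = 0}"
    using roots infinite_super by blast
  then have "b k = 0" if "k \<le> m" for k
    using polyfun_finite_roots[of b m] that by blast
  then have const: "F s = a 0" for s by (simp add: split)
  show ?thesis
  proof (rule that)
    fix s assume s: "0 \<le> Re s" "Re s \<le> \<alpha>"
    then have "\<lfloor>Re s\<rfloor> = 0" using assms by (intro floor_unique) auto
    then have "F s = hA s" using s by (simp add: F_def F2_def)
    then show "hA s = a 0" by (simp add: const)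
  qed
qed

section \<open>Time change of a boundary local time\<close>

text \<open>
  The right-hand end \<open>2\<close> always belongs to the set, so that levels never reached are sent to \<open>2\<close>.
\<close>

definition first_passage :: "(real \<Rightarrow> real) \<Rightarrow> real \<Rightarrow> real" where
  "first_passage l u = Inf {t \<in> {0..2}. u \<le> l t \<or> t = 2}"

lemma first_passage_bounds: "0 \<le> first_passage l u" "first_passage l u \<le> 2"
proof -
  have "2 \<in> {t \<in> {0..2}. u \<le> l t \<or> t = (2::real)}" by simp
  moreover have "bdd_below {t \<in> {0..2::real}. u \<le> l t \<or> t = 2}" by (rule bdd_belowI[of _ 0]) auto
  ultimately show "first_passage l u \<le> 2" unfolding first_passage_def by (intro cInf_lower)
  show "0 \<le> first_passage l u" unfolding first_passage_def
    by (rule cInf_greatest) (auto intro: exI[of _ 2])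
qed

lemma first_passage_le_iff:
  assumes cont: "continuous_on {0..2} l" and mono: "mono_on {0..2} l" and t: "0 \<le> t" "t < 2"
  shows "first_passage l u \<le> t \<longleftrightarrow> u \<le> l t"
proof
  let ?S = "{t \<in> {0..2}. u \<le> l t \<or> t = (2::real)}"
  have bdd: "bdd_below ?S" by (rule bdd_belowI[of _ 0]) auto
  show "first_passage l u \<le> t" if "u \<le> l t"
    unfolding first_passage_def using that t bdd by (intro cInf_lower) auto
  show "u \<le> l t" if le: "first_passage l u \<le> t"
  proof -
    have "closed {t \<in> {0..2}. l t \<in> {u..}}"
      using continuous_closed_preimage[OF cont closed_atLeastAtMost closed_atLeast[of u]]
      by (simp add: vimage_def Int_def conj_commute)
    moreover have "?S = {t \<in> {0..2}. l t \<in> {u..}} \<union> {2}" by auto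
    ultimately have "closed ?S" by simp
    then have "Inf ?S \<in> ?S" using bdd by (intro closed_contains_Inf) (auto intro: exI[of _ 2])
    moreover have "Inf ?S \<le> t" using le by (simp add: first_passage_def)
    ultimately show ?thesis using t mono_onD[OF mono, of "Inf ?S" t] by auto
  qed
qed

lemma borel_measurable_first_passage:
  assumes cont: "continuous_on {0..2} l" and mono: "mono_on {0..2} l"
  shows "first_passage l \<in> borel_measurable borel"
proof (rule borel_measurableI_le)
  fix a :: real
  consider "a < 0" | "2 \<le> a" | "0 \<le> a" "a < 2" by linarith
  then have "{u. first_passage l u \<le> a} \<in> sets borel"
  proof cases
    case 1
    then have "{u. first_passage l u \<le> a} = {}" using first_passage_bounds(1)[of l] by (auto simp: not_le intro: less_le_trans)
    then show ?thesis by simp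
  next
    case 2
    then have "{u. first_passage l u \<le> a} = UNIV" using first_passage_bounds(2)[of l] by (auto intro: order_trans)
    then show ?thesis by simp
  next
    case 3
    then have "{u. first_passage l u \<le> a} = {..l a}" by (auto simp: first_passage_le_iff[OF assms])
    then show ?thesis by simp
  qed
  then show "{u \<in> space borel. first_passage l u \<le> a} \<in> sets borel" by simp
qed

text \<open>
  The Stieltjes measure of a continuous nondecreasing path is the image of Lebesgue measure on the range of
  the path under its generalised inverse. The inverse is measurable jointly in the level and in the random
  outcome, which makes expectations of integrals against a local time ordinary integrals over a product
  space.
\<close>

lemma path_measure_eq_first_passage:
  assumes cont: "continuous_on {0..} l" and mono: "mono_on {0..} l" and l0: "l 0 = 0"
    and [measurable]: "h \<in> borel_measurable borel"
  shows "(\<integral>\<^sup>+t\<in>{0..2}. h t \<partial>path_measure l) = (\<integral>\<^sup>+u\<in>{0<..l 2}. h (first_passage l u) \<partial>lborel)"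
proof -
  let ?F = "\<lambda>t. l (max 0 t)"
  let ?P = "path_measure l"
  have cont2: "continuous_on {0..2} l" and mono2: "mono_on {0..2} l"
    using cont mono by (auto intro: continuous_on_subset simp: mono_on_def)
  have [measurable]: "first_passage l \<in> borel_measurable borel"
    by (rule borel_measurable_first_passage[OF cont2 mono2])
  have setsP[measurable_cong]: "sets ?P = sets borel" by (simp add: path_measure_def)
  have monoF: "?F x \<le> ?F y" if "x \<le> y" for x y
    using that by (intro mono_onD[OF mono]) auto
  have contF: "continuous_on UNIV ?F"
    by (rule continuous_on_compose2[OF cont]) (auto intro!: continuous_intros)
  have Icc: "emeasure ?P {a..b} = ?F b - ?F a" if "a \<le> b" for a b
    unfolding path_measure_def using that by (intro emeasure_interval_measure_Icc monoF contF)
  define N1 where "N1 = density ?P (indicator {0..2})"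
  define N2 where "N2 = distr (density lborel (indicator {0<..l 2})) borel (first_passage l)"
  have l2: "0 \<le> l 2" using mono_onD[OF mono, of 0 2] l0 by simp
  \<comment> \<open>Both measures are finite and have the same distribution function.\<close>
  have "N1 = N2"
  proof (rule measure_eqI_generator_eq[where E = "range (\<lambda>a::real. {..a})" and \<Omega> = UNIV and A = "\<lambda>i. {..real i}"])
    show "Int_stable (range (\<lambda>a::real. {..a}))"
      by (auto simp: Int_stable_def)
    show "sets N1 = sigma_sets UNIV (range (\<lambda>a::real. {..a}))"
      by (simp add: N1_def setsP borel_eq_atMost)
    show "sets N2 = sigma_sets UNIV (range (\<lambda>a::real. {..a}))"
      by (simp add: N2_def borel_eq_atMost)
    have N1: "emeasure N1 {..a} = (if a < 0 then 0 else ennreal (l (min a 2)))" for a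
    proof -
      have "emeasure N1 {..a} = emeasure ?P ({0..2} \<inter> {..a})"
        unfolding N1_def by (subst emeasure_density) (auto simp: setsP indicator_inter_arith[symmetric] simp flip: nn_integral_indicator)
      also have "{0..2} \<inter> {..a} = (if a < 0 then {} else {0..min a 2})" by auto
      finally show ?thesis using Icc[of 0 "min a 2"] l0 by auto
    qed
    have N2: "emeasure N2 {..a} = (if a < 0 then 0 else ennreal (l (min a 2)))" for a
    proof -
      have "emeasure N2 {..a} = emeasure (density lborel (indicator {0<..l 2})) (first_passage l -` {..a})"
        unfolding N2_def by (subst emeasure_distr) auto
      also have "\<dots> = emeasure lborel ({0<..l 2} \<inter> first_passage l -` {..a})"
        using measurable_sets[of "first_passage l" borel borel "{..a}"]
        by (subst emeasure_density) (auto simp: indicator_inter_arith[symmetric] simp flip: nn_integral_indicator)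
      also have "{0<..l 2} \<inter> first_passage l -` {..a} = (if a < 0 then {} else {0<..l (min a 2)})"
      proof -
        consider "a < 0" | "2 \<le> a" | "0 \<le> a" "a < 2" by linarith
        then show ?thesis
        proof cases
          case 1
          then have "\<not> first_passage l u \<le> a" for u using first_passage_bounds(1)[of l u] by linarith
          then show ?thesis using 1 by auto
        next
          case 2
          then show ?thesis using first_passage_bounds(2)[of l] by (auto simp: min_absorb2 intro: order_trans)
        next
          case 3
          then have "l a \<le> l 2" using mono_onD[OF mono, of a 2] by auto
          then show ?thesis using 3 by (auto simp: first_passage_le_iff[OF cont2 mono2])
        qed
      qed
      finally show ?thesis using l0 mono_onD[OF mono, of 0 "min a 2"] by auto
    qed
    show "emeasure N1 X = emeasure N2 X" if "X \<in> range (\<lambda>a. {..a})" for X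
      using that by (auto simp: N1 N2)
    show "emeasure N1 {..real i} \<noteq> \<infinity>" for i by (simp add: N1)
  qed (use real_arch_simple in auto)
  then have "(\<integral>\<^sup>+t. h t \<partial>N1) = (\<integral>\<^sup>+t. h t \<partial>N2)" by simp
  then show ?thesis
    unfolding N1_def N2_def by (simp add: nn_integral_density nn_integral_distr mult.commute)
qed

text \<open>
  The grid with \<open>N\<close> cells on \<open>[0, 2]\<close> is approached from the right: \<open>2 * grid_index N t / N\<close> is the right
  end point of the cell \<open>(2i/N, 2(i+1)/N]\<close> containing \<open>t\<close>.
\<close>

definition grid_index :: "nat \<Rightarrow> real \<Rightarrow> nat" where
  "grid_index N t = nat \<lceil>real N * t / 2\<rceil>"

lemma grid_index_eq_Suc_iff:
  assumes "N > 0"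
  shows "grid_index N t = Suc i \<longleftrightarrow> 2 * real i / real N < t \<and> t \<le> 2 * real (Suc i) / real N"
proof -
  have "grid_index N t = Suc i \<longleftrightarrow> \<lceil>real N * t / 2\<rceil> = int i + 1"
    unfolding grid_index_def by linarith
  also have "\<dots> \<longleftrightarrow> real i < real N * t / 2 \<and> real N * t / 2 \<le> real i + 1"
    by (subst ceiling_eq_iff) auto
  also have "\<dots> \<longleftrightarrow> 2 * real i / real N < t \<and> t \<le> 2 * real (Suc i) / real N"
    using assms by (auto simp: field_simps)
  finally show ?thesis .
qed

lemma grid_index_bounds:
  assumes "N > 0" "0 \<le> t"
  shows "t \<le> 2 * real (grid_index N t) / real N" "2 * real (grid_index N t) / real N \<le> t + 2 / real N"
proof -
  have "0 \<le> real N * t / 2" using assms by simp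
  then have "real N * t / 2 \<le> real (grid_index N t)" "real (grid_index N t) \<le> real N * t / 2 + 1"
    unfolding grid_index_def by linarith+
  then show "t \<le> 2 * real (grid_index N t) / real N" "2 * real (grid_index N t) / real N \<le> t + 2 / real N"
    using assms by (auto simp: field_simps)
qed

lemma grid_index_tendsto:
  assumes "0 \<le> t"
  shows "(\<lambda>N. 2 * real (grid_index (Suc N) t) / real (Suc N)) \<longlonglongrightarrow> t"
proof (rule tendsto_sandwich[of "\<lambda>_. t" _ _ "\<lambda>N. t + 2 * inverse (real (Suc N))"])
  have "(\<lambda>N. t + 2 * inverse (real (Suc N))) \<longlonglongrightarrow> t + 2 * 0"
    by (intro tendsto_intros LIMSEQ_inverse_real_of_nat)
  then show "(\<lambda>N. t + 2 * inverse (real (Suc N))) \<longlonglongrightarrow> t" by simp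
qed (use grid_index_bounds[of "Suc _" t] assms in \<open>auto intro!: always_eventually simp: divide_inverse\<close>)

locale boundary_clock = prob_space M for M :: "'a measure" +
  fixes l :: "real \<Rightarrow> 'a \<Rightarrow> real"
  assumes l_measurable: "\<And>t. 0 \<le> t \<Longrightarrow> l t \<in> borel_measurable M"
    and l_continuous: "\<And>\<omega>. \<omega> \<in> space M \<Longrightarrow> continuous_on {0..} (\<lambda>t. l t \<omega>)"
    and l_mono: "\<And>\<omega>. \<omega> \<in> space M \<Longrightarrow> mono_on {0..} (\<lambda>t. l t \<omega>)"
    and l_zero: "\<And>\<omega>. \<omega> \<in> space M \<Longrightarrow> l 0 \<omega> = 0"
begin

sublocale pair_sigma_finite M lborel
  by unfold_locales

definition passage :: "'a \<times> real \<Rightarrow> real" where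
  "passage = (\<lambda>(\<omega>, u). first_passage (\<lambda>t. l t \<omega>) u)"

text \<open>
  Total mass is \<open>E (l 2)\<close>; integrating \<open>Y (passage p) (fst p)\<close> against it yields \<open>E \<integral>\<^sub>0\<^sup>2 Y\<^sub>t dl\<^sub>t\<close>.
\<close>

definition clock :: "('a \<times> real) measure" where
  "clock = density (M \<Otimes>\<^sub>M lborel) (\<lambda>(\<omega>, u). indicator {0<..l 2 \<omega>} u)"

lemma l_cont2: "\<omega> \<in> space M \<Longrightarrow> continuous_on {0..2} (\<lambda>t. l t \<omega>)"
  by (rule continuous_on_subset[OF l_continuous]) auto

lemma l_mono2: "\<omega> \<in> space M \<Longrightarrow> mono_on {0..2} (\<lambda>t. l t \<omega>)"
  using l_mono by (auto simp: mono_on_def)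

lemma l_le: "\<omega> \<in> space M \<Longrightarrow> 0 \<le> s \<Longrightarrow> s \<le> t \<Longrightarrow> l s \<omega> \<le> l t \<omega>"
  using mono_onD[OF l_mono, of \<omega> s t] by auto

lemma l_nonneg: "\<omega> \<in> space M \<Longrightarrow> 0 \<le> t \<Longrightarrow> 0 \<le> l t \<omega>"
  using l_le[of \<omega> 0 t] l_zero by auto

lemma passage_bounds: "0 \<le> passage p" "passage p \<le> 2"
  by (auto simp: passage_def first_passage_bounds split: prod.split)

lemma l2_measurable [measurable]: "l 2 \<in> borel_measurable M"
  by (simp add: l_measurable)

lemma clock_weight_measurable [measurable]:
  "(\<lambda>p. indicator {0<..l 2 (fst p)} (snd p) :: ennreal) \<in> borel_measurable (M \<Otimes>\<^sub>M lborel)"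
  "(\<lambda>p. indicator {0<..l 2 (fst p)} (snd p) :: real) \<in> borel_measurable (M \<Otimes>\<^sub>M lborel)"
  unfolding indicator_def greaterThanAtMost_iff by measurable

lemma passage_measurable [measurable]: "passage \<in> borel_measurable (M \<Otimes>\<^sub>M lborel)"
proof (rule borel_measurableI_le)
  fix a :: real
  consider "a < 0" | "2 \<le> a" | "0 \<le> a" "a < 2" by linarith
  then show "{p \<in> space (M \<Otimes>\<^sub>M lborel). passage p \<le> a} \<in> sets (M \<Otimes>\<^sub>M lborel)"
  proof cases
    case 1
    then have "\<not> passage p \<le> a" for p using passage_bounds(1)[of p] by linarith
    then show ?thesis by simp
  next
    case 2
    then have "passage p \<le> a" for p using passage_bounds(2)[of p] by linarith
    then have "{p \<in> space (M \<Otimes>\<^sub>M lborel). passage p \<le> a} = space (M \<Otimes>\<^sub>M lborel)" by auto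
    then show ?thesis by (simp only: sets.top)
  next
    case 3
    have [measurable]: "l a \<in> borel_measurable M" using 3 by (simp add: l_measurable)
    have "{p \<in> space (M \<Otimes>\<^sub>M lborel). passage p \<le> a} = {p \<in> space (M \<Otimes>\<^sub>M lborel). snd p \<le> l a (fst p)}"
      using 3 by (auto simp: passage_def space_pair_measure first_passage_le_iff[OF l_cont2 l_mono2])
    also have "\<dots> \<in> sets (M \<Otimes>\<^sub>M lborel)" by measurable
    finally show ?thesis .
  qed
qed

lemma sets_clock [measurable_cong]: "sets clock = sets (M \<Otimes>\<^sub>M lborel)"
  by (simp add: clock_def)

lemma space_clock: "space clock = space M \<times> UNIV"
  by (simp add: clock_def space_pair_measure)

lemma nn_integral_clock:
  assumes [measurable]: "f \<in> borel_measurable (M \<Otimes>\<^sub>M lborel)"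
  shows "(\<integral>\<^sup>+p. f p \<partial>clock) = (\<integral>\<^sup>+\<omega>. (\<integral>\<^sup>+u\<in>{0<..l 2 \<omega>}. f (\<omega>, u) \<partial>lborel) \<partial>M)"
  unfolding clock_def split_beta'
  by (subst nn_integral_density) (simp_all add: lborel.nn_integral_fst[symmetric] mult.commute)

lemma emeasure_clock: "emeasure clock (space clock) = (\<integral>\<^sup>+\<omega>. ennreal (l 2 \<omega>) \<partial>M)"
proof -
  have "emeasure clock (space clock) = (\<integral>\<^sup>+p. 1 \<partial>clock)" by simp
  also have "\<dots> = (\<integral>\<^sup>+\<omega>. (\<integral>\<^sup>+u\<in>{0<..l 2 \<omega>}. 1 \<partial>lborel) \<partial>M)" by (rule nn_integral_clock) simp
  also have "\<dots> = (\<integral>\<^sup>+\<omega>. ennreal (l 2 \<omega>) \<partial>M)"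
    by (intro nn_integral_cong) (simp add: l_nonneg)
  finally show ?thesis .
qed

lemma finite_clock:
  assumes "integrable M (l 2)"
  shows "finite_measure clock"
  using assms by (intro finite_measureI)
    (auto simp: emeasure_clock nn_integral_eq_integral l_nonneg AE_I2)

text \<open>
  Evaluation at the grid point next to the passage time takes countably many values of time, and a path-continuous
  process is the limit of these evaluations.
\<close>

lemma process_at_passage_measurable:
  fixes Y :: "real \<Rightarrow> 'a \<Rightarrow> 'b :: {metric_space, second_countable_topology}"
  assumes meas: "\<And>t. 0 \<le> t \<Longrightarrow> Y t \<in> borel_measurable M"
    and cont: "\<And>\<omega>. \<omega> \<in> space M \<Longrightarrow> continuous_on {0..} (\<lambda>t. Y t \<omega>)"
  shows "(\<lambda>p. Y (passage p) (fst p)) \<in> borel_measurable (M \<Otimes>\<^sub>M lborel)"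
    and "(\<lambda>p. Y (2 * real (grid_index N (passage p)) / real N) (fst p)) \<in> borel_measurable (M \<Otimes>\<^sub>M lborel)"
    and "p \<in> space (M \<Otimes>\<^sub>M lborel) \<Longrightarrow>
      (\<lambda>N. Y (2 * real (grid_index (Suc N) (passage p)) / real (Suc N)) (fst p)) \<longlonglongrightarrow> Y (passage p) (fst p)"
proof -
  have idx [measurable]: "(\<lambda>p. grid_index N (passage p)) \<in> measurable (M \<Otimes>\<^sub>M lborel) (count_space UNIV)" for N
    unfolding grid_index_def by measurable
  show m: "(\<lambda>p. Y (2 * real (grid_index N (passage p)) / real N) (fst p)) \<in> borel_measurable (M \<Otimes>\<^sub>M lborel)" for N
    by (rule measurable_compose_countable[OF _ idx, of "\<lambda>i p. Y (2 * real i / real N) (fst p)"])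
      (rule measurable_compose[OF measurable_fst], rule meas, simp)
  show lim: "(\<lambda>N. Y (2 * real (grid_index (Suc N) (passage p)) / real (Suc N)) (fst p)) \<longlonglongrightarrow> Y (passage p) (fst p)"
    if "p \<in> space (M \<Otimes>\<^sub>M lborel)" for p
  proof -
    have "continuous_on {0..} (\<lambda>t. Y t (fst p))" using that by (intro cont) (auto simp: space_pair_measure)
    then show ?thesis
      by (rule continuous_on_tendsto_compose[OF _ grid_index_tendsto]) (auto simp: passage_bounds)
  qed
  show "(\<lambda>p. Y (passage p) (fst p)) \<in> borel_measurable (M \<Otimes>\<^sub>M lborel)"
    by (rule borel_measurable_LIMSEQ_metric[OF m lim])
qed

text \<open>
  The levels \<open>u\<close> passed during a grid cell are those between the values of the path at its end points.
\<close>

lemma grid_cell_iff: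
  assumes \<omega>: "\<omega> \<in> space M" and i: "i < N"
  shows "l (2 * real i / real N) \<omega> < u \<and> u \<le> l (2 * real (Suc i) / real N) \<omega> \<longleftrightarrow>
    (0 < u \<and> u \<le> l 2 \<omega>) \<and> grid_index N (passage (\<omega>, u)) = Suc i"
proof -
  define s t where "s = 2 * real i / real N" and "t = 2 * real (Suc i) / real N"
  have s: "0 \<le> s" "s < 2" using i by (auto simp: s_def field_simps)
  have t: "0 \<le> t" "t \<le> 2" using i by (auto simp: t_def field_simps)
  have N: "N > 0" using i by simp
  note iff = first_passage_le_iff[OF l_cont2[OF \<omega>] l_mono2[OF \<omega>]]
  have "l s \<omega> < u \<longleftrightarrow> s < passage (\<omega>, u)"
    using iff[OF s, of u] by (auto simp: passage_def not_le[symmetric])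
  moreover have "u \<le> l t \<omega> \<longleftrightarrow> passage (\<omega>, u) \<le> t" if "u \<le> l 2 \<omega>"
    using iff[of t u] t that passage_bounds(2)[of "(\<omega>, u)"] by (cases "t = 2") (auto simp: passage_def)
  moreover have "0 \<le> l s \<omega>" "l t \<omega> \<le> l 2 \<omega>" using l_nonneg l_le \<omega> s t by auto
  ultimately show ?thesis
    unfolding grid_index_eq_Suc_iff[OF N] s_def[symmetric] t_def[symmetric] by force
qed

text \<open>
  A Riemann-Stieltjes sum along the grid is an exact integral over \<^const>\<open>boundary_clock.clock\<close> of
  the process evaluated at the rounded passage time. This turns the convergence of expected Riemann sums into a
  single use of dominated convergence on a finite measure space.
\<close>

lemma expected_riemann_sum:
  fixes Y :: "real \<Rightarrow> 'a \<Rightarrow> complex"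
  assumes meas: "\<And>t. 0 \<le> t \<Longrightarrow> Y t \<in> borel_measurable M"
    and cont: "\<And>\<omega>. \<omega> \<in> space M \<Longrightarrow> continuous_on {0..} (\<lambda>t. Y t \<omega>)"
    and bound: "\<And>t \<omega>. 0 \<le> t \<Longrightarrow> \<omega> \<in> space M \<Longrightarrow> norm (Y t \<omega>) \<le> 1"
    and int: "integrable M (l 2)" and N: "N > 0"
  shows "(\<integral>\<omega>. (\<Sum>i<N. Y (2 * real (Suc i) / real N) \<omega> *
      of_real (l (2 * real (Suc i) / real N) \<omega> - l (2 * real i / real N) \<omega>)) \<partial>M) =
    (\<integral>p. Y (2 * real (grid_index N (passage p)) / real N) (fst p) \<partial>clock)"
proof -
  interpret C: finite_measure clock by (rule finite_clock[OF int])
  let ?Y = "\<lambda>p. Y (2 * real (grid_index N (passage p)) / real N) (fst p)"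
  have [measurable]: "?Y \<in> borel_measurable (M \<Otimes>\<^sub>M lborel)"
    by (rule process_at_passage_measurable[OF meas cont])
  have "integrable clock ?Y"
    by (rule C.integrable_const_bound[where B = 1])
      (auto intro!: AE_I2 bound simp: space_clock)
  then have int': "integrable (M \<Otimes>\<^sub>M lborel) (\<lambda>p. indicator {0<..l 2 (fst p)} (snd p) *\<^sub>R ?Y p)"
    unfolding clock_def split_beta' ennreal_indicator[symmetric] by (simp add: integrable_density)
  have "(\<integral>p. ?Y p \<partial>clock) = (\<integral>p. indicator {0<..l 2 (fst p)} (snd p) *\<^sub>R ?Y p \<partial>(M \<Otimes>\<^sub>M lborel))"
    unfolding clock_def split_beta' ennreal_indicator[symmetric] by (subst integral_density) auto
  also have "\<dots> = (\<integral>\<omega>. (\<integral>u. indicator {0<..l 2 \<omega>} u *\<^sub>R ?Y (\<omega>, u) \<partial>lborel) \<partial>M)"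
    using integral_fst'[OF int'] by simp
  also have "\<dots> = (\<integral>\<omega>. (\<Sum>i<N. Y (2 * real (Suc i) / real N) \<omega> *
      of_real (l (2 * real (Suc i) / real N) \<omega> - l (2 * real i / real N) \<omega>)) \<partial>M)"
  proof (rule Bochner_Integration.integral_cong[OF refl])
    fix \<omega> assume \<omega>: "\<omega> \<in> space M"
    let ?c = "\<lambda>i. Y (2 * real (Suc i) / real N) \<omega>"
    let ?I = "\<lambda>i. {l (2 * real i / real N) \<omega> <.. l (2 * real (Suc i) / real N) \<omega>}"
    have "indicator {0<..l 2 \<omega>} u *\<^sub>R ?Y (\<omega>, u) = (\<Sum>i<N. indicator (?I i) u *\<^sub>R ?c i)" for u
    proof (cases "0 < u \<and> u \<le> l 2 \<omega>")
      case False
      then have "u \<notin> ?I i" if "i < N" for i using grid_cell_iff[OF \<omega> that, of u] by auto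
      then have "(\<Sum>i<N. indicator (?I i) u *\<^sub>R ?c i) = 0" by (intro sum.neutral) auto
      with False show ?thesis by auto
    next
      case True
      have "0 < passage (\<omega>, u)"
        using True first_passage_le_iff[OF l_cont2[OF \<omega>] l_mono2[OF \<omega>], of 0 u] l_zero[OF \<omega>]
        by (auto simp: passage_def not_le[symmetric])
      then have "0 < 2 * real (grid_index N (passage (\<omega>, u))) / real N"
        using grid_index_bounds(1)[OF N, of "passage (\<omega>, u)"] by linarith
      then have "grid_index N (passage (\<omega>, u)) \<noteq> 0"
        by (metis div_0 less_irrefl mult_zero_right of_nat_0)
      then obtain k where k: "grid_index N (passage (\<omega>, u)) = Suc k" using not0_implies_Suc by auto
      have "2 * real k / real N < 2"
        using k grid_index_eq_Suc_iff[OF N, of "passage (\<omega>, u)" k] passage_bounds(2)[of "(\<omega>, u)"] by linarith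
      then have "k < N" using N by (simp add: field_simps)
      have ind: "u \<in> ?I i \<longleftrightarrow> i = k" if "i < N" for i
        using grid_cell_iff[OF \<omega> that, of u] True k by auto
      have "(\<Sum>i<N. indicator (?I i) u *\<^sub>R ?c i) = (\<Sum>i<N. if i = k then ?c i else 0)"
        using ind by (intro sum.cong) (auto simp: indicator_def)
      with \<open>k < N\<close> True k show ?thesis by (simp add: sum.delta)
    qed
    then have "(\<integral>u. indicator {0<..l 2 \<omega>} u *\<^sub>R ?Y (\<omega>, u) \<partial>lborel) =
        (\<integral>u. (\<Sum>i<N. indicator (?I i) u *\<^sub>R ?c i) \<partial>lborel)" by simp
    also have "\<dots> = (\<Sum>i<N. \<integral>u. indicator (?I i) u *\<^sub>R ?c i \<partial>lborel)"
    proof (rule Bochner_Integration.integral_sum)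
      fix i
      have "l (2 * real i / real N) \<omega> \<le> l (2 * real (Suc i) / real N) \<omega>"
        by (intro l_le \<omega>) (auto simp: divide_right_mono)
      then show "integrable lborel (\<lambda>u. indicator (?I i) u *\<^sub>R ?c i)"
        by (intro integrable_scaleR_left integrable_real_indicator) auto
    qed
    also have "\<dots> = (\<Sum>i<N. ?c i * of_real (l (2 * real (Suc i) / real N) \<omega> - l (2 * real i / real N) \<omega>))"
    proof (rule sum.cong[OF refl])
      fix i assume "i \<in> {..<N}"
      have "l (2 * real i / real N) \<omega> \<le> l (2 * real (Suc i) / real N) \<omega>"
        by (intro l_le \<omega>) (auto simp: divide_right_mono)
      then show "(\<integral>u. indicator (?I i) u *\<^sub>R ?c i \<partial>lborel) =
          ?c i * of_real (l (2 * real (Suc i) / real N) \<omega> - l (2 * real i / real N) \<omega>)"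
        by (subst integral_scaleR_left) (auto intro!: integrable_real_indicator simp: scaleR_conv_of_real mult.commute)
    qed
    finally show "(\<integral>u. indicator {0<..l 2 \<omega>} u *\<^sub>R ?Y (\<omega>, u) \<partial>lborel) =
      (\<Sum>i<N. ?c i * of_real (l (2 * real (Suc i) / real N) \<omega> - l (2 * real i / real N) \<omega>))" .
  qed
  finally show ?thesis ..
qed

lemma expected_riemann_sum_tendsto:
  fixes Y :: "real \<Rightarrow> 'a \<Rightarrow> complex"
  assumes meas: "\<And>t. 0 \<le> t \<Longrightarrow> Y t \<in> borel_measurable M"
    and cont: "\<And>\<omega>. \<omega> \<in> space M \<Longrightarrow> continuous_on {0..} (\<lambda>t. Y t \<omega>)"
    and bound: "\<And>t \<omega>. 0 \<le> t \<Longrightarrow> \<omega> \<in> space M \<Longrightarrow> norm (Y t \<omega>) \<le> 1"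
    and int: "integrable M (l 2)"
  shows "(\<lambda>N. \<integral>\<omega>. (\<Sum>i<Suc N. Y (2 * real (Suc i) / real (Suc N)) \<omega> *
      of_real (l (2 * real (Suc i) / real (Suc N)) \<omega> - l (2 * real i / real (Suc N)) \<omega>)) \<partial>M)
    \<longlonglongrightarrow> (\<integral>p. Y (passage p) (fst p) \<partial>clock)"
proof -
  interpret C: finite_measure clock by (rule finite_clock[OF int])
  have "(\<lambda>N. \<integral>p. Y (2 * real (grid_index (Suc N) (passage p)) / real (Suc N)) (fst p) \<partial>clock)
      \<longlonglongrightarrow> (\<integral>p. Y (passage p) (fst p) \<partial>clock)"
  proof (rule integral_dominated_convergence[where w = "\<lambda>_. 1"])
    show "AE p in clock. (\<lambda>N. Y (2 * real (grid_index (Suc N) (passage p)) / real (Suc N)) (fst p))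
        \<longlonglongrightarrow> Y (passage p) (fst p)"
      using process_at_passage_measurable(3)[OF meas cont]
      by (intro AE_I2) (auto simp: space_clock space_pair_measure)
    show "AE p in clock. norm (Y (2 * real (grid_index (Suc N) (passage p)) / real (Suc N)) (fst p)) \<le> 1" for N
      by (intro AE_I2 bound) (auto simp: space_clock)
  qed (use process_at_passage_measurable[OF meas cont] in
      \<open>simp_all only: measurable_cong_sets[OF sets_clock refl] C.integrable_const\<close>)
  then show ?thesis
    by (subst expected_riemann_sum[OF assms]) auto
qed

end

text \<open>
  A process that vanishes at almost every point of increase of the local time vanishes at the passage times.
\<close>

lemma (in boundary_clock) AE_clock_support:
  fixes Z :: "real \<Rightarrow> 'a \<Rightarrow> real"
  assumes meas: "\<And>t. 0 \<le> t \<Longrightarrow> Z t \<in> borel_measurable M"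
    and cont: "\<And>\<omega>. \<omega> \<in> space M \<Longrightarrow> continuous_on {0..} (\<lambda>t. Z t \<omega>)"
    and supp: "\<And>\<omega>. \<omega> \<in> space M \<Longrightarrow> emeasure (path_measure (\<lambda>t. l t \<omega>)) {t. 0 \<le> t \<and> Z t \<omega> \<noteq> 0} = 0"
  shows "AE p in clock. Z (passage p) (fst p) = 0"
proof -
  have [measurable]: "(\<lambda>p. Z (passage p) (fst p)) \<in> borel_measurable (M \<Otimes>\<^sub>M lborel)"
    by (rule process_at_passage_measurable(1)[OF meas cont])
  let ?f = "\<lambda>p. if Z (passage p) (fst p) = 0 then 0 else 1 :: ennreal"
  have "(\<integral>\<^sup>+p. ?f p \<partial>clock) = (\<integral>\<^sup>+\<omega>. (\<integral>\<^sup>+u\<in>{0<..l 2 \<omega>}. ?f (\<omega>, u) \<partial>lborel) \<partial>M)"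
    by (rule nn_integral_clock) measurable
  also have "\<dots> = (\<integral>\<^sup>+\<omega>. 0 \<partial>M)"
  proof (rule nn_integral_cong)
    fix \<omega> assume \<omega>: "\<omega> \<in> space M"
    let ?B = "{t. 0 \<le> t \<and> Z t \<omega> \<noteq> 0}"
    have "{0..} \<inter> (\<lambda>t. Z t \<omega>) -` {0} \<in> sets borel"
      by (intro borel_closed continuous_closed_preimage[OF cont[OF \<omega>]]) auto
    moreover have "?B = {0..} - ({0..} \<inter> (\<lambda>t. Z t \<omega>) -` {0})" by auto
    ultimately have B[measurable]: "?B \<in> sets borel" by simp
    have "(\<integral>\<^sup>+u\<in>{0<..l 2 \<omega>}. ?f (\<omega>, u) \<partial>lborel) =
        (\<integral>\<^sup>+u\<in>{0<..l 2 \<omega>}. indicator ?B (first_passage (\<lambda>t. l t \<omega>) u) \<partial>lborel)"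
      by (intro nn_integral_cong) (auto simp: passage_def first_passage_bounds indicator_def)
    also have "\<dots> = (\<integral>\<^sup>+t\<in>{0..2}. indicator ?B t \<partial>path_measure (\<lambda>t. l t \<omega>))"
      using \<omega> by (intro path_measure_eq_first_passage[symmetric] l_continuous l_mono l_zero) auto
    also have "\<dots> \<le> (\<integral>\<^sup>+t. indicator ?B t \<partial>path_measure (\<lambda>t. l t \<omega>))"
      by (intro nn_integral_mono) (auto simp: indicator_def)
    also have "\<dots> = 0"
      using supp[OF \<omega>] B by (subst nn_integral_indicator) (auto simp: path_measure_def)
    finally show "(\<integral>\<^sup>+u\<in>{0<..l 2 \<omega>}. ?f (\<omega>, u) \<partial>lborel) = 0" by simp
  qed
  finally have "(\<integral>\<^sup>+p. ?f p \<partial>clock) = 0" by simp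
  then have "AE p in clock. ?f p = 0"
    by (subst (asm) nn_integral_0_iff_AE) (simp_all add: measurable_cong_sets[OF sets_clock refl])
  then show ?thesis by (rule AE_mp) (auto intro!: AE_I2 split: if_splits)
qed

section \<open>The adjoint relation on the imaginary axes\<close>

text \<open>
  Continuous monotone paths have zero quadratic variation: the sum of squares is at most the largest increment
  times the total increase.
\<close>

lemma mesh_square_sum_tendsto_zero:
  fixes v :: "real \<Rightarrow> real"
  assumes cont: "continuous_on {0..2} v" and mono: "mono_on {0..2} v"
  shows "(\<lambda>N. \<Sum>i<Suc N. (v (2 * real (Suc i) / real (Suc N)) - v (2 * real i / real (Suc N)))\<^sup>2) \<longlonglongrightarrow> 0"
proof (rule LIMSEQ_I)
  fix e :: real assume e: "e > 0"
  define D where "D = v 2 - v 0"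
  have D: "D \<ge> 0" using mono_onD[OF mono, of 0 2] by (simp add: D_def)
  define e' where "e' = e / (D + 1)"
  have e': "e' > 0" using e D by (simp add: e'_def)
  have "uniformly_continuous_on {0..2} v" using cont compact_uniformly_continuous by blast
  then obtain d where d: "d > 0"
    "\<And>x y. x \<in> {0..2} \<Longrightarrow> y \<in> {0..2} \<Longrightarrow> dist x y < d \<Longrightarrow> dist (v x) (v y) < e'"
    using e' unfolding uniformly_continuous_on_def by metis
  obtain N0 :: nat where N0: "2 / d < real N0" using reals_Archimedean2 by blast
  show "\<exists>no. \<forall>N\<ge>no. norm ((\<Sum>i<Suc N. (v (2 * real (Suc i) / real (Suc N)) - v (2 * real i / real (Suc N)))\<^sup>2) - 0) < e"
  proof (intro exI allI impI)
    fix N assume N: "N \<ge> N0"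
    let ?t = "\<lambda>i. 2 * real i / real (Suc N)"
    let ?d = "\<lambda>i. v (?t (Suc i)) - v (?t i)"
    have t: "?t i \<in> {0..2}" if "i \<le> Suc N" for i using that by (auto simp: field_simps)
    have "2 / d < real (Suc N)" using N0 N by simp
    then have mesh: "2 / real (Suc N) < d" using d by (simp add: field_simps)
    have step: "0 \<le> ?d i \<and> ?d i \<le> e'" if "i < Suc N" for i
    proof -
      have "?t (Suc i) - ?t i = 2 / real (Suc N)" by (simp add: diff_divide_distrib[symmetric])
      then have "?t i \<le> ?t (Suc i)" "dist (?t (Suc i)) (?t i) < d"
        using mesh by (simp_all add: dist_real_def divide_right_mono)
      then show ?thesis
        using d(2)[OF t t, of "Suc i" i] mono_onD[OF mono t t, of i "Suc i"] that
        by (auto simp: dist_real_def)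
    qed
    have "(\<Sum>i<Suc N. (?d i)\<^sup>2) \<le> (\<Sum>i<Suc N. e' * ?d i)"
      using step by (intro sum_mono) (auto simp: power2_eq_square intro!: mult_right_mono)
    also have "\<dots> = e' * (v (?t (Suc N)) - v (?t 0))"
      unfolding sum_distrib_left[symmetric] by (subst sum_lessThan_telescope) simp
    also have "\<dots> = e' * D" by (simp add: D_def del: of_nat_Suc)
    also have "\<dots> < e" using e D by (simp add: e'_def field_simps)
    finally have "(\<Sum>i<Suc N. (?d i)\<^sup>2) < e" .
    moreover have "0 \<le> (\<Sum>i<Suc N. (?d i)\<^sup>2)" by (intro sum_nonneg) simp
    ultimately show "norm ((\<Sum>i<Suc N. (?d i)\<^sup>2) - 0) < e" by simp
  qed
qed

text \<open>
  Means of \<open>X\<close> and \<open>Y\<close> may not exist, but truncations of both to \<open>[-n, n]\<close> have equal means, and the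
  truncated difference is still bounded below by \<open>-w\<close>, so Fatou's lemma bounds the mean of \<open>Y - X + w\<close>
  by that of \<open>w\<close>.
\<close>

lemma (in prob_space) integrable_stationary_increment:
  fixes X Y w :: "'a \<Rightarrow> real"
  assumes [measurable]: "X \<in> borel_measurable M" "Y \<in> borel_measurable M"
    and law: "distr M borel X = distr M borel Y"
    and w: "integrable M w" and lower: "AE \<omega> in M. - w \<omega> \<le> Y \<omega> - X \<omega>" and w0: "\<And>\<omega>. 0 \<le> w \<omega>"
  shows "integrable M (\<lambda>\<omega>. Y \<omega> - X \<omega>)"
proof -
  have [measurable]: "w \<in> borel_measurable M" using w by auto
  define c :: "nat \<Rightarrow> real \<Rightarrow> real" where "c = (\<lambda>n x. max (- real n) (min (real n) x))"
  have [measurable]: "c n \<in> borel_measurable borel" for n unfolding c_def by measurable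
  have c_int: "integrable M (\<lambda>\<omega>. c n (Z \<omega>))" if [measurable]: "Z \<in> borel_measurable M" for n Z
    by (rule integrable_const_bound[where B = "real n"]) (auto simp: c_def intro!: AE_I2)
  have c_law: "expectation (\<lambda>\<omega>. c n (X \<omega>)) = expectation (\<lambda>\<omega>. c n (Y \<omega>))" for n
    using law integral_distr[of X M borel "c n"] integral_distr[of Y M borel "c n"] by simp
  let ?d = "\<lambda>n \<omega>. c n (Y \<omega>) - c n (X \<omega>) + w \<omega>"
  have d0: "AE \<omega> in M. 0 \<le> ?d n \<omega>" for n
    using lower by eventually_elim (use w0 in \<open>auto simp: c_def max_def min_def split: if_splits intro: add_nonneg_nonneg\<close>)
  have int_d: "(\<integral>\<^sup>+\<omega>. ennreal (?d n \<omega>) \<partial>M) = ennreal (expectation w)" for n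
  proof -
    have "integrable M (?d n)"
      by (intro Bochner_Integration.integrable_add Bochner_Integration.integrable_diff c_int w assms)
    then have "(\<integral>\<^sup>+\<omega>. ennreal (?d n \<omega>) \<partial>M) = ennreal (expectation (?d n))"
      by (intro nn_integral_eq_integral d0)
    also have "expectation (?d n) = expectation w"
      using c_law[of n] c_int[OF assms(1)] c_int[OF assms(2)] w by simp
    finally show ?thesis .
  qed
  have lim: "(\<lambda>n. ennreal (?d n \<omega>)) \<longlonglongrightarrow> ennreal (Y \<omega> - X \<omega> + w \<omega>)" for \<omega>
  proof -
    have c_ev: "(\<lambda>n. c n x) \<longlonglongrightarrow> x" for x
    proof (rule tendsto_eventually)
      obtain n0 :: nat where "\<bar>x\<bar> < real n0" using reals_Archimedean2 by blast
      then show "\<forall>\<^sub>F n in sequentially. c n x = x"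
        by (intro eventually_sequentiallyI[of n0]) (auto simp: c_def)
    qed
    show ?thesis by (intro tendsto_ennrealI tendsto_intros c_ev)
  qed
  have "(\<integral>\<^sup>+\<omega>. ennreal (Y \<omega> - X \<omega> + w \<omega>) \<partial>M) = (\<integral>\<^sup>+\<omega>. liminf (\<lambda>n. ennreal (?d n \<omega>)) \<partial>M)"
    by (intro nn_integral_cong lim_imp_Liminf[symmetric] lim) simp
  also have "\<dots> \<le> liminf (\<lambda>n. \<integral>\<^sup>+\<omega>. ennreal (?d n \<omega>) \<partial>M)"
    by (rule nn_integral_liminf) measurable
  also have "\<dots> < \<infinity>" by (simp add: int_d Liminf_const)
  finally have "integrable M (\<lambda>\<omega>. Y \<omega> - X \<omega> + w \<omega>)"
    using lower by (intro integrableI_nonneg) auto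
  from Bochner_Integration.integrable_diff[OF this w] show ?thesis by simp
qed

text \<open>
  The quadratic bound makes the remainders vanish along refining grids, the linear bound dominates them.
\<close>

lemma iexp_remainder: "norm (1 - iexp (- x) - \<i> * of_real x) \<le> min (x\<^sup>2) (2 * \<bar>x\<bar>)"
proof -
  have *: "(\<Sum>k\<le>1. (\<i> * complex_of_real (- x)) ^ k / fact k) = 1 - \<i> * of_real x" by simp
  have eq: "norm (1 - iexp (- x) - \<i> * of_real x) = norm (iexp (- x) - (1 - \<i> * of_real x))"
    by (simp add: norm_minus_commute algebra_simps)
  have "norm (iexp (- x) - (1 - \<i> * of_real x)) \<le> \<bar>- x\<bar> ^ Suc 1 / fact (Suc 1)"
    using iexp_approx1[of "- x" 1] unfolding * .
  then have "norm (iexp (- x) - (1 - \<i> * of_real x)) \<le> x\<^sup>2 / 2"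
    by (simp add: power2_eq_square)
  also have "x\<^sup>2 / 2 \<le> x\<^sup>2" by simp
  finally have "norm (iexp (- x) - (1 - \<i> * of_real x)) \<le> x\<^sup>2" .
  moreover have "norm (iexp (- x) - (1 - \<i> * of_real x)) \<le> 2 * \<bar>- x\<bar> ^ 1 / fact 1"
    using iexp_approx2[of "- x" 1] unfolding * .
  ultimately show ?thesis unfolding eq by simp
qed

text \<open>
  This isolates what the functional equation uses of a stationary reflected Brownian motion: path regularity for
  every outcome instead of almost every one, integrable local times, and, in place of the driving Brownian
  motion, its effect on exponentials over one time step.
\<close>

locale stationary_reflected_process = prob_space M for M :: "'a measure" +
  fixes G L :: "real \<Rightarrow> 'a \<Rightarrow> real^2" and r1 r2 m1 m2 :: real
  assumes G_measurable: "\<And>t. 0 \<le> t \<Longrightarrow> G t \<in> borel_measurable M"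
    and G_continuous: "\<And>\<omega>. \<omega> \<in> space M \<Longrightarrow> continuous_on {0..} (\<lambda>t. G t \<omega>)"
    and G_nonneg: "\<And>\<omega> t i. \<omega> \<in> space M \<Longrightarrow> 0 \<le> t \<Longrightarrow> 0 \<le> G t \<omega> $ i"
    and L_clock: "\<And>i. boundary_clock M (\<lambda>t \<omega>. L t \<omega> $ i)"
    and L_integrable: "\<And>i. integrable M (\<lambda>\<omega>. L 2 \<omega> $ i)"
    and L_support: "\<And>\<omega> i. \<omega> \<in> space M \<Longrightarrow>
      emeasure (path_measure (\<lambda>t. L t \<omega> $ i)) {t. 0 \<le> t \<and> G t \<omega> $ i \<noteq> 0} = 0"
    and G_stationary: "\<And>t. 0 \<le> t \<Longrightarrow> distr M borel (G t) = distr M borel (G 0)"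
    and one_step: "\<And>\<xi> \<eta> s t. 0 \<le> s \<Longrightarrow> s \<le> t \<Longrightarrow>
      expectation (\<lambda>\<omega>. iexp (\<xi> * G t \<omega> $ 1 + \<eta> * G t \<omega> $ 2) *
        iexp (- (- (m1 * \<xi> + m2 * \<eta>) * (t - s) + (\<xi> + r1 * \<eta>) * (L t \<omega> $ 1 - L s \<omega> $ 1)
          + (r2 * \<xi> + \<eta>) * (L t \<omega> $ 2 - L s \<omega> $ 2)))) =
      of_real (exp (- ((\<xi> - \<eta>)\<^sup>2 * (t - s) / 2))) *
        expectation (\<lambda>\<omega>. iexp (\<xi> * G s \<omega> $ 1 + \<eta> * G s \<omega> $ 2))"
begin

sublocale C1: boundary_clock M "\<lambda>t \<omega>. L t \<omega> $ 1" by (rule L_clock)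
sublocale C2: boundary_clock M "\<lambda>t \<omega>. L t \<omega> $ 2" by (rule L_clock)

lemma G_component_measurable [measurable]: "0 \<le> t \<Longrightarrow> (\<lambda>\<omega>. G t \<omega> $ i) \<in> borel_measurable M"
  using G_measurable[of t] by (intro borel_measurable_continuous_on[OF _ G_measurable]) (auto intro!: continuous_intros)

lemma G_component_continuous: "\<omega> \<in> space M \<Longrightarrow> continuous_on {0..} (\<lambda>t. G t \<omega> $ i)"
  by (intro continuous_intros G_continuous)

lemma L_measurable [measurable]: "0 \<le> t \<Longrightarrow> (\<lambda>\<omega>. L t \<omega> $ i) \<in> borel_measurable M"
  using boundary_clock.l_measurable[OF L_clock] by simp

lemma fourier_at_stationary:
  assumes "0 \<le> t"
  shows "expectation (\<lambda>\<omega>. iexp (\<xi> * G t \<omega> $ 1 + \<eta> * G t \<omega> $ 2)) = expectation (\<lambda>\<omega>. iexp (\<xi> * G 0 \<omega> $ 1 + \<eta> * G 0 \<omega> $ 2))"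
proof -
  have [measurable]: "(\<lambda>g. iexp (\<xi> * g $ 1 + \<eta> * g $ 2)) \<in> borel_measurable (borel :: (real^2) measure)"
    by (intro borel_measurable_continuous_onI continuous_intros)
  have "expectation (\<lambda>\<omega>. iexp (\<xi> * G t \<omega> $ 1 + \<eta> * G t \<omega> $ 2)) = (\<integral>g. iexp (\<xi> * g $ 1 + \<eta> * g $ 2) \<partial>distr M borel (G t))" if "0 \<le> t" for t
    by (rule integral_distr[symmetric]) (use G_measurable[OF that] in measurable)
  with assms G_stationary[OF assms] show ?thesis by simp
qed

text \<open>
  Put \<open>f\<^sub>t = exp(i(\<xi> G\<^sub>1(t) + \<eta> G\<^sub>2(t)))\<close> and let \<open>\<theta>\<close> be the bounded-variation part of its phase increment
  over a grid cell of length \<open>h\<close>. The one-step identity says \<open>E f\<^sub>t\<^sub>+\<^sub>h (1 - exp(-i \<theta>)) = (1 - exp(-(\<xi> - \<eta>)\<^sup>2 h/2)) \<phi>\<close>,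
  with \<open>\<phi> = E f\<^sub>t\<close> independent of \<open>t\<close>. Summing over the cells and replacing \<open>1 - exp(-i \<theta>)\<close> by \<open>i \<theta>\<close> leaves
  Riemann sums against time and against the local times. On \<open>dL\<^sub>1\<close> the first coordinate is zero, on
  \<open>dL\<^sub>2\<close> the second, which removes it from the exponent. Purely imaginary exponents matter: they keep
  \<open>exp(-i \<theta>)\<close> bounded although \<open>\<theta>\<close> has no exponential moments.
\<close>

lemma adjoint_relation_imaginary:
  fixes \<xi> \<eta> :: real
  defines "\<phi> \<equiv> expectation (\<lambda>\<omega>. iexp (\<xi> * G 0 \<omega> $ 1 + \<eta> * G 0 \<omega> $ 2))"
  shows "of_real ((\<xi> - \<eta>)\<^sup>2) * \<phi> = - 2 * \<i> * of_real (m1 * \<xi> + m2 * \<eta>) * \<phi>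
      + \<i> * of_real (\<xi> + r1 * \<eta>) * (\<integral>p. iexp (\<eta> * G (C1.passage p) (fst p) $ 2) \<partial>C1.clock)
      + \<i> * of_real (r2 * \<xi> + \<eta>) * (\<integral>p. iexp (\<xi> * G (C2.passage p) (fst p) $ 1) \<partial>C2.clock)"
proof -
  define f where "f = (\<lambda>t \<omega>. iexp (\<xi> * G t \<omega> $ 1 + \<eta> * G t \<omega> $ 2))"
  define a b1 b2 where "a = - (m1 * \<xi> + m2 * \<eta>)" and "b1 = \<xi> + r1 * \<eta>" and "b2 = r2 * \<xi> + \<eta>"
  have f_meas [measurable]: "f t \<in> borel_measurable M" if "0 \<le> t" for t
    using that unfolding f_def by measurable
  have f_cont: "continuous_on {0..} (\<lambda>t. f t \<omega>)" if "\<omega> \<in> space M" for \<omega>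
    unfolding f_def by (intro continuous_intros G_continuous that)
  have f_norm [simp]: "norm (f t \<omega>) = 1" for t \<omega> by (simp add: f_def)
  have f_int: "integrable M (f t)" if "0 \<le> t" for t
    using that by (intro integrable_const_bound[where B = 1]) auto
  have f_exp: "expectation (f t) = \<phi>" if "0 \<le> t" for t
    using fourier_at_stationary[OF that, of \<xi> \<eta>] by (simp add: f_def \<phi>_def)
  \<comment> \<open>\<open>T N i\<close> is the \<open>i\<close>-th point of the grid with \<open>N + 1\<close> cells.\<close>
  define T where "T = (\<lambda>N i. 2 * real i / real (Suc N))"
  have T0: "0 \<le> T N i" and Tstep: "T N (Suc i) - T N i = 2 / real (Suc N)" for N i
    by (simp_all add: T_def diff_divide_distrib[symmetric])
  have Tle: "T N i \<le> T N (Suc i)" for N i by (simp add: T_def divide_right_mono)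
  define \<theta> where "\<theta> = (\<lambda>N i \<omega>. a * (T N (Suc i) - T N i) + b1 * (L (T N (Suc i)) \<omega> $ 1 - L (T N i) \<omega> $ 1)
    + b2 * (L (T N (Suc i)) \<omega> $ 2 - L (T N i) \<omega> $ 2))"
  have \<theta>_meas [measurable]: "\<theta> N i \<in> borel_measurable M" for N i
    using T0 unfolding \<theta>_def by measurable
  define R where "R = (\<lambda>N i \<omega>. 1 - iexp (- \<theta> N i \<omega>) - \<i> * of_real (\<theta> N i \<omega>))"
  have R_meas [measurable]: "R N i \<in> borel_measurable M" for N i unfolding R_def by measurable
  \<comment> \<open>An integrable continuous nondecreasing path whose increments dominate those of the phase.\<close>
  define v where "v = (\<lambda>\<omega> t. \<bar>a\<bar> * t + \<bar>b1\<bar> * L t \<omega> $ 1 + \<bar>b2\<bar> * L t \<omega> $ 2)"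
  have v_cont: "continuous_on {0..2} (v \<omega>)" if "\<omega> \<in> space M" for \<omega>
    unfolding v_def by (intro continuous_intros C1.l_cont2 C2.l_cont2 that)
  have v_mono: "v \<omega> s \<le> v \<omega> t" if "\<omega> \<in> space M" "0 \<le> s" "s \<le> t" for \<omega> s t
    unfolding v_def using that C1.l_le C2.l_le by (intro add_mono mult_left_mono) auto
  have \<theta>_bound: "\<bar>\<theta> N i \<omega>\<bar> \<le> v \<omega> (T N (Suc i)) - v \<omega> (T N i)" if "\<omega> \<in> space M" for N i \<omega>
  proof -
    have "0 \<le> L (T N (Suc i)) \<omega> $ 1 - L (T N i) \<omega> $ 1" "0 \<le> L (T N (Suc i)) \<omega> $ 2 - L (T N i) \<omega> $ 2"
      using C1.l_le[OF that T0 Tle] C2.l_le[OF that T0 Tle] by auto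
    moreover have "\<bar>\<theta> N i \<omega>\<bar> \<le> \<bar>a * (T N (Suc i) - T N i)\<bar> + \<bar>b1 * (L (T N (Suc i)) \<omega> $ 1 - L (T N i) \<omega> $ 1)\<bar>
      + \<bar>b2 * (L (T N (Suc i)) \<omega> $ 2 - L (T N i) \<omega> $ 2)\<bar>" unfolding \<theta>_def by linarith
    moreover have "0 \<le> T N (Suc i) - T N i" using Tle[of N i] by simp
    ultimately have "\<bar>\<theta> N i \<omega>\<bar> \<le> \<bar>a\<bar> * (T N (Suc i) - T N i) + \<bar>b1\<bar> * (L (T N (Suc i)) \<omega> $ 1 - L (T N i) \<omega> $ 1)
      + \<bar>b2\<bar> * (L (T N (Suc i)) \<omega> $ 2 - L (T N i) \<omega> $ 2)" by (simp only: abs_mult abs_of_nonneg)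
    also have "\<dots> = v \<omega> (T N (Suc i)) - v \<omega> (T N i)" by (simp add: v_def algebra_simps)
    finally show ?thesis .
  qed
  have v_int: "integrable M (\<lambda>\<omega>. v \<omega> 2 - v \<omega> 0)"
    unfolding v_def using L_integrable C1.l_zero C2.l_zero
    by (subst Bochner_Integration.integrable_cong[OF refl, of _ _ "\<lambda>\<omega>. \<bar>a\<bar> * 2 + \<bar>b1\<bar> * L 2 \<omega> $ 1 + \<bar>b2\<bar> * L 2 \<omega> $ 2"]) auto
  have telescope: "(\<Sum>i<Suc N. v \<omega> (T N (Suc i)) - v \<omega> (T N i)) = v \<omega> 2 - v \<omega> 0" for N \<omega>
    by (subst sum_lessThan_telescope) (simp add: T_def del: of_nat_Suc)
  have R_lim: "(\<lambda>N. expectation (\<lambda>\<omega>. \<Sum>i<Suc N. f (T N (Suc i)) \<omega> * R N i \<omega>)) \<longlonglongrightarrow> expectation (\<lambda>\<omega>. 0)"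
  proof (rule integral_dominated_convergence[where w = "\<lambda>\<omega>. 2 * (v \<omega> 2 - v \<omega> 0)"])
    show "(\<lambda>\<omega>. \<Sum>i<Suc N. f (T N (Suc i)) \<omega> * R N i \<omega>) \<in> borel_measurable M" for N
      by (intro borel_measurable_sum borel_measurable_times f_meas R_meas T0)
    show "integrable M (\<lambda>\<omega>. 2 * (v \<omega> 2 - v \<omega> 0))" by (intro integrable_mult_right v_int)
    show "AE \<omega> in M. norm (\<Sum>i<Suc N. f (T N (Suc i)) \<omega> * R N i \<omega>) \<le> 2 * (v \<omega> 2 - v \<omega> 0)" for N
    proof (rule AE_I2)
      fix \<omega> assume \<omega>: "\<omega> \<in> space M"
      have "norm (\<Sum>i<Suc N. f (T N (Suc i)) \<omega> * R N i \<omega>) \<le> (\<Sum>i<Suc N. 2 * (v \<omega> (T N (Suc i)) - v \<omega> (T N i)))"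
      proof (rule sum_norm_le)
        fix i
        show "norm (f (T N (Suc i)) \<omega> * R N i \<omega>) \<le> 2 * (v \<omega> (T N (Suc i)) - v \<omega> (T N i))"
          using iexp_remainder[of "\<theta> N i \<omega>"] \<theta>_bound[OF \<omega>, of N i] by (simp add: norm_mult R_def)
      qed
      also have "\<dots> = 2 * (v \<omega> 2 - v \<omega> 0)" by (simp only: sum_distrib_left[symmetric] telescope)
      finally show "norm (\<Sum>i<Suc N. f (T N (Suc i)) \<omega> * R N i \<omega>) \<le> 2 * (v \<omega> 2 - v \<omega> 0)" .
    qed
    show "AE \<omega> in M. (\<lambda>N. \<Sum>i<Suc N. f (T N (Suc i)) \<omega> * R N i \<omega>) \<longlonglongrightarrow> 0"
    proof (rule AE_I2)
      fix \<omega> assume \<omega>: "\<omega> \<in> space M"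
      show "(\<lambda>N. \<Sum>i<Suc N. f (T N (Suc i)) \<omega> * R N i \<omega>) \<longlonglongrightarrow> 0"
      proof (rule Lim_null_comparison[OF always_eventually])
        show "(\<lambda>N. \<Sum>i<Suc N. (v \<omega> (T N (Suc i)) - v \<omega> (T N i))\<^sup>2) \<longlonglongrightarrow> 0"
          unfolding T_def by (rule mesh_square_sum_tendsto_zero[OF v_cont[OF \<omega>]])
            (auto intro!: mono_onI v_mono \<omega>)
        show "\<forall>N. norm (\<Sum>i<Suc N. f (T N (Suc i)) \<omega> * R N i \<omega>) \<le> (\<Sum>i<Suc N. (v \<omega> (T N (Suc i)) - v \<omega> (T N i))\<^sup>2)"
        proof (intro allI sum_norm_le)
          fix N i
          have "(\<theta> N i \<omega>)\<^sup>2 \<le> (v \<omega> (T N (Suc i)) - v \<omega> (T N i))\<^sup>2"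
            using \<theta>_bound[OF \<omega>, of N i] by (intro abs_le_square_iff[THEN iffD1]) auto
          then show "norm (f (T N (Suc i)) \<omega> * R N i \<omega>) \<le> (v \<omega> (T N (Suc i)) - v \<omega> (T N i))\<^sup>2"
            using iexp_remainder[of "\<theta> N i \<omega>"] by (simp add: norm_mult R_def)
        qed
      qed
    qed
  qed simp
  define S where "S = (\<lambda>j N \<omega>. \<Sum>i<Suc N. f (T N (Suc i)) \<omega> * of_real (L (T N (Suc i)) \<omega> $ j - L (T N i) \<omega> $ j))"
  have S1: "(\<lambda>N. expectation (S 1 N)) \<longlonglongrightarrow> (\<integral>p. f (C1.passage p) (fst p) \<partial>C1.clock)"
    unfolding S_def T_def
    by (rule C1.expected_riemann_sum_tendsto) (use f_meas f_cont L_integrable in auto)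
  have S2: "(\<lambda>N. expectation (S 2 N)) \<longlonglongrightarrow> (\<integral>p. f (C2.passage p) (fst p) \<partial>C2.clock)"
    unfolding S_def T_def
    by (rule C2.expected_riemann_sum_tendsto) (use f_meas f_cont L_integrable in auto)
  have L_int: "integrable M (\<lambda>\<omega>. L (T N i) \<omega> $ j)" if "i \<le> Suc N" for N i j
  proof (rule Bochner_Integration.integrable_bound[OF L_integrable[of j]])
    have "T N i \<le> 2" using that by (simp add: T_def field_simps)
    then show "AE \<omega> in M. norm (L (T N i) \<omega> $ j) \<le> norm (L 2 \<omega> $ j)"
      using T0[of N i] boundary_clock.l_le[OF L_clock, of _ "T N i" 2 j] boundary_clock.l_nonneg[OF L_clock, of _ "T N i" j]
      by (intro AE_I2) fastforce
  qed (use T0 in measurable)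
  have fL_int: "integrable M (\<lambda>\<omega>. f (T N (Suc i)) \<omega> * of_real (L (T N (Suc i)) \<omega> $ j - L (T N i) \<omega> $ j))"
    if "i < Suc N" for N i j
  proof (rule Bochner_Integration.integrable_bound[where f = "\<lambda>\<omega>. L (T N (Suc i)) \<omega> $ j - L (T N i) \<omega> $ j"])
    show "integrable M (\<lambda>\<omega>. L (T N (Suc i)) \<omega> $ j - L (T N i) \<omega> $ j)"
      using that by (intro Bochner_Integration.integrable_diff L_int) auto
    have [measurable]: "f (T N (Suc i)) \<in> borel_measurable M" by (intro f_meas T0)
    show "(\<lambda>\<omega>. f (T N (Suc i)) \<omega> * of_real (L (T N (Suc i)) \<omega> $ j - L (T N i) \<omega> $ j)) \<in> borel_measurable M"
      using T0 by measurable
  qed (auto simp: norm_mult)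
  \<comment> \<open>The factor that a Gaussian increment over a cell of length \<open>2 / (N + 1)\<close> contributes.\<close>
  define q where "q = (\<lambda>N. exp (- ((\<xi> - \<eta>)\<^sup>2 * (2 / real (Suc N)) / 2)))"
  have main: "of_nat (Suc N) * (1 - of_real (q N)) * \<phi> = 2 * \<i> * of_real a * \<phi>
      + \<i> * of_real b1 * expectation (S 1 N) + \<i> * of_real b2 * expectation (S 2 N)
      + expectation (\<lambda>\<omega>. \<Sum>i<Suc N. f (T N (Suc i)) \<omega> * R N i \<omega>)" for N
  proof -
    let ?e = "\<lambda>i \<omega>. f (T N (Suc i)) \<omega> * iexp (- \<theta> N i \<omega>)"
    have fT [measurable]: "f (T N i) \<in> borel_measurable M" for i by (intro f_meas T0)
    have e_int: "integrable M (?e i)" for i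
      by (rule integrable_const_bound[where B = 1]) (auto simp: norm_mult)
    have e_exp: "expectation (?e i) = of_real (q N) * \<phi>" for i
      using one_step[OF T0[of N i] Tle[of N i], of \<xi> \<eta>] f_exp[OF T0, of N i]
      unfolding f_def \<theta>_def a_def b1_def b2_def q_def Tstep by simp
    let ?h = "2 / real (Suc N)"
    have pt: "f (T N (Suc i)) \<omega> * R N i \<omega> = f (T N (Suc i)) \<omega> - ?e i \<omega> - \<i> * of_real (a * ?h) * f (T N (Suc i)) \<omega>
       - \<i> * of_real b1 * (f (T N (Suc i)) \<omega> * of_real (L (T N (Suc i)) \<omega> $ 1 - L (T N i) \<omega> $ 1))
       - \<i> * of_real b2 * (f (T N (Suc i)) \<omega> * of_real (L (T N (Suc i)) \<omega> $ 2 - L (T N i) \<omega> $ 2))" for i \<omega>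
      unfolding R_def \<theta>_def Tstep by (simp add: algebra_simps)
    have "expectation (\<lambda>\<omega>. \<Sum>i<Suc N. f (T N (Suc i)) \<omega> * R N i \<omega>) =
       (\<Sum>i<Suc N. \<phi> - of_real (q N) * \<phi> - \<i> * of_real (a * ?h) * \<phi>
       - \<i> * of_real b1 * expectation (\<lambda>\<omega>. f (T N (Suc i)) \<omega> * of_real (L (T N (Suc i)) \<omega> $ 1 - L (T N i) \<omega> $ 1))
       - \<i> * of_real b2 * expectation (\<lambda>\<omega>. f (T N (Suc i)) \<omega> * of_real (L (T N (Suc i)) \<omega> $ 2 - L (T N i) \<omega> $ 2)))"
    proof -
      have lin: "integrable M (\<lambda>\<omega>. p \<omega> - e \<omega> - k * p \<omega> - k1 * x \<omega> - k2 * y \<omega>)"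
          "expectation (\<lambda>\<omega>. p \<omega> - e \<omega> - k * p \<omega> - k1 * x \<omega> - k2 * y \<omega>) =
            expectation p - expectation e - k * expectation p - k1 * expectation x - k2 * expectation y"
        if "integrable M p" "integrable M e" "integrable M x" "integrable M y"
        for p e x y :: "'a \<Rightarrow> complex" and k k1 k2 using that by simp_all
      show ?thesis
        unfolding pt
      proof (subst Bochner_Integration.integral_sum, goal_cases)
        case (1 i)
        then show ?case by (intro lin(1) f_int T0 e_int fL_int) simp_all
      next
        case 2
        show ?case
        proof (intro sum.cong refl, goal_cases)
          case (1 i)
          then have i: "i < Suc N" by simp
          show ?case
            by (simp only: lin(2)[OF f_int[OF T0[of N "Suc i"]] e_int[of i] fL_int[OF i, of 1] fL_int[OF i, of 2]]
                e_exp f_exp[OF T0])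
        qed
      qed
    qed
    also have "\<dots> = of_nat (Suc N) * (\<phi> - of_real (q N) * \<phi> - \<i> * of_real (a * ?h) * \<phi>)
       - \<i> * of_real b1 * expectation (S 1 N) - \<i> * of_real b2 * expectation (S 2 N)"
      unfolding S_def
      by (subst (1 2) Bochner_Integration.integral_sum)
        (auto intro!: fL_int simp: sum_subtractf sum_distrib_left simp del: of_real_diff sum.lessThan_Suc of_nat_Suc)
    also have "of_nat (Suc N) * (\<phi> - of_real (q N) * \<phi> - \<i> * of_real (a * ?h) * \<phi>) =
        of_nat (Suc N) * (1 - of_real (q N)) * \<phi> - 2 * \<i> * of_real a * \<phi>"
      by (simp add: field_simps del: of_nat_Suc)
    finally show ?thesis by simp
  qed
  have q_lim: "(\<lambda>N. of_nat (Suc N) * (1 - of_real (q N)) * \<phi>) \<longlonglongrightarrow> of_real ((\<xi> - \<eta>)\<^sup>2) * \<phi>"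
  proof -
    have "(\<lambda>N. real (Suc N) * (1 - q N)) \<longlonglongrightarrow> (\<xi> - \<eta>)\<^sup>2"
      unfolding q_def by real_asymp
    then have "(\<lambda>N. complex_of_real (real (Suc N) * (1 - q N))) \<longlonglongrightarrow> of_real ((\<xi> - \<eta>)\<^sup>2)"
      by (rule tendsto_of_real)
    then have "(\<lambda>N. complex_of_real (real (Suc N) * (1 - q N)) * \<phi>) \<longlonglongrightarrow> of_real ((\<xi> - \<eta>)\<^sup>2) * \<phi>"
      by (rule tendsto_mult_right)
    then show ?thesis by simp
  qed
  have "(\<lambda>N. of_nat (Suc N) * (1 - of_real (q N)) * \<phi>) \<longlonglongrightarrow> 2 * \<i> * of_real a * \<phi>
      + \<i> * of_real b1 * (\<integral>p. f (C1.passage p) (fst p) \<partial>C1.clock)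
      + \<i> * of_real b2 * (\<integral>p. f (C2.passage p) (fst p) \<partial>C2.clock) + expectation (\<lambda>\<omega>. 0)"
    unfolding main by (intro tendsto_intros S1 S2 R_lim)
  note limit = LIMSEQ_unique[OF q_lim this]
  have g_meas: "(\<lambda>\<omega>. iexp (c * G t \<omega> $ i)) \<in> borel_measurable M" if "0 \<le> t" for c t i
    using that by measurable
  have g_cont: "continuous_on {0..} (\<lambda>t. iexp (c * G t \<omega> $ i))" if "\<omega> \<in> space M" for c \<omega> i
    by (intro continuous_intros G_continuous that)
  from limit
  have "of_real ((\<xi> - \<eta>)\<^sup>2) * \<phi> = 2 * \<i> * of_real a * \<phi>
      + \<i> * of_real b1 * (\<integral>p. f (C1.passage p) (fst p) \<partial>C1.clock)
      + \<i> * of_real b2 * (\<integral>p. f (C2.passage p) (fst p) \<partial>C2.clock)"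
    by (simp only: Bochner_Integration.integral_zero add_0_right)
  moreover have "(\<integral>p. f (C1.passage p) (fst p) \<partial>C1.clock) = (\<integral>p. iexp (\<eta> * G (C1.passage p) (fst p) $ 2) \<partial>C1.clock)"
  proof (rule integral_cong_AE)
    show "AE p in C1.clock. f (C1.passage p) (fst p) = iexp (\<eta> * G (C1.passage p) (fst p) $ 2)"
    proof -
      have "AE p in C1.clock. G (C1.passage p) (fst p) $ 1 = 0"
        by (rule C1.AE_clock_support[of "\<lambda>t \<omega>. G t \<omega> $ 1"])
          (simp_all add: G_component_measurable G_component_continuous L_support)
      then show ?thesis by eventually_elim (simp add: f_def)
    qed
    show "(\<lambda>p. f (C1.passage p) (fst p)) \<in> borel_measurable C1.clock"
      unfolding measurable_cong_sets[OF C1.sets_clock refl]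
      by (rule C1.process_at_passage_measurable(1)[OF f_meas f_cont])
    show "(\<lambda>p. iexp (\<eta> * G (C1.passage p) (fst p) $ 2)) \<in> borel_measurable C1.clock"
      unfolding measurable_cong_sets[OF C1.sets_clock refl]
      by (rule C1.process_at_passage_measurable(1)[OF g_meas g_cont])
  qed
  moreover have "(\<integral>p. f (C2.passage p) (fst p) \<partial>C2.clock) = (\<integral>p. iexp (\<xi> * G (C2.passage p) (fst p) $ 1) \<partial>C2.clock)"
  proof (rule integral_cong_AE)
    show "AE p in C2.clock. f (C2.passage p) (fst p) = iexp (\<xi> * G (C2.passage p) (fst p) $ 1)"
    proof -
      have "AE p in C2.clock. G (C2.passage p) (fst p) $ 2 = 0"
        by (rule C2.AE_clock_support[of "\<lambda>t \<omega>. G t \<omega> $ 2"])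
          (simp_all add: G_component_measurable G_component_continuous L_support)
      then show ?thesis by eventually_elim (simp add: f_def)
    qed
    show "(\<lambda>p. f (C2.passage p) (fst p)) \<in> borel_measurable C2.clock"
      unfolding measurable_cong_sets[OF C2.sets_clock refl]
      by (rule C2.process_at_passage_measurable(1)[OF f_meas f_cont])
    show "(\<lambda>p. iexp (\<xi> * G (C2.passage p) (fst p) $ 1)) \<in> borel_measurable C2.clock"
      unfolding measurable_cong_sets[OF C2.sets_clock refl]
      by (rule C2.process_at_passage_measurable(1)[OF g_meas g_cont])
  qed
  moreover have "2 * \<i> * of_real a * \<phi> = - 2 * \<i> * of_real (m1 * \<xi> + m2 * \<eta>) * \<phi>"
    unfolding a_def of_real_minus mult_minus_left mult_minus_right by (rule refl)
  ultimately show ?thesis by (simp only: b1_def b2_def)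
qed

end

section \<open>From Brownian motion to the one-step identity\<close>

lemma (in brownian_motion) increment_measurable:
  assumes "0 \<le> s" "s \<le> t"
  shows "(\<lambda>\<omega>. W t \<omega> - W s \<omega>) \<in> borel_measurable M"
  using W_increment_gaussian[OF assms] by (simp add: centered_gaussian_vector_def)

lemma (in brownian_motion) increment_law:
  assumes "0 \<le> s" "s \<le> t"
  shows "distr M borel (\<lambda>\<omega>. a \<bullet> (W t \<omega> - W s \<omega>)) =
    distr std_normal_distribution borel (\<lambda>z. sqrt (a \<bullet> (((t - s) *\<^sub>R \<Sigma>) *v a)) * z)"
  using W_increment_gaussian[OF assms] by (simp add: centered_gaussian_vector_def)

lemma (in brownian_motion) increment_char:
  assumes "0 \<le> s" "s \<le> t"
  shows "expectation (\<lambda>\<omega>. iexp (a \<bullet> (W t \<omega> - W s \<omega>))) =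
    of_real (exp (- (sqrt (a \<bullet> (((t - s) *\<^sub>R \<Sigma>) *v a)))\<^sup>2 / 2))"
proof -
  let ?c = "sqrt (a \<bullet> (((t - s) *\<^sub>R \<Sigma>) *v a))"
  have [measurable]: "(\<lambda>\<omega>. a \<bullet> (W t \<omega> - W s \<omega>)) \<in> borel_measurable M"
    using increment_measurable[OF assms] by measurable
  have "expectation (\<lambda>\<omega>. iexp (a \<bullet> (W t \<omega> - W s \<omega>))) =
      (\<integral>x. iexp x \<partial>distr M borel (\<lambda>\<omega>. a \<bullet> (W t \<omega> - W s \<omega>)))"
    by (subst integral_distr) auto
  also have "\<dots> = (\<integral>z. iexp (?c * z) \<partial>std_normal_distribution)"
    unfolding increment_law[OF assms] by (subst integral_distr) auto
  also have "\<dots> = char std_normal_distribution ?c" by (simp add: char_def)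
  also have "\<dots> = of_real (exp (- ?c\<^sup>2 / 2))" by (simp only: char_std_normal_distribution)
  finally show ?thesis .
qed

lemma (in brownian_motion) increment_integrable:
  assumes "0 \<le> s" "s \<le> t"
  shows "integrable M (\<lambda>\<omega>. a \<bullet> (W t \<omega> - W s \<omega>))"
proof -
  let ?c = "sqrt (a \<bullet> (((t - s) *\<^sub>R \<Sigma>) *v a))"
  have [measurable]: "(\<lambda>\<omega>. a \<bullet> (W t \<omega> - W s \<omega>)) \<in> borel_measurable M"
    using increment_measurable[OF assms] by measurable
  have "integrable std_normal_distribution (\<lambda>z. z)"
    using integrable_std_normal_moment[of 1]
    by (subst integrable_density) (auto simp: normal_density_nonneg)
  then have "integrable std_normal_distribution (\<lambda>z. ?c * z)" by (rule integrable_mult_right)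
  then have "integrable (distr std_normal_distribution borel (\<lambda>z. ?c * z)) (\<lambda>x. x)"
    by (subst integrable_distr_eq) auto
  then have "integrable (distr M borel (\<lambda>\<omega>. a \<bullet> (W t \<omega> - W s \<omega>))) (\<lambda>x. x)"
    by (simp only: increment_law[OF assms])
  then show ?thesis by (subst (asm) integrable_distr_eq) auto
qed

text \<open>
  \<open>X\<close> is known at time \<open>s\<close>, and the increment after \<open>s\<close> is independent of that information.
\<close>

lemma (in brownian_motion) increment_factorization:
  fixes X :: "'a \<Rightarrow> complex"
  assumes st: "0 \<le> s" "s \<le> t" and X: "X \<in> borel_measurable (F s)" and bound: "\<And>\<omega>. norm (X \<omega>) \<le> 1"
  shows "expectation (\<lambda>\<omega>. X \<omega> * iexp (a \<bullet> (W t \<omega> - W s \<omega>))) =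
    expectation X * expectation (\<lambda>\<omega>. iexp (a \<bullet> (W t \<omega> - W s \<omega>)))"
proof -
  let ?D = "\<lambda>\<omega>. W t \<omega> - W s \<omega>"
  let ?Y = "\<lambda>\<omega>. iexp (a \<bullet> ?D \<omega>)"
  let ?V = "vimage_algebra (space M) ?D borel"
  have spF: "space (F s) = space M" and subF: "sets (F s) \<subseteq> sets M"
    using F_subalgebra[of s] by (auto simp: subalgebra_def)
  have XM [measurable]: "X \<in> borel_measurable M"
    using X F_subalgebra[of s] by (rule measurable_from_subalg[rotated])
  have DV: "?D \<in> measurable ?V borel" by (rule measurable_vimage_algebra1) auto
  have [measurable]: "?D \<in> borel_measurable M" by (rule increment_measurable[OF st])
  have YV: "?Y \<in> borel_measurable ?V"
    by (rule measurable_compose[OF DV]) (intro borel_measurable_continuous_onI continuous_intros)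
  have YM: "?Y \<in> borel_measurable M" by measurable
  have "sigma_sets (space M) {X -` A \<inter> space M | A. A \<in> sets borel} \<subseteq> sets (F s)"
    using sets.sigma_sets_subset[of "{X -` A \<inter> space M | A. A \<in> sets borel}" "F s"]
      measurable_sets[OF X] by (auto simp: spF)
  moreover have "sigma_sets (space M) {?Y -` A \<inter> space M | A. A \<in> sets borel} \<subseteq> sets ?V"
    using sets.sigma_sets_subset[of "{?Y -` A \<inter> space M | A. A \<in> sets borel}" ?V]
      measurable_sets[OF YV] by auto
  ultimately have "indep_set (sigma_sets (space M) {X -` A \<inter> space M | A. A \<in> sets borel})
      (sigma_sets (space M) {?Y -` A \<inter> space M | A. A \<in> sets borel})"
    using W_increment_indep[OF st] unfolding indep_set_def
    by (elim indep_sets_mono_sets) (auto split: bool.split)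
  then have "indep_var borel X borel ?Y"
    unfolding indep_var_eq using XM YM by auto
  then show ?thesis
    by (rule indep_var_lebesgue_integral)
      (auto intro!: integrable_const_bound[where B = 1] AE_I2 bound YM)
qed

lemma borel_measurable_vec_component: "(\<lambda>g. g $ i) \<in> borel_measurable (borel :: (real^'n) measure)"
  by (intro borel_measurable_continuous_onI continuous_intros)

lemma borel_measurable_iexp: "f \<in> borel_measurable M \<Longrightarrow> (\<lambda>\<omega>. iexp (f \<omega>)) \<in> borel_measurable M"
  by (rule measurable_compose[of f M borel iexp]) (auto intro!: borel_measurable_continuous_onI continuous_intros)

context degenerate_reflected_bm
begin

lemma G_measurable: "0 \<le> t \<Longrightarrow> G t \<in> borel_measurable M"
  and L_measurable: "0 \<le> t \<Longrightarrow> L t \<in> borel_measurable M"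
  using G_adapted L_adapted F_subalgebra[of t] by (auto intro: measurable_from_subalg)

text \<open>
  Only the difference of the coordinates sees the noise, since \<open>W\<^sub>1 + W\<^sub>2\<close> has variance zero.
\<close>

lemma degenerate_quadratic_form:
  fixes a :: "real^2"
  shows "a \<bullet> ((c *\<^sub>R (vector [vector [1, -1], vector [-1, 1]] :: real^2^2)) *v a) = c * (a $ 1 - a $ 2)\<^sup>2"
  by (simp add: inner_vec_def sum_2 matrix_vector_mult_def power2_eq_square algebra_simps)

lemma inner_vector_2: "(vector [x, y] :: real^2) \<bullet> b = x * b $ 1 + y * b $ 2"
  by (simp add: inner_vec_def sum_2)

text \<open>
  Removing the bounded-variation part of the phase leaves the exponential at time \<open>s\<close> times that of a Gaussian
  increment independent of the past.
\<close>

lemma one_step_identity: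
  assumes st: "0 \<le> s" "s \<le> t"
  shows "expectation (\<lambda>\<omega>. iexp (\<xi> * G t \<omega> $ 1 + \<eta> * G t \<omega> $ 2) *
        iexp (- (- (\<mu>1 * \<xi> + \<mu>2 * \<eta>) * (t - s) + (\<xi> + r1 * \<eta>) * (L t \<omega> $ 1 - L s \<omega> $ 1)
          + (r2 * \<xi> + \<eta>) * (L t \<omega> $ 2 - L s \<omega> $ 2)))) =
      of_real (exp (- ((\<xi> - \<eta>)\<^sup>2 * (t - s) / 2))) *
        expectation (\<lambda>\<omega>. iexp (\<xi> * G s \<omega> $ 1 + \<eta> * G s \<omega> $ 2))"
proof -
  let ?a = "vector [\<xi>, \<eta>] :: real^2"
  let ?X = "\<lambda>\<omega>. iexp (\<xi> * G s \<omega> $ 1 + \<eta> * G s \<omega> $ 2)"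
  have X: "?X \<in> borel_measurable (F s)"
    by (rule measurable_compose[OF G_adapted[OF st(1)]]) (intro borel_measurable_continuous_onI continuous_intros)
  have t0: "0 \<le> t" using st by simp
  have iexp_mult: "iexp a * iexp b = iexp (a + b)" for a b :: real
    unfolding of_real_add distrib_left exp_add by (rule refl)
  have "expectation (\<lambda>\<omega>. iexp (\<xi> * G t \<omega> $ 1 + \<eta> * G t \<omega> $ 2) *
        iexp (- (- (\<mu>1 * \<xi> + \<mu>2 * \<eta>) * (t - s) + (\<xi> + r1 * \<eta>) * (L t \<omega> $ 1 - L s \<omega> $ 1)
          + (r2 * \<xi> + \<eta>) * (L t \<omega> $ 2 - L s \<omega> $ 2)))) =
     expectation (\<lambda>\<omega>. ?X \<omega> * iexp (?a \<bullet> (W t \<omega> - W s \<omega>)))"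
  proof (rule integral_cong_AE)
    show "AE \<omega> in M. iexp (\<xi> * G t \<omega> $ 1 + \<eta> * G t \<omega> $ 2) *
        iexp (- (- (\<mu>1 * \<xi> + \<mu>2 * \<eta>) * (t - s) + (\<xi> + r1 * \<eta>) * (L t \<omega> $ 1 - L s \<omega> $ 1)
          + (r2 * \<xi> + \<eta>) * (L t \<omega> $ 2 - L s \<omega> $ 2))) = ?X \<omega> * iexp (?a \<bullet> (W t \<omega> - W s \<omega>))"
      using G_equation1 G_equation2
    proof eventually_elim
      fix \<omega>
      assume e1: "\<forall>t\<ge>0. G t \<omega> $ 1 = G 0 \<omega> $ 1 - \<mu>1 * t + W t \<omega> $ 1 + L t \<omega> $ 1 + r2 * L t \<omega> $ 2"
        and e2: "\<forall>t\<ge>0. G t \<omega> $ 2 = G 0 \<omega> $ 2 - \<mu>2 * t + W t \<omega> $ 2 + r1 * L t \<omega> $ 1 + L t \<omega> $ 2"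
      have "(\<xi> * G t \<omega> $ 1 + \<eta> * G t \<omega> $ 2) + - (- (\<mu>1 * \<xi> + \<mu>2 * \<eta>) * (t - s) + (\<xi> + r1 * \<eta>) * (L t \<omega> $ 1 - L s \<omega> $ 1)
          + (r2 * \<xi> + \<eta>) * (L t \<omega> $ 2 - L s \<omega> $ 2)) = (\<xi> * G s \<omega> $ 1 + \<eta> * G s \<omega> $ 2) + ?a \<bullet> (W t \<omega> - W s \<omega>)"
        unfolding e1[rule_format, OF st(1)] e2[rule_format, OF st(1)] e1[rule_format, OF t0] e2[rule_format, OF t0]
          inner_vector_2 by (simp add: algebra_simps)
      then show "iexp (\<xi> * G t \<omega> $ 1 + \<eta> * G t \<omega> $ 2) *
        iexp (- (- (\<mu>1 * \<xi> + \<mu>2 * \<eta>) * (t - s) + (\<xi> + r1 * \<eta>) * (L t \<omega> $ 1 - L s \<omega> $ 1)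
          + (r2 * \<xi> + \<eta>) * (L t \<omega> $ 2 - L s \<omega> $ 2))) = ?X \<omega> * iexp (?a \<bullet> (W t \<omega> - W s \<omega>))"
        by (simp only: iexp_mult)
    qed
  qed (intro borel_measurable_times borel_measurable_iexp borel_measurable_add borel_measurable_diff
      borel_measurable_uminus borel_measurable_const borel_measurable_inner increment_measurable[OF st]
      measurable_compose[OF G_measurable[OF st(1)] borel_measurable_vec_component] measurable_compose[OF G_measurable[OF t0] borel_measurable_vec_component]
      measurable_compose[OF L_measurable[OF st(1)] borel_measurable_vec_component] measurable_compose[OF L_measurable[OF t0] borel_measurable_vec_component])+
  also have "\<dots> = expectation ?X * expectation (\<lambda>\<omega>. iexp (?a \<bullet> (W t \<omega> - W s \<omega>)))"
    by (rule increment_factorization[OF st X]) simp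
  also have "expectation (\<lambda>\<omega>. iexp (?a \<bullet> (W t \<omega> - W s \<omega>))) = of_real (exp (- ((\<xi> - \<eta>)\<^sup>2 * (t - s) / 2)))"
  proof -
    have "(sqrt ((t - s) * (?a $ 1 - ?a $ 2)\<^sup>2))\<^sup>2 = (t - s) * (?a $ 1 - ?a $ 2)\<^sup>2"
      using st by (intro real_sqrt_pow2 mult_nonneg_nonneg) auto
    also have "\<dots> = (\<xi> - \<eta>)\<^sup>2 * (t - s)" by (simp only: vector_2 mult.commute)
    finally show ?thesis
      unfolding increment_char[OF st] degenerate_quadratic_form minus_divide_left[symmetric] by (simp only:)
  qed
  finally show ?thesis unfolding mult.commute[of "expectation ?X"] .
qed

text \<open>
  For \<open>h\<close> as in the assumptions, \<open>h \<bullet> G\<close> has increment \<open>c1 L\<^sub>1 + c2 L\<^sub>2\<close> plus a linear drift and a Gaussian term.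
  The local times being nonnegative, the increment of the stationary process \<open>h \<bullet> G\<close> is bounded below by an
  integrable variable, and such an increment is integrable.
\<close>

lemma local_time_combination_integrable:
  fixes h :: "real^2"
  assumes inv: "started_from_invariant M G \<pi>"
    and c: "h $ 1 + r1 * h $ 2 = c1" "r2 * h $ 1 + h $ 2 = c2" "0 \<le> c1" "0 \<le> c2"
  shows "integrable M (\<lambda>\<omega>. c1 * L 2 \<omega> $ 1 + c2 * L 2 \<omega> $ 2)"
proof -
  note [measurable] = G_measurable L_measurable
  have law: "distr M borel (\<lambda>\<omega>. h \<bullet> G 0 \<omega>) = distr M borel (\<lambda>\<omega>. h \<bullet> G 2 \<omega>)"
  proof -
    have "distr M borel (\<lambda>\<omega>. h \<bullet> G u \<omega>) = distr (distr M borel (G u)) borel (\<lambda>g. h \<bullet> g)" if "0 \<le> u" for u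
      using that by (subst distr_distr) (auto simp: comp_def)
    then show ?thesis using inv by (simp add: started_from_invariant_def)
  qed
  define k where "k = 2 * (h $ 1 * \<mu>1 + h $ 2 * \<mu>2)"
  let ?w = "\<lambda>\<omega>. \<bar>k\<bar> + \<bar>h \<bullet> (W 2 \<omega> - W 0 \<omega>)\<bar>"
  have w_int: "integrable M ?w"
    by (intro Bochner_Integration.integrable_add integrable_abs increment_integrable) auto
  have eq: "AE \<omega> in M. c1 * L 2 \<omega> $ 1 + c2 * L 2 \<omega> $ 2 = (h \<bullet> G 2 \<omega> - h \<bullet> G 0 \<omega>) + k - h \<bullet> (W 2 \<omega> - W 0 \<omega>)"
    using G_equation1 G_equation2 L_zero
  proof eventually_elim
    fix \<omega>
    assume e1: "\<forall>t\<ge>0. G t \<omega> $ 1 = G 0 \<omega> $ 1 - \<mu>1 * t + W t \<omega> $ 1 + L t \<omega> $ 1 + r2 * L t \<omega> $ 2"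
      and e2: "\<forall>t\<ge>0. G t \<omega> $ 2 = G 0 \<omega> $ 2 - \<mu>2 * t + W t \<omega> $ 2 + r1 * L t \<omega> $ 1 + L t \<omega> $ 2"
      and z: "L 0 \<omega> = 0"
    have w0: "W 0 \<omega> $ 1 = 0" "W 0 \<omega> $ 2 = 0"
      using e1[rule_format, of 0] e2[rule_format, of 0] z by auto
    have g2: "G 2 \<omega> $ 1 = G 0 \<omega> $ 1 - \<mu>1 * 2 + W 2 \<omega> $ 1 + L 2 \<omega> $ 1 + r2 * L 2 \<omega> $ 2"
      "G 2 \<omega> $ 2 = G 0 \<omega> $ 2 - \<mu>2 * 2 + W 2 \<omega> $ 2 + r1 * L 2 \<omega> $ 1 + L 2 \<omega> $ 2"
      by (rule e1[rule_format], simp) (rule e2[rule_format], simp)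
    show "c1 * L 2 \<omega> $ 1 + c2 * L 2 \<omega> $ 2 = (h \<bullet> G 2 \<omega> - h \<bullet> G 0 \<omega>) + k - h \<bullet> (W 2 \<omega> - W 0 \<omega>)"
      unfolding inner_vec_def sum_2 vector_minus_component g2 w0 k_def c(1)[symmetric] c(2)[symmetric] inner_real_def
      by (simp add: algebra_simps)
  qed
  have pos: "AE \<omega> in M. 0 \<le> c1 * L 2 \<omega> $ 1 + c2 * L 2 \<omega> $ 2"
    using L_mono L_zero
  proof eventually_elim
    fix \<omega> assume mono: "\<forall>i. mono_on {0..} (\<lambda>t. L t \<omega> $ i)" and z: "L 0 \<omega> = 0"
    have "0 \<le> L 2 \<omega> $ i" for i
      using mono_onD[OF mono[rule_format], of 0 2 i] by (simp add: z)
    then show "0 \<le> c1 * L 2 \<omega> $ 1 + c2 * L 2 \<omega> $ 2"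
      by (intro add_nonneg_nonneg mult_nonneg_nonneg c(3) c(4))
  qed
  have "AE \<omega> in M. - ?w \<omega> \<le> h \<bullet> G 2 \<omega> - h \<bullet> G 0 \<omega>"
    using eq pos by eventually_elim linarith
  then have "integrable M (\<lambda>\<omega>. h \<bullet> G 2 \<omega> - h \<bullet> G 0 \<omega>)"
    by (intro integrable_stationary_increment[OF _ _ law w_int]) auto
  then have int: "integrable M (\<lambda>\<omega>. (h \<bullet> G 2 \<omega> - h \<bullet> G 0 \<omega>) + k - h \<bullet> (W 2 \<omega> - W 0 \<omega>))"
    by (intro Bochner_Integration.integrable_diff[OF Bochner_Integration.integrable_add[OF _ integrable_const] increment_integrable]) auto
  have m1: "(\<lambda>\<omega>. c1 * L 2 \<omega> $ 1 + c2 * L 2 \<omega> $ 2) \<in> borel_measurable M"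
  proof -
    have L2: "L 2 \<in> borel_measurable M" by (rule L_measurable) simp
    show ?thesis by (intro borel_measurable_add borel_measurable_times borel_measurable_const borel_measurable_vec_component[THEN measurable_compose[OF L2]])
  qed
  have m2: "(\<lambda>\<omega>. (h \<bullet> G 2 \<omega> - h \<bullet> G 0 \<omega>) + k - h \<bullet> (W 2 \<omega> - W 0 \<omega>)) \<in> borel_measurable M"
    by (rule borel_measurable_integrable[OF int])
  have "integrable M (\<lambda>\<omega>. c1 * L 2 \<omega> $ 1 + c2 * L 2 \<omega> $ 2) \<longleftrightarrow>
      integrable M (\<lambda>\<omega>. (h \<bullet> G 2 \<omega> - h \<bullet> G 0 \<omega>) + k - h \<bullet> (W 2 \<omega> - W 0 \<omega>))"
    using m1 m2 eq by (rule integrable_cong_AE)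
  then show ?thesis using int by (rule iffD2)
qed

text \<open>
  If \<open>1 - r1 r2 \<noteq> 0\<close> the reflection matrix is invertible, so that each local time alone is a combination of
  the kind treated above.
\<close>

lemma local_time_integrable:
  assumes inv: "started_from_invariant M G \<pi>" and d: "1 - r1 * r2 \<noteq> 0"
  shows "integrable M (\<lambda>\<omega>. L 2 \<omega> $ i)"
proof -
  let ?d = "1 - r1 * r2"
  have e: "1 / ?d + r1 * (- r2 / ?d) = 1" "r2 * (1 / ?d) + (- r2 / ?d) = 0"
    "- r1 / ?d + r1 * (1 / ?d) = 0" "r2 * (- r1 / ?d) + 1 / ?d = 1"
  proof -
    have "1 / ?d + r1 * (- r2 / ?d) = ?d / ?d" "r2 * (- r1 / ?d) + 1 / ?d = ?d / ?d"
      unfolding diff_divide_distrib by simp_all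
    then show "1 / ?d + r1 * (- r2 / ?d) = 1" "r2 * (- r1 / ?d) + 1 / ?d = 1"
      using d by simp_all
  qed simp_all
  have "integrable M (\<lambda>\<omega>. 1 * L 2 \<omega> $ 1 + 0 * L 2 \<omega> $ 2)"
    by (rule local_time_combination_integrable[OF inv, of "vector [1 / ?d, - r2 / ?d]"])
      (simp_all only: vector_2 e order.refl zero_le_one)
  moreover have "integrable M (\<lambda>\<omega>. 0 * L 2 \<omega> $ 1 + 1 * L 2 \<omega> $ 2)"
    by (rule local_time_combination_integrable[OF inv, of "vector [- r1 / ?d, 1 / ?d]"])
      (simp_all only: vector_2 e order.refl zero_le_one)
  ultimately show ?thesis using exhaust_2[of i] by (elim disjE) simp_all
qed

text \<open>
  Setting the paths to zero on a null set makes all path properties hold everywhere; this is what joint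
  measurability of the time change needs.
\<close>

lemma regular_version:
  assumes inv: "started_from_invariant M G \<pi>" and d: "1 - r1 * r2 \<noteq> 0"
  obtains G' L' where "stationary_reflected_process M G' L' r1 r2 \<mu>1 \<mu>2"
    and "AE \<omega> in M. \<forall>t. G' t \<omega> = G t \<omega> \<and> L' t \<omega> = L t \<omega>"
proof -
  define good where "good = (\<lambda>\<omega>. continuous_on {0..} (\<lambda>t. G t \<omega>) \<and> (\<forall>t\<ge>0. \<forall>i. 0 \<le> G t \<omega> $ i) \<and>
    L 0 \<omega> = 0 \<and> continuous_on {0..} (\<lambda>t. L t \<omega>) \<and> (\<forall>i. mono_on {0..} (\<lambda>t. L t \<omega> $ i)) \<and>
    (\<forall>i. emeasure (path_measure (\<lambda>t. L t \<omega> $ i)) {t. 0 \<le> t \<and> G t \<omega> $ i \<noteq> 0} = 0))"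
  have "AE \<omega> in M. good \<omega>"
    using G_continuous G_quadrant L_zero L_continuous L_mono L_support
    by eventually_elim (simp add: good_def)
  then obtain N where N: "\<And>\<omega>. \<omega> \<in> space M - N \<Longrightarrow> good \<omega>" "N \<in> null_sets M"
    using AE_E3 by blast
  define \<Omega> where "\<Omega> = space M - N"
  have \<Omega>: "\<Omega> \<in> sets M" "\<And>\<omega>. \<omega> \<in> \<Omega> \<Longrightarrow> good \<omega>" using N by (auto simp: \<Omega>_def)
  have G_cont: "continuous_on {0..} (\<lambda>t. G t \<omega>)" and G_pos: "\<And>t i. 0 \<le> t \<Longrightarrow> 0 \<le> G t \<omega> $ i"
    and L_0: "L 0 \<omega> = 0" and L_cont: "continuous_on {0..} (\<lambda>t. L t \<omega>)"
    and L_mon: "\<And>i. mono_on {0..} (\<lambda>t. L t \<omega> $ i)"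
    and L_sup: "\<And>i. emeasure (path_measure (\<lambda>t. L t \<omega> $ i)) {t. 0 \<le> t \<and> G t \<omega> $ i \<noteq> 0} = 0"
    if "\<omega> \<in> \<Omega>" for \<omega>
    using \<Omega>(2)[OF that] unfolding good_def by blast+
  have AE_\<Omega>: "AE \<omega> in M. \<omega> \<in> \<Omega>"
    using AE_not_in[OF N(2)] by (auto simp: \<Omega>_def elim!: AE_mp intro!: AE_I2)
  define G' where "G' = (\<lambda>t \<omega>. if \<omega> \<in> \<Omega> then G t \<omega> else 0)"
  define L' where "L' = (\<lambda>t \<omega>. if \<omega> \<in> \<Omega> then L t \<omega> else 0)"
  have eq: "AE \<omega> in M. \<forall>t. G' t \<omega> = G t \<omega> \<and> L' t \<omega> = L t \<omega>"
    using AE_\<Omega> by eventually_elim (simp add: G'_def L'_def)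
  have GM': "G' u \<in> borel_measurable M" and LM': "L' u \<in> borel_measurable M" if "0 \<le> u" for u
    unfolding G'_def L'_def using G_measurable[OF that] L_measurable[OF that] \<Omega>(1) by (auto intro!: measurable_If_set)
  have law: "distr M borel (G' t) = \<pi>" if "0 \<le> t" for t
  proof -
    have "distr M borel (G' t) = distr M borel (G t)"
      using G_measurable[OF that] GM'[OF that] eq by (intro distr_cong_AE) auto
    then show ?thesis using inv that by (simp add: started_from_invariant_def)
  qed
  have "stationary_reflected_process M G' L' r1 r2 \<mu>1 \<mu>2"
  proof (intro stationary_reflected_process.intro prob_space_axioms stationary_reflected_process_axioms.intro)
    show "G' t \<in> borel_measurable M" if "0 \<le> t" for t using that by (rule GM')
    show "continuous_on {0..} (\<lambda>t. G' t \<omega>)" for \<omega>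
      by (cases "\<omega> \<in> \<Omega>") (simp_all add: G'_def G_cont)
    show "0 \<le> G' t \<omega> $ i" if "0 \<le> t" for t \<omega> i
      using that by (cases "\<omega> \<in> \<Omega>") (simp_all add: G'_def G_pos)
    show "boundary_clock M (\<lambda>t \<omega>. L' t \<omega> $ i)" for i
    proof unfold_locales
      show "(\<lambda>\<omega>. L' t \<omega> $ i) \<in> borel_measurable M" if "0 \<le> t" for t
        by (rule measurable_compose[OF LM'[OF that] borel_measurable_vec_component])
      show "continuous_on {0..} (\<lambda>t. L' t \<omega> $ i)" for \<omega>
      proof (cases "\<omega> \<in> \<Omega>")
        case True
        have "continuous_on {0..} (\<lambda>t. L t \<omega> $ i)" by (intro continuous_intros L_cont[OF True])
        with True show ?thesis by (simp add: L'_def)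
      qed (simp add: L'_def)
      show "mono_on {0..} (\<lambda>t. L' t \<omega> $ i)" for \<omega>
        by (cases "\<omega> \<in> \<Omega>") (simp_all add: L'_def L_mon, simp add: mono_on_def)
      show "L' 0 \<omega> $ i = 0" for \<omega>
        by (simp add: L'_def L_0)
    qed
    show "integrable M (\<lambda>\<omega>. L' 2 \<omega> $ i)" for i
    proof -
      have "integrable M (\<lambda>\<omega>. L 2 \<omega> $ i) \<longleftrightarrow> integrable M (\<lambda>\<omega>. L' 2 \<omega> $ i)"
      proof (rule integrable_cong_AE)
        show "AE \<omega> in M. L 2 \<omega> $ i = L' 2 \<omega> $ i" using eq by eventually_elim simp
      qed (use measurable_compose[OF L_measurable[of 2] borel_measurable_vec_component] measurable_compose[OF LM'[of 2] borel_measurable_vec_component] in auto)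
      then show ?thesis using local_time_integrable[OF inv d, of i] by simp
    qed
    show "emeasure (path_measure (\<lambda>t. L' t \<omega> $ i)) {t. 0 \<le> t \<and> G' t \<omega> $ i \<noteq> 0} = 0" for \<omega> i
      by (cases "\<omega> \<in> \<Omega>") (simp_all add: L'_def G'_def L_sup)
    show "distr M borel (G' t) = distr M borel (G' 0)" if "0 \<le> t" for t
      using law[OF that] law[of 0] by simp
    fix \<xi> \<eta> s t :: real assume st: "0 \<le> s" "s \<le> t"
    then have t0: "0 \<le> t" by simp
    note intros = borel_measurable_times borel_measurable_iexp borel_measurable_add borel_measurable_diff
      borel_measurable_uminus borel_measurable_const
      G_measurable[OF st(1), THEN measurable_compose, OF borel_measurable_vec_component] G_measurable[OF t0, THEN measurable_compose, OF borel_measurable_vec_component]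
      L_measurable[OF st(1), THEN measurable_compose, OF borel_measurable_vec_component] L_measurable[OF t0, THEN measurable_compose, OF borel_measurable_vec_component]
      GM'[OF st(1), THEN measurable_compose, OF borel_measurable_vec_component] GM'[OF t0, THEN measurable_compose, OF borel_measurable_vec_component]
      LM'[OF st(1), THEN measurable_compose, OF borel_measurable_vec_component] LM'[OF t0, THEN measurable_compose, OF borel_measurable_vec_component]
    have "expectation (\<lambda>\<omega>. iexp (\<xi> * G' t \<omega> $ 1 + \<eta> * G' t \<omega> $ 2) *
        iexp (- (- (\<mu>1 * \<xi> + \<mu>2 * \<eta>) * (t - s) + (\<xi> + r1 * \<eta>) * (L' t \<omega> $ 1 - L' s \<omega> $ 1)
          + (r2 * \<xi> + \<eta>) * (L' t \<omega> $ 2 - L' s \<omega> $ 2)))) =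
      expectation (\<lambda>\<omega>. iexp (\<xi> * G t \<omega> $ 1 + \<eta> * G t \<omega> $ 2) *
        iexp (- (- (\<mu>1 * \<xi> + \<mu>2 * \<eta>) * (t - s) + (\<xi> + r1 * \<eta>) * (L t \<omega> $ 1 - L s \<omega> $ 1)
          + (r2 * \<xi> + \<eta>) * (L t \<omega> $ 2 - L s \<omega> $ 2))))"
    proof (rule integral_cong_AE, goal_cases)
      case 1 show ?case by (intro intros)
    next
      case 2 show ?case by (intro intros)
    next
      case 3
      from eq show "AE \<omega> in M. iexp (\<xi> * G' t \<omega> $ 1 + \<eta> * G' t \<omega> $ 2) *
        iexp (- (- (\<mu>1 * \<xi> + \<mu>2 * \<eta>) * (t - s) + (\<xi> + r1 * \<eta>) * (L' t \<omega> $ 1 - L' s \<omega> $ 1)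
          + (r2 * \<xi> + \<eta>) * (L' t \<omega> $ 2 - L' s \<omega> $ 2))) =
        iexp (\<xi> * G t \<omega> $ 1 + \<eta> * G t \<omega> $ 2) *
        iexp (- (- (\<mu>1 * \<xi> + \<mu>2 * \<eta>) * (t - s) + (\<xi> + r1 * \<eta>) * (L t \<omega> $ 1 - L s \<omega> $ 1)
          + (r2 * \<xi> + \<eta>) * (L t \<omega> $ 2 - L s \<omega> $ 2)))"
      proof eventually_elim
        case (elim \<omega>)
        then show ?case by (simp only:)
      qed
    qed
    also have "\<dots> = of_real (exp (- ((\<xi> - \<eta>)\<^sup>2 * (t - s) / 2))) *
        expectation (\<lambda>\<omega>. iexp (\<xi> * G s \<omega> $ 1 + \<eta> * G s \<omega> $ 2))"
      by (rule one_step_identity[OF st])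
    also have "expectation (\<lambda>\<omega>. iexp (\<xi> * G s \<omega> $ 1 + \<eta> * G s \<omega> $ 2)) =
        expectation (\<lambda>\<omega>. iexp (\<xi> * G' s \<omega> $ 1 + \<eta> * G' s \<omega> $ 2))"
    proof (rule integral_cong_AE, goal_cases)
      case 1 show ?case by (intro intros)
    next
      case 2 show ?case by (intro intros)
    next
      case 3
      from eq show "AE \<omega> in M. iexp (\<xi> * G s \<omega> $ 1 + \<eta> * G s \<omega> $ 2) = iexp (\<xi> * G' s \<omega> $ 1 + \<eta> * G' s \<omega> $ 2)"
      proof eventually_elim
        case (elim \<omega>)
        then show ?case by (simp only:)
      qed
    qed
    finally show "expectation (\<lambda>\<omega>. iexp (\<xi> * G' t \<omega> $ 1 + \<eta> * G' t \<omega> $ 2) *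
        iexp (- (- (\<mu>1 * \<xi> + \<mu>2 * \<eta>) * (t - s) + (\<xi> + r1 * \<eta>) * (L' t \<omega> $ 1 - L' s \<omega> $ 1)
          + (r2 * \<xi> + \<eta>) * (L' t \<omega> $ 2 - L' s \<omega> $ 2)))) =
      of_real (exp (- ((\<xi> - \<eta>)\<^sup>2 * (t - s) / 2))) *
        expectation (\<lambda>\<omega>. iexp (\<xi> * G' s \<omega> $ 1 + \<eta> * G' s \<omega> $ 2))" .
  qed
  then show ?thesis using eq by (rule that)
qed

end

context stationary_reflected_process
begin

section \<open>The functional equation on the left half-planes\<close>

text \<open>
  Unlike the transform of the lateral measure, this one includes the mass that \<open>dL\<^sub>1\<close> might put on the corner
  \<open>G\<^sub>2 = 0\<close>; likewise for the second axis.
\<close>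

definition boundary_laplace1 :: "complex \<Rightarrow> complex" where
  "boundary_laplace1 y = (\<integral>p. exp (y * of_real (G (C1.passage p) (fst p) $ 2)) \<partial>C1.clock)"

definition boundary_laplace2 :: "complex \<Rightarrow> complex" where
  "boundary_laplace2 x = (\<integral>p. exp (x * of_real (G (C2.passage p) (fst p) $ 1)) \<partial>C2.clock)"

definition interior_laplace :: "complex \<Rightarrow> complex \<Rightarrow> complex" where
  "interior_laplace x y = expectation (\<lambda>\<omega>. exp (x * of_real (G 0 \<omega> $ 1)) * exp (y * of_real (G 0 \<omega> $ 2)))"

lemma finite_clock1: "finite_measure C1.clock" and finite_clock2: "finite_measure C2.clock"
  by (intro C1.finite_clock L_integrable C2.finite_clock)+

lemma G_at_passage_measurable:
  "(\<lambda>p. G (C1.passage p) (fst p) $ i) \<in> borel_measurable C1.clock"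
  "(\<lambda>p. G (C2.passage p) (fst p) $ i) \<in> borel_measurable C2.clock"
  using C1.process_at_passage_measurable(1)[OF G_component_measurable G_component_continuous]
    C2.process_at_passage_measurable(1)[OF G_component_measurable G_component_continuous]
  by (simp_all only: measurable_cong_sets[OF C1.sets_clock refl] measurable_cong_sets[OF C2.sets_clock refl])

lemma G_at_passage_nonneg:
  "p \<in> space C1.clock \<Longrightarrow> 0 \<le> G (C1.passage p) (fst p) $ i"
  "p \<in> space C2.clock \<Longrightarrow> 0 \<le> G (C2.passage p) (fst p) $ i"
  by (auto simp: C1.space_clock C2.space_clock intro!: G_nonneg C1.passage_bounds C2.passage_bounds)

lemma boundary_laplace_continuous_on:
  "continuous_on {z. Re z \<le> 0} boundary_laplace1" "continuous_on {z. Re z \<le> 0} boundary_laplace2"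
  using laplace_weighted_continuous_on[OF finite_clock1 G_at_passage_measurable(1), of "\<lambda>_. 1" 2]
    laplace_weighted_continuous_on[OF finite_clock2 G_at_passage_measurable(2), of "\<lambda>_. 1" 1]
    G_at_passage_nonneg
  by (simp_all add: boundary_laplace1_def[abs_def] boundary_laplace2_def[abs_def])

lemma boundary_laplace_holomorphic_on:
  "boundary_laplace1 holomorphic_on {z. Re z < 0}" "boundary_laplace2 holomorphic_on {z. Re z < 0}"
  using laplace_weighted_holomorphic_on[OF finite_clock1 G_at_passage_measurable(1), of "\<lambda>_. 1" 2]
    laplace_weighted_holomorphic_on[OF finite_clock2 G_at_passage_measurable(2), of "\<lambda>_. 1" 1]
    G_at_passage_nonneg
  by (simp_all add: boundary_laplace1_def[abs_def] boundary_laplace2_def[abs_def])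

lemma boundary_laplace_norm_le:
  assumes "Re z \<le> 0"
  shows "norm (boundary_laplace1 z) \<le> measure C1.clock (space C1.clock)"
    "norm (boundary_laplace2 z) \<le> measure C2.clock (space C2.clock)"
  using laplace_weighted_norm_le[OF finite_clock1 G_at_passage_measurable(1), of "\<lambda>_. 1" 2 z]
    laplace_weighted_norm_le[OF finite_clock2 G_at_passage_measurable(2), of "\<lambda>_. 1" 1 z]
    G_at_passage_nonneg assms
  by (simp_all add: boundary_laplace1_def boundary_laplace2_def)

lemma norm_exp_G_le: "Re z \<le> 0 \<Longrightarrow> \<omega> \<in> space M \<Longrightarrow> norm (exp (z * of_real (G 0 \<omega> $ i))) \<le> 1"
  using G_nonneg[of \<omega> 0 i] by (simp add: mult_nonpos_nonneg)

lemma interior_laplace_regular1: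
  assumes "Re y \<le> 0"
  shows "continuous_on {z. Re z \<le> 0} (\<lambda>x. interior_laplace x y)"
    "(\<lambda>x. interior_laplace x y) holomorphic_on {z. Re z < 0}"
proof -
  have m: "(\<lambda>\<omega>. exp (y * of_real (G 0 \<omega> $ 2))) \<in> borel_measurable M" by measurable
  show "continuous_on {z. Re z \<le> 0} (\<lambda>x. interior_laplace x y)"
    unfolding interior_laplace_def
    by (intro laplace_weighted_continuous_on finite_measure_axioms m G_component_measurable G_nonneg norm_exp_G_le assms) auto
  show "(\<lambda>x. interior_laplace x y) holomorphic_on {z. Re z < 0}"
    unfolding interior_laplace_def
    by (intro laplace_weighted_holomorphic_on finite_measure_axioms m G_component_measurable G_nonneg norm_exp_G_le assms) auto
qed

lemma interior_laplace_regular2: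
  assumes "Re x \<le> 0"
  shows "continuous_on {z. Re z \<le> 0} (\<lambda>y. interior_laplace x y)"
    "(\<lambda>y. interior_laplace x y) holomorphic_on {z. Re z < 0}"
proof -
  have m: "(\<lambda>\<omega>. exp (x * of_real (G 0 \<omega> $ 1))) \<in> borel_measurable M" by measurable
  have eq: "(\<lambda>y. interior_laplace x y) = (\<lambda>y. expectation (\<lambda>\<omega>. exp (y * of_real (G 0 \<omega> $ 2)) * exp (x * of_real (G 0 \<omega> $ 1))))"
    unfolding interior_laplace_def by (simp add: mult.commute)
  show "continuous_on {z. Re z \<le> 0} (\<lambda>y. interior_laplace x y)"
    unfolding eq
    by (intro laplace_weighted_continuous_on finite_measure_axioms m G_component_measurable G_nonneg norm_exp_G_le assms) auto
  show "(\<lambda>y. interior_laplace x y) holomorphic_on {z. Re z < 0}"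
    unfolding eq
    by (intro laplace_weighted_holomorphic_on finite_measure_axioms m G_component_measurable G_nonneg norm_exp_G_le assms) auto
qed

definition adjoint_defect :: "complex \<Rightarrow> complex \<Rightarrow> complex" where
  "adjoint_defect x y = ((x - y)\<^sup>2 - 2 * (of_real m1 * x + of_real m2 * y)) * interior_laplace x y
    + (x + of_real r1 * y) * boundary_laplace1 y + (of_real r2 * x + y) * boundary_laplace2 x"

lemma adjoint_defect_imaginary: "adjoint_defect (\<i> * of_real \<xi>) (\<i> * of_real \<eta>) = 0"
proof -
  define \<phi> where "\<phi> = interior_laplace (\<i> * of_real \<xi>) (\<i> * of_real \<eta>)"
  define A where "A = boundary_laplace1 (\<i> * of_real \<eta>)"
  define B where "B = boundary_laplace2 (\<i> * of_real \<xi>)"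
  have "\<phi> = expectation (\<lambda>\<omega>. iexp (\<xi> * G 0 \<omega> $ 1 + \<eta> * G 0 \<omega> $ 2))"
    unfolding \<phi>_def interior_laplace_def by (simp add: exp_add[symmetric] algebra_simps)
  moreover have "A = (\<integral>p. iexp (\<eta> * G (C1.passage p) (fst p) $ 2) \<partial>C1.clock)"
    unfolding A_def boundary_laplace1_def by (simp add: algebra_simps)
  moreover have "B = (\<integral>p. iexp (\<xi> * G (C2.passage p) (fst p) $ 1) \<partial>C2.clock)"
    unfolding B_def boundary_laplace2_def by (simp add: algebra_simps)
  ultimately have rel: "of_real ((\<xi> - \<eta>)\<^sup>2) * \<phi> = - 2 * \<i> * of_real (m1 * \<xi> + m2 * \<eta>) * \<phi>
      + \<i> * of_real (\<xi> + r1 * \<eta>) * A + \<i> * of_real (r2 * \<xi> + \<eta>) * B"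
    using adjoint_relation_imaginary[of \<xi> \<eta>] by simp
  have sq: "(\<i> * of_real \<xi> - \<i> * of_real \<eta>)\<^sup>2 = - of_real ((\<xi> - \<eta>)\<^sup>2)"
    by (simp add: power_mult_distrib flip: right_diff_distrib)
  have "adjoint_defect (\<i> * of_real \<xi>) (\<i> * of_real \<eta>) = - (of_real ((\<xi> - \<eta>)\<^sup>2) * \<phi>)
     + (- 2 * \<i> * of_real (m1 * \<xi> + m2 * \<eta>) * \<phi>
      + \<i> * of_real (\<xi> + r1 * \<eta>) * A + \<i> * of_real (r2 * \<xi> + \<eta>) * B)"
    unfolding adjoint_defect_def sq \<phi>_def[symmetric] A_def[symmetric] B_def[symmetric] by (simp add: algebra_simps)
  then show ?thesis unfolding rel by simp
qed

text \<open>
  The defect is continuous in each variable on the closed half-plane and holomorphic inside, so vanishing on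
  imaginary pairs spreads first to all \<open>x\<close> for imaginary \<open>y\<close>, then to all \<open>y\<close>.
\<close>

lemma adjoint_relation:
  assumes x: "Re x \<le> 0" and y: "Re y \<le> 0"
  shows "adjoint_defect x y = 0"
proof -
  have imag: "z = \<i> * of_real (Im z)" if "Re z = 0" for z using that by (simp add: complex_eq_iff)
  have step: "adjoint_defect x y = 0" if "Re y = 0" "Re x \<le> 0" for x y
  proof (rule zero_on_left_half_plane_if_zero_on_axis[where f = "\<lambda>x. adjoint_defect x y"])
    show "continuous_on {z. Re z \<le> 0} (\<lambda>x. adjoint_defect x y)"
      unfolding adjoint_defect_def
      using that by (intro continuous_intros interior_laplace_regular1 boundary_laplace_continuous_on) auto
    show "(\<lambda>x. adjoint_defect x y) holomorphic_on {z. Re z < 0}"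
      unfolding adjoint_defect_def
      using that by (intro holomorphic_intros interior_laplace_regular1 boundary_laplace_holomorphic_on) auto
    show "adjoint_defect z y = 0" if "Re z = 0" for z
      using adjoint_defect_imaginary[of "Im z" "Im y"] imag[OF that] imag[OF \<open>Re y = 0\<close>] by simp
  qed fact
  show ?thesis
  proof (rule zero_on_left_half_plane_if_zero_on_axis[where f = "\<lambda>y. adjoint_defect x y"])
    show "continuous_on {z. Re z \<le> 0} (\<lambda>y. adjoint_defect x y)"
      unfolding adjoint_defect_def
      using x by (intro continuous_intros interior_laplace_regular2 boundary_laplace_continuous_on) auto
    show "(\<lambda>y. adjoint_defect x y) holomorphic_on {z. Re z < 0}"
      unfolding adjoint_defect_def
      using x by (intro holomorphic_intros interior_laplace_regular2 boundary_laplace_holomorphic_on) auto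
    show "adjoint_defect x z = 0" if "Re z = 0" for z
      by (rule step[OF that x])
  qed fact
qed

text \<open>
  By the time change the set function defining the lateral measure is an honest image measure, restricted to
  the open half-line.
\<close>

lemma lateral_measure1_eq:
  "lateral_measure1 M G L = restrict_space (distr C1.clock borel (\<lambda>p. G (C1.passage p) (fst p) $ 2)) {0<..}"
proof -
  let ?N = "distr C1.clock borel (\<lambda>p. G (C1.passage p) (fst p) $ 2)"
  have [measurable]: "(\<lambda>p. G (C1.passage p) (fst p) $ 2) \<in> borel_measurable (M \<Otimes>\<^sub>M lborel)"
    by (rule C1.process_at_passage_measurable(1)[OF G_component_measurable G_component_continuous])
  have sets_eq: "sets (restrict_space borel {0<..}) = ((\<inter>) {0::real<..} ` sets borel)"
    by (simp add: sets_restrict_space)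
  have "restrict_space ?N {0<..} = measure_of {0<..} ((\<inter>) {0<..} ` sets borel) (emeasure ?N)"
    by (simp add: restrict_space_def)
  also have "\<dots> = lateral_measure1 M G L"
    unfolding lateral_measure1_def sets_eq
  proof (rule measure_of_eq)
    show "(\<inter>) {0<..} ` sets borel \<subseteq> Pow {0::real<..}" by auto
    fix A assume "A \<in> sigma_sets {0::real<..} ((\<inter>) {0<..} ` sets borel)"
    then have "A \<in> sets (restrict_space borel {0::real<..})"
      by (metis sets_eq sets.sigma_sets_eq space_restrict_space space_borel Int_UNIV_right)
    then have A [measurable]: "A \<in> sets borel" by (auto simp: sets_restrict_space)
    have "emeasure ?N A = (\<integral>\<^sup>+p. indicator A (G (C1.passage p) (fst p) $ 2) \<partial>C1.clock)"
    proof -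
      have "emeasure ?N A = (\<integral>\<^sup>+x. indicator A x \<partial>?N)" by simp
      also have "\<dots> = (\<integral>\<^sup>+p. indicator A (G (C1.passage p) (fst p) $ 2) \<partial>C1.clock)"
        by (intro nn_integral_distr G_at_passage_measurable) simp
      finally show ?thesis .
    qed
    also have "\<dots> = (\<integral>\<^sup>+\<omega>. (\<integral>\<^sup>+u\<in>{0<..L 2 \<omega> $ 1}. indicator A (G (C1.passage (\<omega>, u)) \<omega> $ 2) \<partial>lborel) \<partial>M)"
      by (subst C1.nn_integral_clock) auto
    also have "\<dots> = (\<integral>\<^sup>+ \<omega>. (\<integral>\<^sup>+ t\<in>{0..2}. indicator A (G t \<omega> $ 2) \<partial>path_measure (\<lambda>t. L t \<omega> $ 1)) \<partial>M)"
    proof (rule nn_integral_cong)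
      fix \<omega> assume \<omega>: "\<omega> \<in> space M"
      let ?h = "\<lambda>t. indicator A (G (max 0 t) \<omega> $ 2) :: ennreal"
      have "continuous_on UNIV (\<lambda>t. G (max 0 t) \<omega> $ 2)"
        by (rule continuous_on_compose2[OF G_component_continuous[OF \<omega>]]) (auto intro!: continuous_intros)
      then have [measurable]: "(\<lambda>t. G (max 0 t) \<omega> $ 2) \<in> borel_measurable borel"
        by (rule borel_measurable_continuous_onI)
      have "(\<integral>\<^sup>+t\<in>{0..2}. indicator A (G t \<omega> $ 2) \<partial>path_measure (\<lambda>t. L t \<omega> $ 1)) =
          (\<integral>\<^sup>+t\<in>{0..2}. ?h t \<partial>path_measure (\<lambda>t. L t \<omega> $ 1))"
        by (intro nn_integral_cong) (auto simp: indicator_def max_def)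
      also have "\<dots> = (\<integral>\<^sup>+u\<in>{0<..L 2 \<omega> $ 1}. ?h (first_passage (\<lambda>t. L t \<omega> $ 1) u) \<partial>lborel)"
        using \<omega> by (intro path_measure_eq_first_passage C1.l_continuous C1.l_mono C1.l_zero) auto
      also have "\<dots> = (\<integral>\<^sup>+u\<in>{0<..L 2 \<omega> $ 1}. indicator A (G (C1.passage (\<omega>, u)) \<omega> $ 2) \<partial>lborel)"
        by (intro nn_integral_cong) (simp add: C1.passage_def max_def first_passage_bounds)
      finally show "(\<integral>\<^sup>+u\<in>{0<..L 2 \<omega> $ 1}. indicator A (G (C1.passage (\<omega>, u)) \<omega> $ 2) \<partial>lborel) =
        (\<integral>\<^sup>+t\<in>{0..2}. indicator A (G t \<omega> $ 2) \<partial>path_measure (\<lambda>t. L t \<omega> $ 1))" ..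
    qed
    finally show "emeasure ?N A = (\<integral>\<^sup>+ \<omega>. (\<integral>\<^sup>+ t\<in>{0..2}. indicator A (G t \<omega> $ 2) \<partial>path_measure (\<lambda>t. L t \<omega> $ 1)) \<partial>M)" .
  qed
  finally show ?thesis ..
qed

lemma laplace_lateral_measure1:
  "laplace_transform (lateral_measure1 M G L) y =
    (\<integral>p. indicator {0<..} (G (C1.passage p) (fst p) $ 2) *\<^sub>R exp (y * of_real (G (C1.passage p) (fst p) $ 2)) \<partial>C1.clock)"
  unfolding laplace_transform_def lateral_measure1_eq
  using G_at_passage_measurable(1)[of 2]
  by (subst integral_restrict_space, simp) (subst integral_distr, auto)

text \<open>
  As \<open>y\<close> tends to \<open>-\<infinity>\<close>, the transform \<^const>\<open>boundary_laplace1\<close> tends to the mass of the corner. If the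
  limit is zero, restriction to the open half-line loses nothing.
\<close>

lemma laplace_lateral_measure1_eq_boundary_laplace1:
  assumes decay: "((\<lambda>k. boundary_laplace1 (- of_nat k)) \<longlonglongrightarrow> 0)"
  shows "laplace_transform (lateral_measure1 M G L) y = boundary_laplace1 y"
proof -
  interpret F: finite_measure C1.clock by (rule finite_clock1)
  let ?Z = "\<lambda>p. G (C1.passage p) (fst p) $ 2"
  have [measurable]: "?Z \<in> borel_measurable C1.clock" by (rule G_at_passage_measurable)
  have "(\<lambda>k. \<integral>p. exp (- of_nat k * of_real (?Z p)) \<partial>C1.clock) \<longlonglongrightarrow> (\<integral>p. of_real (indicator {0} (?Z p)) \<partial>C1.clock :: complex)"
  proof (rule integral_dominated_convergence[where w = "\<lambda>_. 1"])
    show "AE p in C1.clock. (\<lambda>k. exp (- of_nat k * of_real (?Z p)) :: complex) \<longlonglongrightarrow> of_real (indicator {0} (?Z p))"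
    proof (rule AE_I2)
      fix p assume p: "p \<in> space C1.clock"
      show "(\<lambda>k. exp (- of_nat k * of_real (?Z p)) :: complex) \<longlonglongrightarrow> of_real (indicator {0} (?Z p))"
      proof (cases "?Z p = 0")
        case False
        then have "exp (- ?Z p) < 1" using G_at_passage_nonneg(1)[OF p, of 2] by simp
        then have "(\<lambda>k. exp (- ?Z p) ^ k) \<longlonglongrightarrow> 0" by (intro LIMSEQ_realpow_zero) auto
        then have "(\<lambda>k. complex_of_real (exp (- ?Z p) ^ k)) \<longlonglongrightarrow> of_real 0" by (rule tendsto_of_real)
        moreover have "complex_of_real (exp (- ?Z p) ^ k) = exp (- of_nat k * of_real (?Z p))" for k
          by (simp add: exp_of_nat_mult[symmetric] exp_of_real[symmetric])
        ultimately show ?thesis using False by simp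
      qed simp
    qed
    show "AE p in C1.clock. norm (exp (- of_nat k * of_real (?Z p)) :: complex) \<le> 1" for k
      using G_at_passage_nonneg(1)[of _ 2] by (intro AE_I2) simp
  qed auto
  moreover have "(\<lambda>k. \<integral>p. exp (- of_nat k * of_real (?Z p)) \<partial>C1.clock) \<longlonglongrightarrow> (0 :: complex)"
    using decay by (simp add: boundary_laplace1_def)
  ultimately have "(\<integral>p. of_real (indicator {0} (?Z p)) \<partial>C1.clock) = (0 :: complex)"
    by (rule LIMSEQ_unique)
  then have "(\<integral>p. indicator {0} (?Z p) \<partial>C1.clock) = (0 :: real)"
    by (subst (asm) integral_complex_of_real) simp
  moreover have "integrable C1.clock (\<lambda>p. indicator {0} (?Z p) :: real)"
    by (rule F.integrable_const_bound[where B = 1]) (auto simp: indicator_def)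
  ultimately have "AE p in C1.clock. indicator {0} (?Z p) = (0 :: real)"
    by (subst (asm) integral_nonneg_eq_0_iff_AE) auto
  then have "AE p in C1.clock. indicator {0<..} (?Z p) *\<^sub>R exp (y * of_real (?Z p)) = exp (y * of_real (?Z p))"
    using AE_space by eventually_elim (use G_at_passage_nonneg(1)[of _ 2] in \<open>force simp: indicator_def split: if_splits\<close>)
  then show ?thesis
    unfolding laplace_lateral_measure1 boundary_laplace1_def by (intro integral_cong_AE) auto
qed

end

section \<open>Uniformization and the rational form\<close>

lemma prod_linear_factors_growth:
  fixes u w :: "nat \<Rightarrow> complex"
  obtains K where "0 \<le> K" "\<And>s. norm (\<Prod>k<n. (s + u k) * (s + w k)) \<le> K * (1 + norm s) ^ (2 * n)"
proof -
  have lin: "norm (s + a) \<le> (1 + norm a) * (1 + norm s)" for s a :: complex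
  proof -
    have "0 \<le> norm a * norm s" by simp
    moreover have "(1 + norm a) * (1 + norm s) = 1 + norm a + norm s + norm a * norm s"
      by (simp add: algebra_simps)
    ultimately show ?thesis using norm_triangle_ineq[of s a] by linarith
  qed
  define K where "K = (\<Prod>k<n. (1 + norm (u k)) * (1 + norm (w k)))"
  show ?thesis
  proof (rule that)
    show "0 \<le> K" unfolding K_def by (intro prod_nonneg) auto
    fix s
    have "norm (\<Prod>k<n. (s + u k) * (s + w k)) = (\<Prod>k<n. norm ((s + u k) * (s + w k)))"
      by (simp only: prod_norm)
    also have "\<dots> \<le> (\<Prod>k<n. ((1 + norm (u k)) * (1 + norm (w k))) * (1 + norm s)\<^sup>2)"
    proof (intro prod_mono conjI)
      fix k
      have "norm ((s + u k) * (s + w k)) \<le> ((1 + norm (u k)) * (1 + norm s)) * ((1 + norm (w k)) * (1 + norm s))"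
        unfolding norm_mult by (intro mult_mono lin) auto
      then show "norm ((s + u k) * (s + w k)) \<le> ((1 + norm (u k)) * (1 + norm (w k))) * (1 + norm s)\<^sup>2"
        by (simp add: power2_eq_square mult_ac)
    qed simp
    also have "\<dots> = K * (1 + norm s) ^ (2 * n)"
      unfolding K_def prod.distrib[of _ "\<lambda>_. (1 + norm s)\<^sup>2"] by (simp add: power_mult)
    finally show "norm (\<Prod>k<n. (s + u k) * (s + w k)) \<le> K * (1 + norm s) ^ (2 * n)" .
  qed
qed

context stationary_reflected_process
begin

text \<open>
  \<open>s \<mapsto> (x_param s, y_param s)\<close> parametrizes the parabola on which the kernel
  \<open>(x - y)\<^sup>2 - 2(m1 x + m2 y)\<close> vanishes; here \<open>x - y = 2s\<close>.
\<close>

definition x_param :: "complex \<Rightarrow> complex" where "x_param s = 2 * s * (s + of_real m2)"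
definition y_param :: "complex \<Rightarrow> complex" where "y_param s = 2 * s * (s - of_real m1)"

lemma Re_param:
  "Re (x_param s) = 2 * (Re s * (Re s + m2) - (Im s)\<^sup>2)"
  "Re (y_param s) = 2 * (Re s * (Re s - m1) - (Im s)\<^sup>2)"
  by (simp_all add: x_param_def y_param_def power2_eq_square algebra_simps)

lemma kernel_vanishes_on_curve:
  assumes "m1 + m2 = 1"
  shows "(x_param s - y_param s)\<^sup>2 - 2 * (of_real m1 * x_param s + of_real m2 * y_param s) = 0"
proof -
  have "m2 = 1 - m1" using assms by simp
  then have m2: "(of_real m2 :: complex) = 1 - of_real m1" by simp
  show ?thesis unfolding x_param_def y_param_def m2 by (simp add: power2_eq_square algebra_simps)
qed

lemma curve_relation:
  assumes mu: "m1 + m2 = 1" and r: "r1 \<noteq> -1" "r2 \<noteq> -1" and s: "Re s = 0" "Im s \<noteq> 0"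
  shows "of_real (1 + r1) * (s - of_real (s_one r1 m1 m2)) * boundary_laplace1 (y_param s)
    + of_real (1 + r2) * (s - of_real (s_two r2 m1 m2)) * boundary_laplace2 (x_param s) = 0"
proof -
  have "Re (x_param s) \<le> 0" "Re (y_param s) \<le> 0" using s by (simp_all add: Re_param)
  from adjoint_relation[OF this]
  have 1: "(x_param s + of_real r1 * y_param s) * boundary_laplace1 (y_param s)
      + (of_real r2 * x_param s + y_param s) * boundary_laplace2 (x_param s) = 0"
    unfolding adjoint_defect_def kernel_vanishes_on_curve[OF mu] by simp
  have "(1 + r1) * s_one r1 m1 m2 = r1 * m1 - m2" "(1 + r2) * s_two r2 m1 m2 = m1 - r2 * m2"
    using r by (simp_all add: s_one_def s_two_def)
  from this[THEN arg_cong[where f = complex_of_real]]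
  have s1: "of_real (1 + r1) * of_real (s_one r1 m1 m2) = (of_real r1 * of_real m1 - of_real m2 :: complex)"
    and s2: "of_real (1 + r2) * of_real (s_two r2 m1 m2) = (of_real m1 - of_real r2 * of_real m2 :: complex)"
    by (simp_all only: of_real_mult of_real_diff)
  have 2: "x_param s + of_real r1 * y_param s = 2 * s * (of_real (1 + r1) * (s - of_real (s_one r1 m1 m2)))"
    unfolding right_diff_distrib[of "of_real (1 + r1)"] s1 by (simp add: x_param_def y_param_def algebra_simps)
  have 3: "of_real r2 * x_param s + y_param s = 2 * s * (of_real (1 + r2) * (s - of_real (s_two r2 m1 m2)))"
    unfolding right_diff_distrib[of "of_real (1 + r2)"] s2 by (simp add: x_param_def y_param_def algebra_simps)
  have "2 * s * (of_real (1 + r1) * (s - of_real (s_one r1 m1 m2)) * boundary_laplace1 (y_param s)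
    + of_real (1 + r2) * (s - of_real (s_two r2 m1 m2)) * boundary_laplace2 (x_param s)) = 0"
    using 1 unfolding 2 3 distrib_left mult.assoc .
  moreover have "s \<noteq> 0" using s by auto
  ultimately show ?thesis by simp
qed

text \<open>
  With \<open>s\<^sub>2 = s\<^sub>1 - n\<close> the ratio \<open>(s - s\<^sub>2)/(s - s\<^sub>1)\<close> in the curve relation equals \<open>PB s / PA s\<close> for
  two polynomials that are invariant under \<open>s \<mapsto> m1 - s\<close> and \<open>s \<mapsto> -m2 - s\<close> respectively; up to the factor
  \<open>2 ^ n\<close>, \<open>PA s\<close> is the product of the statement evaluated at \<open>y_param s\<close>. The gluing of strips
  then applies.
\<close>

lemma boundary_laplace1_times_product:
  fixes n :: nat
  assumes mu: "m1 + m2 = 1" "m1 > 0" "m2 > 0" and r: "r1 \<noteq> -1" "r2 \<noteq> -1"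
    and gap: "s_two r2 m1 m2 = s_one r1 m1 m2 - real n"
  obtains c where "\<And>y. Re y \<le> 0 \<Longrightarrow>
    boundary_laplace1 y * (\<Prod>k<n. y - of_real (y_curve m1 (s_one r1 m1 m2 - real k))) = c"
proof -
  define \<sigma> :: complex where "\<sigma> = of_real (s_one r1 m1 m2)"
  have s2: "complex_of_real (s_two r2 m1 m2) = \<sigma> - of_nat n" by (simp add: gap \<sigma>_def)
  have m2: "(of_real m2 :: complex) = 1 - of_real m1"
    using mu(1) by (metis add_diff_cancel_left' of_real_1 of_real_diff)
  define PA where "PA = (\<lambda>s. \<Prod>k<n. (s - \<sigma> + of_nat k) * (s + \<sigma> - of_nat k - of_real m1))"
  define PB where "PB = (\<lambda>s. \<Prod>k<n. (s - \<sigma> + of_nat (Suc k)) * (s + \<sigma> - of_nat k - of_real m1))"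
  define hA where "hA = (\<lambda>s. of_real (1 + r1) * PA s * boundary_laplace1 (y_param s))"
  define hB where "hB = (\<lambda>s. - of_real (1 + r2) * PB s * boundary_laplace2 (x_param s))"
  \<comment> \<open>Telescoping: consecutive factors of \<open>PA\<close> and \<open>PB\<close> differ by a shift of \<open>k\<close>.\<close>
  have shift: "(s - (\<sigma> - of_nat n)) * PA s = (s - \<sigma>) * PB s" for s
  proof -
    have "(s - \<sigma> + of_nat n) * (\<Prod>k<n. s - \<sigma> + of_nat k) = (\<Prod>k<Suc n. s - \<sigma> + of_nat k)"
      by (simp only: prod.lessThan_Suc mult.commute)
    also have "\<dots> = (s - \<sigma>) * (\<Prod>k<n. s - \<sigma> + of_nat (Suc k))"
      by (subst prod.lessThan_Suc_shift) simp
    finally have split: "(s - \<sigma> + of_nat n) * (\<Prod>k<n. s - \<sigma> + of_nat k) =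
      (s - \<sigma>) * (\<Prod>k<n. s - \<sigma> + of_nat (Suc k))" .
    have "s - (\<sigma> - of_nat n) = s - \<sigma> + of_nat n" by simp
    then show ?thesis
      unfolding PA_def PB_def prod.distrib mult.assoc[symmetric] by (simp only: split)
  qed
  have sub_le: "2 * (p - q\<^sup>2) \<le> 0" if "p \<le> 0" for p q :: real
  proof -
    have "p \<le> q\<^sup>2" by (rule order_trans[OF that zero_le_power2])
    then show ?thesis by simp
  qed
  have sub_less: "2 * (p - q\<^sup>2) < 0" if "p < 0" for p q :: real
  proof -
    have "p < q\<^sup>2" by (rule less_le_trans[OF that zero_le_power2])
    then show ?thesis by simp
  qed
  have reY: "Re (y_param s) \<le> 0" if "0 \<le> Re s" "Re s \<le> m1" for s
  proof -
    have "Re s * (Re s - m1) \<le> 0" using that by (intro mult_nonneg_nonpos) auto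
    then show ?thesis unfolding Re_param by (rule sub_le)
  qed
  have reY': "Re (y_param s) < 0" if "0 < Re s" "Re s < m1" for s
  proof -
    have "Re s * (Re s - m1) < 0" using that by (intro mult_pos_neg) auto
    then show ?thesis unfolding Re_param by (rule sub_less)
  qed
  have reX: "Re (x_param s) \<le> 0" if "- m2 \<le> Re s" "Re s \<le> 0" for s
  proof -
    have "Re s * (Re s + m2) \<le> 0" using that by (intro mult_nonpos_nonneg) auto
    then show ?thesis unfolding Re_param by (rule sub_le)
  qed
  have reX': "Re (x_param s) < 0" if "- m2 < Re s" "Re s < 0" for s
  proof -
    have "Re s * (Re s + m2) < 0" using that by (intro mult_neg_pos) auto
    then show ?thesis unfolding Re_param by (rule sub_less)
  qed
  have PA_hol: "PA holomorphic_on S" and PB_hol: "PB holomorphic_on S" for S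
    unfolding PA_def PB_def by (intro holomorphic_intros)+
  have y_hol: "y_param holomorphic_on S" and x_hol: "x_param holomorphic_on S" for S
    unfolding y_param_def[abs_def] x_param_def[abs_def] by (intro holomorphic_intros)+
  have contA: "continuous_on {s. 0 \<le> Re s \<and> Re s \<le> m1} hA"
    unfolding hA_def
    by (intro continuous_intros holomorphic_on_imp_continuous_on[OF PA_hol]
        continuous_on_compose2[OF boundary_laplace_continuous_on(1) holomorphic_on_imp_continuous_on[OF y_hol]])
      (auto simp: reY)
  have contB: "continuous_on {s. - m2 \<le> Re s \<and> Re s \<le> 0} hB"
    unfolding hB_def
    by (intro continuous_intros holomorphic_on_imp_continuous_on[OF PB_hol]
        continuous_on_compose2[OF boundary_laplace_continuous_on(2) holomorphic_on_imp_continuous_on[OF x_hol]])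
      (auto simp: reX)
  have holA: "hA holomorphic_on {s. 0 < Re s \<and> Re s < m1}"
  proof -
    have "(boundary_laplace1 \<circ> y_param) holomorphic_on {s. 0 < Re s \<and> Re s < m1}"
      by (rule holomorphic_on_compose_gen[OF y_hol boundary_laplace_holomorphic_on(1)]) (auto simp: reY')
    then show ?thesis unfolding hA_def comp_def by (intro holomorphic_intros PA_hol)
  qed
  have holB: "hB holomorphic_on {s. - m2 < Re s \<and> Re s < 0}"
  proof -
    have "(boundary_laplace2 \<circ> x_param) holomorphic_on {s. - m2 < Re s \<and> Re s < 0}"
      by (rule holomorphic_on_compose_gen[OF x_hol boundary_laplace_holomorphic_on(2)]) (auto simp: reX')
    then show ?thesis unfolding hB_def comp_def by (intro holomorphic_intros PB_hol)
  qed
  have reflA: "hA (of_real m1 - s) = hA s" for s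
  proof -
    have "PA (of_real m1 - s) = PA s"
      unfolding PA_def by (intro prod.cong refl) (simp add: algebra_simps)
    moreover have "y_param (of_real m1 - s) = y_param s" by (simp add: y_param_def algebra_simps)
    ultimately show ?thesis by (simp add: hA_def)
  qed
  have reflB: "hB (- of_real m2 - s) = hB s" for s
  proof -
    have "PB (- of_real m2 - s) = PB s"
      unfolding PB_def m2 by (intro prod.cong refl) (simp add: algebra_simps)
    moreover have "x_param (- of_real m2 - s) = x_param s" by (simp add: x_param_def algebra_simps)
    ultimately show ?thesis by (simp add: hB_def)
  qed
  have match': "hA s = hB s" if s: "Re s = 0" "Im s \<noteq> 0" for s
  proof -
    have "(s - \<sigma>) * (hA s - hB s) = of_real (1 + r1) * (s - \<sigma>) * PA s * boundary_laplace1 (y_param s)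
        + of_real (1 + r2) * ((s - \<sigma>) * PB s) * boundary_laplace2 (x_param s)"
      by (simp add: hA_def hB_def algebra_simps)
    also have "\<dots> = PA s * (of_real (1 + r1) * (s - \<sigma>) * boundary_laplace1 (y_param s)
        + of_real (1 + r2) * (s - (\<sigma> - of_nat n)) * boundary_laplace2 (x_param s))"
      unfolding shift[symmetric] by (simp only: distrib_left mult_ac)
    also have "\<dots> = 0"
      using curve_relation[OF mu(1) r s] unfolding \<sigma>_def[symmetric] s2 by simp
    finally have "(s - \<sigma>) * (hA s - hB s) = 0" .
    moreover have "s \<noteq> \<sigma>" using s by (auto simp: \<sigma>_def)
    ultimately show ?thesis by simp
  qed
  \<comment> \<open>The relation was divided by \<open>2s\<close>, so the origin is reached by continuity along the axis.\<close>
  have match: "hA s = hB s" if "Re s = 0" for s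
  proof (cases "Im s = 0")
    case True
    with that have s0: "s = 0" by (simp add: complex_eq_iff)
    let ?u = "\<lambda>k. \<i> * of_real (inverse (real (Suc k)))"
    have "?u \<longlonglongrightarrow> \<i> * of_real 0"
      by (intro tendsto_intros LIMSEQ_inverse_real_of_nat)
    then have u: "?u \<longlonglongrightarrow> 0" by simp
    have "(\<lambda>k. hA (?u k)) \<longlonglongrightarrow> hA 0"
      by (rule continuous_on_tendsto_compose[OF contA u]) (use mu in auto)
    moreover have "(\<lambda>k. hB (?u k)) \<longlonglongrightarrow> hB 0"
      by (rule continuous_on_tendsto_compose[OF contB u]) (use mu in auto)
    moreover have "hA (?u k) = hB (?u k)" for k by (rule match') auto
    ultimately show ?thesis unfolding s0 using LIMSEQ_unique by auto
  qed (use that match' in blast)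
  have PA_eq: "PA s = (\<Prod>k<n. (s + (- \<sigma> + of_nat k)) * (s + (\<sigma> - of_nat k - of_real m1)))" for s
    unfolding PA_def by (intro prod.cong refl) (simp add: algebra_simps)
  have PB_eq: "PB s = (\<Prod>k<n. (s + (- \<sigma> + of_nat (Suc k))) * (s + (\<sigma> - of_nat k - of_real m1)))" for s
    unfolding PB_def by (intro prod.cong refl) (simp add: algebra_simps)
  obtain KA where KA: "0 \<le> KA" "\<And>s. norm (PA s) \<le> KA * (1 + norm s) ^ (2 * n)"
    using prod_linear_factors_growth[where n = n and u = "\<lambda>k. - \<sigma> + of_nat k" and w = "\<lambda>k. \<sigma> - of_nat k - of_real m1"]
    unfolding PA_eq[symmetric] by blast
  obtain KB where KB: "0 \<le> KB" "\<And>s. norm (PB s) \<le> KB * (1 + norm s) ^ (2 * n)"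
    using prod_linear_factors_growth[where n = n and u = "\<lambda>k. - \<sigma> + of_nat (Suc k)" and w = "\<lambda>k. \<sigma> - of_nat k - of_real m1"]
    unfolding PB_eq[symmetric] by blast
  define cA where "cA = \<bar>1 + r1\<bar> * KA * measure C1.clock (space C1.clock)"
  define cB where "cB = \<bar>1 + r2\<bar> * KB * measure C2.clock (space C2.clock)"
  have c0: "0 \<le> cA" "0 \<le> cB" using KA KB by (simp_all add: cA_def cB_def)
  have growth: "norm (of_real a * P * b) \<le> (cA + cB) * N"
    if "norm P \<le> K * N" "norm b \<le> m" "0 \<le> K" "0 \<le> m" "0 \<le> N" "\<bar>a\<bar> * K * m \<le> cA + cB"
    for a K m N :: real and P b :: complex
  proof -
    have "norm (of_real a * P * b) \<le> \<bar>a\<bar> * (K * N) * m"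
      unfolding norm_mult norm_of_real using that by (intro mult_mono) auto
    also have "\<dots> = (\<bar>a\<bar> * K * m) * N" by simp
    also have "\<dots> \<le> (cA + cB) * N" using that by (intro mult_right_mono) auto
    finally show ?thesis .
  qed
  have growthA: "norm (hA s) \<le> (cA + cB) * (1 + norm s) ^ (2 * n)" if "0 \<le> Re s" "Re s \<le> m1" for s
    unfolding hA_def using c0
    by (intro growth[OF KA(2) boundary_laplace_norm_le(1)[OF reY[OF that]] KA(1)]) (auto simp: cA_def[symmetric])
  have growthB: "norm (hB s) \<le> (cA + cB) * (1 + norm s) ^ (2 * n)" if "- m2 \<le> Re s" "Re s \<le> 0" for s
    unfolding hB_def of_real_minus[symmetric] using c0
    by (intro growth[OF KB(2) boundary_laplace_norm_le(2)[OF reX[OF that]] KB(1)])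
      (simp_all only: abs_minus_cancel cB_def[symmetric], auto)
  obtain c where c: "\<And>s. 0 \<le> Re s \<Longrightarrow> Re s \<le> m1 \<Longrightarrow> hA s = c"
    using reflected_strip_functions_constant[OF mu(2,3,1) contA holA contB holB reflA reflB match growthA growthB]
    by blast
  define Qc where "Qc = (\<lambda>y. \<Prod>k<n. y - complex_of_real (y_curve m1 (s_one r1 m1 m2 - real k)))"
  have Qc_PA: "Qc (y_param s) = 2 ^ n * PA s" for s
  proof -
    have "Qc (y_param s) = (\<Prod>k<n. 2 * ((s - \<sigma> + of_nat k) * (s + \<sigma> - of_nat k - of_real m1)))"
      unfolding Qc_def by (intro prod.cong refl) (simp add: y_param_def y_curve_def \<sigma>_def algebra_simps)
    also have "\<dots> = 2 ^ n * PA s" unfolding PA_def prod.distrib[of "\<lambda>_. 2"] by simp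
    finally show ?thesis .
  qed
  define c' where "c' = 2 ^ n * c / of_real (1 + r1)"
  have r1': "complex_of_real (1 + r1) \<noteq> 0" using r(1) by (metis add.inverse_unique of_real_eq_0_iff)
  have on_strip: "boundary_laplace1 (y_param s) * Qc (y_param s) = c'" if "0 \<le> Re s" "Re s \<le> m1" for s
  proof -
    have "b * (T * P) = T * e / \<rho>" if "\<rho> \<noteq> 0" "\<rho> * P * b = e" for \<rho> P b e T :: complex
      using that by (auto simp: field_simps)
    from this[OF r1' c[OF that, unfolded hA_def]] show ?thesis unfolding Qc_PA c'_def .
  qed
  have Qc_hol: "Qc holomorphic_on S" for S unfolding Qc_def by (intro holomorphic_intros)
  let ?D = "\<lambda>y. boundary_laplace1 y * Qc y - c'"
  have D_hol: "?D holomorphic_on {y. Re y < 0}"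
    by (intro holomorphic_intros boundary_laplace_holomorphic_on Qc_hol)
  \<comment> \<open>The line \<open>Re s = m1/2\<close> is mapped onto the half-line \<open>y \<le> -m1\<^sup>2/2\<close>.\<close>
  have D_real: "?D (of_real t) = 0" if "t \<le> - (m1\<^sup>2 / 2)" for t
  proof -
    define b where "b = sqrt (- t / 2 - m1\<^sup>2 / 4)"
    have b: "b\<^sup>2 = - t / 2 - m1\<^sup>2 / 4" unfolding b_def using that by (intro real_sqrt_pow2) simp
    have "y_param (Complex (m1 / 2) b) = of_real t"
      using b by (simp add: y_param_def complex_eq_iff power2_eq_square field_simps)
    then show ?thesis using on_strip[of "Complex (m1 / 2) b"] mu by simp
  qed
  have D_open: "?D y = 0" if "Re y < 0" for y
  proof -
    let ?U = "complex_of_real ` {..- (m1\<^sup>2 / 2)}"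
    \<comment> \<open>An arbitrary interior point of the half-line.\<close>
    let ?\<xi> = "complex_of_real (- (m1\<^sup>2))"
    have m1sq: "0 < m1\<^sup>2" using mu by simp
    have conn: "connected {y::complex. Re y < 0}" by (intro convex_connected convex_halfspace_Re_lt)
    have sub: "?U \<subseteq> {y. Re y < 0}"
    proof
      fix z assume "z \<in> ?U"
      then obtain x where x: "z = of_real x" "x \<le> - (m1\<^sup>2 / 2)" by auto
      have "- (m1\<^sup>2 / 2) < 0" using m1sq by simp
      then have "x < 0" using x(2) by (rule le_less_trans[rotated])
      then show "z \<in> {y. Re y < 0}" using x(1) by simp
    qed
    have mem: "?\<xi> \<in> {y. Re y < 0}" using m1sq by simp
    have lim: "?\<xi> islimpt ?U"
      unfolding islimpt_approachable
    proof (intro allI impI)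
      fix e :: real assume e: "e > 0"
      define x where "x = - (m1\<^sup>2) - e / 2"
      have x: "x \<le> - (m1\<^sup>2 / 2)" "x \<noteq> - (m1\<^sup>2)" "\<bar>x - - (m1\<^sup>2)\<bar> < e"
        unfolding x_def using e m1sq by linarith+
      have "of_real x \<in> ?U" using x(1) by blast
      moreover have "of_real x \<noteq> ?\<xi>" using x(2) by (simp only: of_real_eq_iff not_False_eq_True)
      moreover have "dist (complex_of_real x) ?\<xi> < e"
        using x(3) by (simp only: dist_of_real dist_real_def)
      ultimately show "\<exists>x'\<in>?U. x' \<noteq> ?\<xi> \<and> dist x' ?\<xi> < e" by blast
    qed
    have zero: "?D z = 0" if "z \<in> ?U" for z using that D_real by auto
    show ?thesis
      by (rule analytic_continuation[OF D_hol open_halfspace_Re_lt conn sub mem lim zero]) (use that in auto)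
  qed
  show ?thesis
  proof (rule that)
    fix y :: complex assume y: "Re y \<le> 0"
    let ?u = "\<lambda>k. y - of_real (inverse (real (Suc k)))"
    have "?u \<longlonglongrightarrow> y - of_real 0" by (intro tendsto_intros LIMSEQ_inverse_real_of_nat)
    then have u: "?u \<longlonglongrightarrow> y" by simp
    have neg: "Re (?u k) < 0" for k
    proof -
      have "0 < inverse (real (Suc k))" by simp
      then show ?thesis using y unfolding minus_complex.sel Re_complex_of_real by linarith
    qed
    have "continuous_on {y. Re y \<le> 0} ?D"
      by (intro continuous_intros boundary_laplace_continuous_on holomorphic_on_imp_continuous_on[OF Qc_hol])
    from continuous_on_tendsto_compose[OF this u]
    have "(\<lambda>k. ?D (?u k)) \<longlonglongrightarrow> ?D y" using y neg by (auto intro: less_imp_le always_eventually)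
    moreover have "(\<lambda>k. ?D (?u k)) = (\<lambda>k. 0)" using D_open[OF neg] by blast
    ultimately have "?D y = 0" by (metis LIMSEQ_unique tendsto_const)
    then show "boundary_laplace1 y * (\<Prod>k<n. y - of_real (y_curve m1 (s_one r1 m1 m2 - real k))) = c'"
      by (simp add: Qc_def)
  qed
qed

text \<open>
  This uses \<open>n \<ge> 1\<close>: at least one factor of the product grows.
\<close>

lemma boundary_laplace1_decay:
  fixes a :: "nat \<Rightarrow> real"
  assumes n: "n \<ge> 1" and c: "\<And>y. Re y \<le> 0 \<Longrightarrow> boundary_laplace1 y * (\<Prod>k<n. y - of_real (a k)) = c"
  shows "(\<lambda>j. boundary_laplace1 (- of_nat j)) \<longlonglongrightarrow> 0"
proof -
  have "\<forall>\<^sub>F j in sequentially. \<forall>k\<in>{..<n}. a k \<noteq> - real j"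
  proof (rule eventually_ball_finite)
    show "\<forall>k\<in>{..<n}. \<forall>\<^sub>F j in sequentially. a k \<noteq> - real j"
    proof
      fix k
      obtain j0 :: nat where "- a k < real j0" using reals_Archimedean2 by blast
      then show "\<forall>\<^sub>F j in sequentially. a k \<noteq> - real j"
        by (intro eventually_sequentiallyI[of j0]) auto
    qed
  qed simp
  then have ev: "\<forall>\<^sub>F j in sequentially. c * (\<Prod>k<n. of_real (inverse (- real j - a k))) = boundary_laplace1 (- of_nat j)"
  proof eventually_elim
    case (elim j)
    have nz: "(\<Prod>k<n. - of_nat j - complex_of_real (a k)) \<noteq> 0"
    proof -
      have "- of_nat j - complex_of_real (a k) \<noteq> 0" if "k < n" for k
      proof
        assume "- of_nat j - complex_of_real (a k) = 0"
        then have "complex_of_real (a k) = of_real (- real j)" by (simp add: algebra_simps)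
        then show False using elim that by (simp only: of_real_eq_iff) auto
      qed
      then show ?thesis by simp
    qed
    have "(\<Prod>k<n. complex_of_real (inverse (- real j - a k))) = inverse (\<Prod>k<n. - of_nat j - complex_of_real (a k))"
      unfolding prod_inversef[symmetric] by (intro prod.cong refl) simp
    moreover have "boundary_laplace1 (- of_nat j) * (\<Prod>k<n. - of_nat j - complex_of_real (a k)) = c"
      by (rule c) simp
    ultimately show ?case using nz by (auto simp: field_simps)
  qed
  have "(\<lambda>j. inverse (- real j - x)) \<longlonglongrightarrow> 0" for x by real_asymp
  then have "(\<lambda>j. c * (\<Prod>k<n. of_real (inverse (- real j - a k)))) \<longlonglongrightarrow> c * (\<Prod>k<n. of_real 0)"
    by (intro tendsto_intros)
  then have "(\<lambda>j. boundary_laplace1 (- of_nat j)) \<longlonglongrightarrow> c * (\<Prod>k<n. of_real 0)"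
    by (rule Lim_transform_eventually[OF _ ev])
  moreover have "c * (\<Prod>k<n. of_real 0) = 0" using n by (simp add: power_0_left)
  ultimately show ?thesis by (simp only:)
qed

text \<open>
  The transform at a real point integrates a strictly positive function, so it can only vanish for the zero
  measure.
\<close>

lemma boundary_laplace1_zero_everywhere:
  assumes "boundary_laplace1 (of_real t) = 0" and le: "t \<le> 0"
  shows "boundary_laplace1 y = 0"
proof -
  let ?Z = "\<lambda>p. G (C1.passage p) (fst p) $ 2"
  have [measurable]: "?Z \<in> borel_measurable C1.clock" by (rule G_at_passage_measurable)
  interpret N: finite_measure C1.clock by (rule finite_clock1)
  have t: "exp (complex_of_real t * of_real x) = of_real (exp (t * x))" for x
    by (simp only: of_real_mult[symmetric] exp_of_real)
  have "(\<integral>p. exp (min t 0 * ?Z p) \<partial>C1.clock) = 0"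
    using assms le unfolding boundary_laplace1_def t integral_complex_of_real by (simp add: min_absorb1)
  moreover have "integrable C1.clock (\<lambda>p. exp (min t 0 * ?Z p))"
    by (rule N.integrable_const_bound[where B = 1])
      (auto intro!: AE_I2 mult_nonpos_nonneg G_at_passage_nonneg)
  ultimately have "AE p in C1.clock. exp (min t 0 * ?Z p) = 0"
    by (subst (asm) integral_nonneg_eq_0_iff_AE) auto
  then have "AE p in C1.clock. exp (y * of_real (?Z p)) = 0"
    by eventually_elim simp
  then show ?thesis
    unfolding boundary_laplace1_def by (rule integral_eq_zero_AE)
qed

end

theorem theorem46:
  fixes M :: "'a measure" and F :: "real \<Rightarrow> 'a measure"
    and W G L :: "real \<Rightarrow> 'a \<Rightarrow> real^2"
    and \<pi> :: "(real^2) measure"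
    and r1 r2 \<mu>1 \<mu>2 :: real and n :: nat
  assumes "\<mu>1 > 0" and "\<mu>2 > 0" and "\<mu>1 + \<mu>2 = 1"
    and "1 - r1 * r2 > 0 \<or> (r1 > 0 \<and> r2 > 0)"
    and "\<mu>1 - r2 * \<mu>2 > 0" and "\<mu>2 - r1 * \<mu>1 > 0"
    and "r1 \<noteq> -1" and "r2 \<noteq> -1"
    and "degenerate_reflected_bm M F W r1 r2 \<mu>1 \<mu>2 G L"
    and "started_from_invariant M G \<pi>"
    and "n \<ge> 1" and "gamma_par r1 r2 \<mu>1 \<mu>2 = - real n"
  shows "\<exists>(Q :: real poly) (c :: real).
    degree Q = n \<and>
    (\<forall>y. poly Q y = (\<Prod>k=0..n-1. y - y_curve \<mu>1 (s_one r1 \<mu>1 \<mu>2 - real k))) \<and>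
    (\<forall>y :: complex. Re y \<le> 0 \<longrightarrow>
       laplace_transform (lateral_measure1 M G L) y =
         of_real c / poly (map_poly of_real Q) y)"
proof -
  interpret D: degenerate_reflected_bm M F W r1 r2 \<mu>1 \<mu>2 G L by fact
  have d: "1 - r1 * r2 \<noteq> 0"
  proof
    assume "1 - r1 * r2 = 0"
    then have "gamma_par r1 r2 \<mu>1 \<mu>2 = 0" using gamma_par_eq[OF assms(3,7,8)] by simp
    then show False using assms(11,12) by simp
  qed
  obtain G' L' where reg: "stationary_reflected_process M G' L' r1 r2 \<mu>1 \<mu>2"
    and ae: "AE \<omega> in M. \<forall>t. G' t \<omega> = G t \<omega> \<and> L' t \<omega> = L t \<omega>"
    by (rule D.regular_version[OF assms(10) d])
  interpret R: stationary_reflected_process M G' L' r1 r2 \<mu>1 \<mu>2 by (rule reg)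
  have lateral: "lateral_measure1 M G L = lateral_measure1 M G' L'"
  proof -
    have "(\<integral>\<^sup>+ \<omega>. (\<integral>\<^sup>+ t\<in>{0..2}. indicator A (G t \<omega> $ 2) \<partial>path_measure (\<lambda>t. L t \<omega> $ 1)) \<partial>M) =
      (\<integral>\<^sup>+ \<omega>. (\<integral>\<^sup>+ t\<in>{0..2}. indicator A (G' t \<omega> $ 2) \<partial>path_measure (\<lambda>t. L' t \<omega> $ 1)) \<partial>M)" for A
      by (rule nn_integral_cong_AE) (use ae in eventually_elim, simp only:)
    then show ?thesis unfolding lateral_measure1_def by (simp only:)
  qed
  define a where "a = (\<lambda>k. y_curve \<mu>1 (s_one r1 \<mu>1 \<mu>2 - real k))"
  define Q where "Q = (\<Prod>k<n. [:- a k, 1:])"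
  have gap: "s_two r2 \<mu>1 \<mu>2 = s_one r1 \<mu>1 \<mu>2 - real n"
    using assms(12) by (simp add: gamma_par_def)
  obtain c where c: "\<And>y. Re y \<le> 0 \<Longrightarrow> R.boundary_laplace1 y * (\<Prod>k<n. y - of_real (a k)) = c"
    using R.boundary_laplace1_times_product[OF assms(3,1,2,7,8) gap] unfolding a_def by blast
  have laplace: "laplace_transform (lateral_measure1 M G L) y = R.boundary_laplace1 y" for y
    unfolding lateral
    by (rule R.laplace_lateral_measure1_eq_boundary_laplace1[OF R.boundary_laplace1_decay[OF assms(11) c]])
  have range: "{0..n - 1} = {..<n}" using assms(11) by auto
  have polyQ: "poly Q y = (\<Prod>k<n. y - a k)" for y
    unfolding Q_def poly_prod by (intro prod.cong) auto
  have degQ: "degree Q = n"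
    unfolding Q_def by (subst degree_prod_sum_eq) auto
  have mapQ: "poly (map_poly of_real Q) y = (\<Prod>k<n. y - complex_of_real (a k))" for y
  proof -
    have "map_poly complex_of_real Q = (\<Prod>k<n. [:- complex_of_real (a k), 1:])"
      unfolding Q_def
    proof (induction n)
      case (Suc n)
      have hom: "map_poly complex_of_real (p * q) = map_poly of_real p * map_poly of_real q" for p q
        by (rule poly_eqI) (simp add: coeff_map_poly coeff_mult)
      have lin: "map_poly complex_of_real [:- a n, 1:] = [:- complex_of_real (a n), 1:]"
        by (simp add: map_poly_pCons)
      show ?case unfolding prod.lessThan_Suc hom Suc lin by (rule refl)
    qed simp
    then show ?thesis by (simp add: poly_prod)
  qed
  have c_real: "c = of_real (Re c)"
  proof -
    \<comment> \<open>At \<open>y = 0\<close> both factors are real.\<close>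
    have "R.boundary_laplace1 0 = of_real (measure R.C1.clock (space R.C1.clock))"
      by (simp add: R.boundary_laplace1_def scaleR_conv_of_real)
    then have "c = of_real (measure R.C1.clock (space R.C1.clock) * (\<Prod>k<n. - a k))"
      using c[of 0] by simp
    then show ?thesis by (metis Re_complex_of_real)
  qed
  have quotient: "R.boundary_laplace1 y = of_real (Re c) / (\<Prod>k<n. y - of_real (a k))" if y: "Re y \<le> 0" for y
  proof (cases "(\<Prod>k<n. y - complex_of_real (a k)) = 0")
    case False
    then show ?thesis using c[OF y] c_real by (metis nonzero_mult_div_cancel_right)
  next
    case True
    then have c0: "c = 0" using c[OF y] by (simp only: mult_zero_right)
    \<comment> \<open>The constant is zero here, so the transform vanishes to the left of all zeros of \<open>Q\<close>, hence
    everywhere; the quotient is then \<open>0 / 0 = 0\<close>.\<close>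
    define t where "t = - 1 - (\<Sum>k<n. \<bar>a k\<bar>)"
    have t: "t \<le> 0" "\<And>k. k < n \<Longrightarrow> t < a k"
    proof -
      have "0 \<le> (\<Sum>k<n. \<bar>a k\<bar>)" by (intro sum_nonneg) simp
      then show "t \<le> 0" unfolding t_def by linarith
      fix k assume "k < n"
      then have "\<bar>a k\<bar> \<le> (\<Sum>k<n. \<bar>a k\<bar>)" by (intro member_le_sum) auto
      then show "t < a k" unfolding t_def by linarith
    qed
    have "(\<Prod>k<n. complex_of_real t - of_real (a k)) \<noteq> 0"
      using t(2) by (auto simp flip: of_real_diff)
    then have "R.boundary_laplace1 (of_real t) = 0" using c[of "of_real t"] t(1) c0 by simp
    then have "R.boundary_laplace1 y = 0" using t(1) by (rule R.boundary_laplace1_zero_everywhere)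
    then show ?thesis using True by simp
  qed
  show ?thesis
    by (intro exI[of _ Q] exI[of _ "Re c"] conjI allI impI)
      (simp_all only: degQ polyQ range laplace mapQ quotient a_def)
qed

end
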